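(* Let $0\le\alpha<3/2$ and let $q\in W^{\alpha,2}(\mathbb{R}^3)$ be compactly supported. Then the high frequency quartic term $\widetilde Q_4(q)$ belongs to $W^{\beta,2}(\mathbb{R}^3)$ for every $\beta$ with $0\le\beta<\alpha+\tfrac12$.
   Context: Here $n=3$. Fourier transform: $\hat f(\xi)=\mathcal F f(\xi)=\int_{\mathbb{R}^n}e^{-i\xi\cdot x}f(x)\,dx$. $W^{\alpha,2}(\mathbb{R}^n)=\{f\in\mathcal S'(\mathbb{R}^n): (1+|\cdot|^2)^{\alpha/2}\hat f\in L^2(\mathbb{R}^n)\}$. For $k>0$ the outgoing resolvent $R_k$ is defined by $\widehat{R_k(f)}(\xi)=(-|\xi|^2+k^2+i0)^{-1}\hat f(\xi)$. For $j\ge2$, the $j$-th term $Q_j(q)$ is defined by $$\widehat{Q_j(q)}(\xi)=\int_{\mathbb{R}^n}e^{ik\theta\cdot y}(qR_k)^{j-1}\big(q(\cdot)e^{ik\theta\cdot(\cdot)}\big)(y)\,dy,\qquad k=|\xi|/2,\ \theta=-\xi/|\xi|.$$ Its high frequency version is $\widetilde Q_j(q)=\mathcal F^{-1}\big(\chi^*(|\cdot|/2)\,\widehat{Q_j(q)}(\cdot)\big)$, where $\chi^*\in C^\infty(\mathbb{R})$, $\chi^*(t)=1$ for $t\ge 2C_0$, $\chi^*(t)=0$ for $t<C_0$, and $C_0$ is a fixed constant with $C_0>\max\{(2\|q\|_{W^{\alpha,2}})^4,1\}$. *)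

theory Defs
  imports "HOL-Analysis.Analysis"
begin

section \<open>Schwartz functions and tempered distributions\<close>

definition dir_deriv :: "'a::euclidean_space \<Rightarrow> ('a \<Rightarrow> complex) \<Rightarrow> 'a \<Rightarrow> complex" where
  "dir_deriv v f = (\<lambda>x. frechet_derivative f (at x) v)"

text \<open>A list of basis vectors plays the role of a multi-index.\<close>

definition partials :: "'a::euclidean_space list \<Rightarrow> ('a \<Rightarrow> complex) \<Rightarrow> 'a \<Rightarrow> complex" where
  "partials vs f = foldr dir_deriv vs f"

definition schwartz :: "('a::euclidean_space \<Rightarrow> complex) set" where
  "schwartz = {f. \<forall>vs. set vs \<subseteq> Basis \<longrightarrow>
     (\<forall>x. partials vs f differentiable (at x)) \<and>
     (\<forall>N::nat. bounded (range (\<lambda>x. (1 + norm x) ^ N *\<^sub>R partials vs f x)))}"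

definition schwartz_seminorm :: "nat \<Rightarrow> ('a::euclidean_space \<Rightarrow> complex) \<Rightarrow> real" where
  "schwartz_seminorm N f =
     (SUP (vs, x) \<in> {vs. set vs \<subseteq> Basis \<and> length vs \<le> N} \<times> UNIV.
        (1 + norm x) ^ N * norm (partials vs f x))"

text \<open>
  Distributions are functionals on functions of which only the values on
  \<^const>\<open>schwartz\<close> are meaningful.
\<close>

type_synonym 'a distribution = "('a \<Rightarrow> complex) \<Rightarrow> complex"

definition tempered :: "'a::euclidean_space distribution \<Rightarrow> bool" where
  "tempered T \<longleftrightarrow>
     (\<forall>f\<in>schwartz. \<forall>g\<in>schwartz. T (\<lambda>x. f x + g x) = T f + T g) \<and>
     (\<forall>c. \<forall>f\<in>schwartz. T (\<lambda>x. c * f x) = c * T f) \<and>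
     (\<exists>N C. \<forall>f\<in>schwartz. norm (T f) \<le> C * schwartz_seminorm N f)"

definition dist_of :: "('a::euclidean_space \<Rightarrow> complex) \<Rightarrow> 'a distribution" where
  "dist_of u = (\<lambda>f. LINT x|lborel. u x * f x)"

definition tempered_function :: "('a::euclidean_space \<Rightarrow> complex) \<Rightarrow> bool" where
  "tempered_function u \<longleftrightarrow>
     u \<in> borel_measurable borel \<and>
     (\<forall>f\<in>schwartz. integrable lborel (\<lambda>x. u x * f x)) \<and>
     tempered (dist_of u)"

definition mult_dist :: "('a::euclidean_space \<Rightarrow> complex) \<Rightarrow> 'a distribution \<Rightarrow> 'a distribution" where
  "mult_dist m T = (\<lambda>f. T (\<lambda>x. m x * f x))"


section \<open>Fourier transform\<close>

definition fourier :: "('a::euclidean_space \<Rightarrow> complex) \<Rightarrow> 'a \<Rightarrow> complex" where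
  "fourier f \<xi> = (LINT x|lborel. cis (- (\<xi> \<bullet> x)) * f x)"

definition inv_fourier :: "('a::euclidean_space \<Rightarrow> complex) \<Rightarrow> 'a \<Rightarrow> complex" where
  "inv_fourier f x =
     of_real (1 / (2 * pi) ^ DIM('a)) * (LINT \<xi>|lborel. cis (\<xi> \<bullet> x) * f \<xi>)"

definition fourier_dist :: "'a::euclidean_space distribution \<Rightarrow> 'a distribution" where
  "fourier_dist T = (\<lambda>f. T (fourier f))"

definition inv_fourier_dist :: "'a::euclidean_space distribution \<Rightarrow> 'a distribution" where
  "inv_fourier_dist T = (\<lambda>f. T (inv_fourier f))"


section \<open>Sobolev spaces\<close>

definition L2_function :: "('a::euclidean_space \<Rightarrow> complex) \<Rightarrow> bool" where
  "L2_function h \<longleftrightarrow>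
     h \<in> borel_measurable borel \<and> integrable lborel (\<lambda>x. (norm (h x))\<^sup>2)"

definition represented_L2 :: "'a::euclidean_space distribution \<Rightarrow> ('a \<Rightarrow> complex) \<Rightarrow> bool" where
  "represented_L2 T h \<longleftrightarrow> L2_function h \<and> (\<forall>f\<in>schwartz. T f = dist_of h f)"

definition bessel_fourier :: "real \<Rightarrow> 'a::euclidean_space distribution \<Rightarrow> 'a distribution" where
  "bessel_fourier \<alpha> T =
     mult_dist (\<lambda>\<xi>. of_real ((1 + (norm \<xi>)\<^sup>2) powr (\<alpha> / 2))) (fourier_dist T)"

definition sobolev :: "real \<Rightarrow> 'a::euclidean_space distribution set" where
  "sobolev \<alpha> = {T. tempered T \<and> (\<exists>h. represented_L2 (bessel_fourier \<alpha> T) h)}"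

text \<open>The representing function is unique up to null sets, so the choice is immaterial.\<close>

definition sobolev_norm :: "real \<Rightarrow> 'a::euclidean_space distribution \<Rightarrow> real" where
  "sobolev_norm \<alpha> T =
     (let h = (SOME h. represented_L2 (bessel_fourier \<alpha> T) h)
      in sqrt (LINT \<xi>|lborel. (norm (h \<xi>))\<^sup>2))"


section \<open>Outgoing resolvent\<close>

text \<open>
  The boundary value \<open>(-|\<xi>|\<^sup>2 + k\<^sup>2 + i0)\<^sup>-\<^sup>1\<close> is the limit, in the sense of
  tempered distributions, of the smooth multipliers with \<open>i\<epsilon>\<close> as \<open>\<epsilon>\<close> decreases to \<open>0\<close>.
  The resolvent of \<open>f\<close> is a function, determined up to null sets, whose Fourier transform is
  the limit of the products with the Fourier transform of \<open>f\<close>.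
\<close>

definition is_outgoing_resolvent ::
  "real \<Rightarrow> ('a::euclidean_space \<Rightarrow> complex) \<Rightarrow> ('a \<Rightarrow> complex) \<Rightarrow> bool" where
  "is_outgoing_resolvent k f u \<longleftrightarrow>
     tempered_function u \<and>
     (\<forall>\<phi>\<in>schwartz.
        ((\<lambda>\<epsilon>. mult_dist (\<lambda>\<xi>. inverse (Complex (- (norm \<xi>)\<^sup>2 + k\<^sup>2) \<epsilon>))
                 (fourier_dist (dist_of f)) \<phi>)
          \<longlongrightarrow> fourier_dist (dist_of u) \<phi>) (at_right 0))"

definition resolvent ::
  "real \<Rightarrow> ('a::euclidean_space \<Rightarrow> complex) \<Rightarrow> 'a \<Rightarrow> complex" where
  "resolvent k f = (SOME u. is_outgoing_resolvent k f u)"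


section \<open>Terms of the Born series for backscattering\<close>

text \<open>
  At \<open>\<xi> = 0\<close> the value is irrelevant: the cutoff below vanishes near the origin.
\<close>

definition Q_hat :: "nat \<Rightarrow> ('a::euclidean_space \<Rightarrow> complex) \<Rightarrow> 'a \<Rightarrow> complex" where
  "Q_hat j q \<xi> =
     (let k = norm \<xi> / 2; \<theta> = - (\<xi> /\<^sub>R norm \<xi>)
      in LINT y|lborel. cis (k * (\<theta> \<bullet> y)) *
           ((\<lambda>g x. q x * resolvent k g x) ^^ (j - 1)) (\<lambda>x. q x * cis (k * (\<theta> \<bullet> x))) y)"

definition Q_high ::
  "(real \<Rightarrow> real) \<Rightarrow> nat \<Rightarrow> ('a::euclidean_space \<Rightarrow> complex) \<Rightarrow> 'a distribution" where
  "Q_high \<kappa> j q =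
     inv_fourier_dist (dist_of (\<lambda>\<xi>. of_real (\<kappa> (norm \<xi> / 2)) * Q_hat j q \<xi>))"

definition smooth_real :: "(real \<Rightarrow> real) \<Rightarrow> bool" where
  "smooth_real \<kappa> \<longleftrightarrow> (\<forall>n t. (deriv ^^ n) \<kappa> differentiable (at t))"

definition high_frequency_cutoff :: "real \<Rightarrow> (real \<Rightarrow> real) \<Rightarrow> bool" where
  "high_frequency_cutoff C\<^sub>0 \<kappa> \<longleftrightarrow>
     smooth_real \<kappa> \<and> (\<forall>t\<ge>2 * C\<^sub>0. \<kappa> t = 1) \<and> (\<forall>t<C\<^sub>0. \<kappa> t = 0)"

definition compactly_supported :: "('a::euclidean_space \<Rightarrow> complex) \<Rightarrow> bool" where
  "compactly_supported q \<longleftrightarrow> (\<exists>K. compact K \<and> (AE x in lborel. x \<notin> K \<longrightarrow> q x = 0))"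

end

theory Submission
  imports Defs "HOL-Probability.Probability"
begin

text \<open>
  The outgoing resolvent is the convolution with a Helmholtz kernel. Since \<open>q\<close> has compact
  support the kernel may be truncated, and the Fourier transform of the truncated kernel is a
  function bounded, up to a constant, by \<open>M(p) = 1 / ((1 + |p|) (1 + ||p| - k|))\<close>. Hence the
  Fourier transform of the quartic term at \<open>\<xi>\<close> is an iterated integral over three intermediate
  momenta, and the four momentum transfers add up to \<open>\<xi>\<close>, where \<open>|\<xi>| = 2k\<close>. So one of them has
  length at least \<open>k / 2\<close>, and the Sobolev regularity of \<open>q\<close> yields a factor \<open>k\<^sup>-\<^sup>\<alpha>\<close>.

  The operator with kernel \<open>M(p)\<^sup>1\<^sup>/\<^sup>2 |q^(p - p')| M(p')\<^sup>1\<^sup>/\<^sup>2\<close> has norm \<open>O(k\<^sup>-\<^sup>1\<^sup>/\<^sup>2\<^sup>+\<^sup>\<delta>)\<close>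
  on \<open>L\<^sup>2\<close>: by duality this is a bilinear convolution estimate, in which differences are traded
  for sums. If \<open>p\<close> and \<open>p'\<close> lie in one octant, then both are at most as long as \<open>p + p'\<close>, and
  bipolar coordinates control the intersection of the two shells. Together with \<open>M \<le> 1 / k\<close>
  this bounds the Fourier transform of the quartic term pointwise by \<open>C |\<xi>|\<^sup>-\<^sup>2\<^sup>-\<^sup>\<alpha>\<^sup>+\<^sup>2\<^sup>\<delta>\<close>,
  which suffices in dimension three because \<open>\<beta> < \<alpha> + 1/2\<close>.
\<close>

section \<open>Spherical and bipolar coordinates\<close>

text \<open>The obstacle is a pair of nearly tangent shells. For a short difference \<zeta> the
  points p and p - \<zeta> can both lie on the shell, and nothing offsets the factor 1 / |\<zeta>|
  of bipolar coordinates. For a short sum \<zeta> within one octant both points are short, hence far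
  from the shell, and each radial integral is O(|\<zeta>| / k). Passing through autocorrelations
  puts both points into one octant even if the two functions live in different ones.

  The powers of k: the three weights M make six square roots. The two outermost are O(k^(-1/2))
  each, and the other four belong to two operators of norm O(k^(-1/2 + \<delta>)), in total k^(-2 +
  2 \<delta>). Here \<delta> absorbs the logarithm in the integral of 1 / (1 + |r - k|).

  The resolvent is given by a distributional limit and a choice. It has to be identified, up to null
  sets, with an integral operator before anything can be estimated; Fourier inversion and uniqueness
  for tempered functions serve this purpose. Inversion also drives each step of the iteration, under
  an integrability condition that must be propagated.\<close>

lemma lborel_distr_orthogonal:
  fixes A :: "real ^ 'n::{finite,wellorder} \<Rightarrow> real ^ 'n::{finite,wellorder}"
  assumes A: "orthogonal_transformation A"
  shows "distr lborel borel A = lborel"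
proof (rule sym, rule lborel_eqI)
  have lin: "linear A" using A by (rule orthogonal_transformation_linear)
  have [measurable]: "A \<in> borel_measurable borel"
    by (intro borel_measurable_continuous_onI linear_continuous_on linear_linear[THEN iffD2] lin)
  fix l u :: "real ^ 'n::{finite,wellorder}"
  assume le: "\<And>b. b \<in> Basis \<Longrightarrow> l \<bullet> b \<le> u \<bullet> b"
  have bij: "bij A" using A by (rule orthogonal_transformation_bij)
  have inv: "orthogonal_transformation (inv A)" using A by (rule orthogonal_transformation_inv)
  have eq: "A -` box l u = inv A ` box l u" using bij by (rule bij_vimage_eq_inv_image)
  have m: "measure lebesgue (inv A ` box l u) = measure lebesgue (box l u)"
    by (rule measure_orthogonal_image[OF inv]) simp
  have lm: "inv A ` box l u \<in> lmeasurable"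
    by (rule measurable_orthogonal_image[OF inv]) simp
  have b: "A -` box l u \<in> sets borel"
    by (rule borel_open, rule continuous_open_vimage)
       (auto intro!: linear_continuous_at simp: linear_linear lin linear_continuous_on)
  have "emeasure (distr lborel borel A) (box l u) = emeasure lborel (A -` box l u)"
    by (subst emeasure_distr) auto
  also have "\<dots> = emeasure lebesgue (A -` box l u)"
    using b by simp
  also have "\<dots> = ennreal (measure lebesgue (box l u))"
    using lm m eq by (simp add: emeasure_eq_measure2)
  also have "\<dots> = (\<Prod>b\<in>Basis. (u - l) \<bullet> b)"
    using le by (simp add: measure_lborel_box_eq measure_completion)
  finally show "emeasure (distr lborel borel A) (box l u) = (\<Prod>b\<in>Basis. (u - l) \<bullet> b)" .
qed simp

text \<open>The nested pair lets Fubini separate the plane of the first two coordinates, where discs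
  have a known area, from the third axis.\<close>

definition vec3 :: "(real \<times> real) \<times> real \<Rightarrow> real ^ 3" where
  "vec3 p = (\<chi> i. if i = 1 then fst (fst p) else if i = 2 then snd (fst p) else snd p)"

lemma vec3_nth [simp]: "vec3 p $ 1 = fst (fst p)" "vec3 p $ 2 = snd (fst p)" "vec3 p $ 3 = snd p"
  by (simp_all add: vec3_def)

lemma continuous_vec3: "continuous_on S vec3"
proof -
  have "continuous_on S (\<lambda>p. if i = 1 then fst (fst p) else if i = 2 then snd (fst p) else snd p)" for i :: 3
    by (cases "i = 1"; cases "i = 2") (auto intro!: continuous_intros)
  then show ?thesis
    unfolding vec3_def by (rule continuous_on_vec_lambda)
qed

lemma borel_measurable_vec3 [measurable]: "vec3 \<in> borel_measurable borel"
  by (intro borel_measurable_continuous_onI continuous_vec3)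

lemma distr_vec3: "distr lborel borel vec3 = lborel"
proof (rule sym, rule lborel_eqI)
  have prod3: "(\<Prod>i\<in>UNIV. f i) = f 1 * f 2 * f (3::3)" for f :: "3 \<Rightarrow> real"
    unfolding UNIV_3 by (simp add: mult.assoc)
  fix l u :: "real ^ 3"
  assume le: "\<And>b. b \<in> Basis \<Longrightarrow> l \<bullet> b \<le> u \<bullet> b"
  have le': "l $ i \<le> u $ i" for i
    using le[of "axis i 1"] by (simp add: inner_axis)
  have eq: "vec3 -` box l u = ({l$1<..<u$1} \<times> {l$2<..<u$2}) \<times> {l$3<..<u$3}"
    by (auto simp: mem_box_cart forall_3)
  have "emeasure (distr lborel borel vec3) (box l u) = emeasure lborel (vec3 -` box l u)"
    by (subst emeasure_distr) auto
  also have "\<dots> = emeasure ((lborel \<Otimes>\<^sub>M lborel) \<Otimes>\<^sub>M lborel) (({l$1<..<u$1} \<times> {l$2<..<u$2}) \<times> {l$3<..<u$3})"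
    by (simp add: eq lborel_prod)
  also have "\<dots> = ennreal (u$1 - l$1) * ennreal (u$2 - l$2) * ennreal (u$3 - l$3)"
    using le' by (simp add: lborel.emeasure_pair_measure_Times lborel_prod[symmetric])
  also have "\<dots> = ennreal (\<Prod>i\<in>UNIV. (u - l) $ i)"
    using le'[of 1] le'[of 2] le'[of 3]
    by (simp add: prod3 ennreal_mult mult_nonneg_nonneg)
  also have "(\<Prod>i\<in>UNIV. (u - l) $ i) = (\<Prod>b\<in>Basis. (u - l) \<bullet> b)"
  proof -
    have B: "(Basis :: (real^3) set) = range (\<lambda>i. axis i 1)" by (auto simp: Basis_vec_def)
    show ?thesis
      unfolding B by (subst prod.reindex) (auto simp: inj_on_def axis_eq_axis inner_axis)
  qed
  finally show "emeasure (distr lborel borel vec3) (box l u) = (\<Prod>b\<in>Basis. (u - l) \<bullet> b)" .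
qed simp

lemma emeasure_disc:
  assumes "0 \<le> t"
  shows "emeasure lborel {p::real\<times>real. (norm p)\<^sup>2 \<le> t} = ennreal (pi * t)"
proof -
  have "{p::real\<times>real. (norm p)\<^sup>2 \<le> t} = cball 0 (sqrt t)"
    by (auto simp: mem_cball) (metis abs_norm_cancel real_sqrt_abs real_sqrt_le_iff)+
  then show ?thesis
    using assms by (simp add: emeasure_cball unit_ball_vol_2 DIM_prod)
qed

text \<open>The area of a disc is linear in its squared radius, so the squared radius has constant
  density pi on the half-line. This takes the place of polar coordinates in the plane.\<close>

lemma distr_norm_sq_disc:
  "distr (lborel::(real\<times>real) measure) borel (\<lambda>p. (norm p)\<^sup>2)
     = density lborel (\<lambda>t. ennreal (pi * indicator {0..} t))"
proof (rule measure_eqI_generator_eq)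
  let ?E = "range (\<lambda>a::real. {..a})"
  let ?A = "\<lambda>n::nat. {..real n}"
  have dens: "emeasure (density lborel (\<lambda>t. ennreal (pi * indicator {0..} t))) {..a} = ennreal (pi * max 0 a)" for a :: real
  proof -
    have "emeasure (density lborel (\<lambda>t. ennreal (pi * indicator {0..} t))) {..a}
       = (\<integral>\<^sup>+ t. ennreal pi * indicator {0..a} t \<partial>lborel)"
      by (subst emeasure_density) (auto intro!: nn_integral_cong split: split_indicator)
    also have "\<dots> = ennreal pi * emeasure lborel {0..a}"
      by (subst nn_integral_cmult_indicator) auto
    also have "\<dots> = ennreal (pi * max 0 a)"
      by (simp add: emeasure_lborel_Icc_eq ennreal_mult max_def)
    finally show ?thesis .
  qed
  have dist: "emeasure (distr (lborel::(real\<times>real) measure) borel (\<lambda>p. (norm p)\<^sup>2)) {..a} = ennreal (pi * max 0 a)" for a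
  proof -
    have "emeasure (distr (lborel::(real\<times>real) measure) borel (\<lambda>p. (norm p)\<^sup>2)) {..a}
      = emeasure lborel {p::real\<times>real. (norm p)\<^sup>2 \<le> a}"
      by (subst emeasure_distr) (auto simp: vimage_def)
    also have "\<dots> = ennreal (pi * max 0 a)"
    proof (cases "0 \<le> a")
      case True then show ?thesis by (simp add: emeasure_disc)
    next
      case False
      then have eq: "{p::real\<times>real. (norm p)\<^sup>2 \<le> a} = {}"
        by (auto simp: not_le intro: less_le_trans[OF _ zero_le_power2])
      show ?thesis unfolding eq using False by simp
    qed
    finally show ?thesis .
  qed
  show "Int_stable ?E" by (auto simp: Int_stable_def)
  show "?E \<subseteq> Pow UNIV" by simp
  show "sets (distr (lborel::(real\<times>real) measure) borel (\<lambda>p. (norm p)\<^sup>2)) = sigma_sets UNIV ?E"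
    "sets (density lborel (\<lambda>t. ennreal (pi * indicator {0..} t))) = sigma_sets UNIV ?E"
    by (simp_all add: borel_eq_atMost)
  show "range ?A \<subseteq> ?E" by auto
  show "(\<Union>i. ?A i) = UNIV" using real_arch_simple by auto
  show "emeasure (distr (lborel::(real\<times>real) measure) borel (\<lambda>p. (norm p)\<^sup>2)) (?A i) \<noteq> \<infinity>" for i
    by (simp add: dist)
  show "emeasure (distr (lborel::(real\<times>real) measure) borel (\<lambda>p. (norm p)\<^sup>2)) X =
    emeasure (density lborel (\<lambda>t. ennreal (pi * indicator {0..} t))) X" if "X \<in> ?E" for X
    using that by (auto simp: dens dist)
qed

lemma norm_vec3: "(norm (vec3 p))\<^sup>2 = (norm (fst p))\<^sup>2 + (snd p)\<^sup>2"
  by (simp add: norm_vec_def L2_set_def sum_3 norm_prod_def)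

text \<open>A rotation takes the third axis to \<open>e\<close>, which makes
  \<open>e \<bullet> x\<close> the third coordinate. What remains of the norm is the squared radius
  in the plane, whose distribution is known.\<close>

lemma nn_integral_cylindrical:
  fixes \<Psi> :: "real \<times> real \<Rightarrow> ennreal" and e :: "real ^ 3"
  assumes [measurable]: "\<Psi> \<in> borel_measurable borel" and e: "norm e = 1"
  shows "(\<integral>\<^sup>+ x. \<Psi> ((norm x)\<^sup>2, e \<bullet> x) \<partial>lborel)
    = (\<integral>\<^sup>+ z. (\<integral>\<^sup>+ t. ennreal pi * \<Psi> (t + z\<^sup>2, z) * indicator {0..} t \<partial>lborel) \<partial>lborel)"
proof -
  have "norm (axis 3 1 :: real^3) = norm e" using e by simp
  then obtain A :: "real^3 \<Rightarrow> real^3" where A: "orthogonal_transformation A" "A (axis 3 1) = e"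
    by (metis orthogonal_transformation_exists)
  have lin: "linear A" using A(1) by (rule orthogonal_transformation_linear)
  have [measurable]: "A \<in> borel_measurable borel"
    by (intro borel_measurable_continuous_onI linear_continuous_on linear_linear[THEN iffD2] lin)
  have ip: "e \<bullet> A x = x $ 3" for x
    using A by (metis cart_eq_inner_axis inner_commute orthogonal_transformation_def)
  have [measurable]: "\<Psi> \<in> borel_measurable (borel \<Otimes>\<^sub>M borel)"
    by (simp add: borel_prod)
  have "(\<integral>\<^sup>+ x. \<Psi> ((norm x)\<^sup>2, e \<bullet> x) \<partial>lborel) = (\<integral>\<^sup>+ x. \<Psi> ((norm x)\<^sup>2, e \<bullet> x) \<partial>distr lborel borel A)"
    by (simp add: lborel_distr_orthogonal[OF A(1)])
  also have "\<dots> = (\<integral>\<^sup>+ x. \<Psi> ((norm x)\<^sup>2, x $ (3::3)) \<partial>lborel)"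
    by (subst nn_integral_distr) (auto simp: ip orthogonal_transformation_norm[OF A(1)])
  also have "\<dots> = (\<integral>\<^sup>+ x. \<Psi> ((norm x)\<^sup>2, x $ 3) \<partial>distr lborel borel vec3)"
    by (simp add: distr_vec3)
  also have "\<dots> = (\<integral>\<^sup>+ p. \<Psi> ((norm (fst p))\<^sup>2 + (snd p)\<^sup>2, snd p) \<partial>(lborel :: ((real\<times>real)\<times>real) measure))"
    by (subst nn_integral_distr)
       (auto simp: norm_vec3)
  also have "\<dots> = (\<integral>\<^sup>+ z. (\<integral>\<^sup>+ p. \<Psi> ((norm p)\<^sup>2 + z\<^sup>2, z) \<partial>(lborel :: (real\<times>real) measure)) \<partial>lborel)"
    unfolding lborel_prod[symmetric, where ?'a="real\<times>real"]
    by (subst lborel_pair.nn_integral_snd[symmetric]) auto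
  also have "\<dots> = (\<integral>\<^sup>+ z. (\<integral>\<^sup>+ t. \<Psi> (t + z\<^sup>2, z) \<partial>distr (lborel::(real\<times>real) measure) borel (\<lambda>p. (norm p)\<^sup>2)) \<partial>lborel)"
    by (intro nn_integral_cong, subst nn_integral_distr) auto
  also have "\<dots> = (\<integral>\<^sup>+ z. (\<integral>\<^sup>+ t. ennreal pi * \<Psi> (t + z\<^sup>2, z) * indicator {0..} t \<partial>lborel) \<partial>lborel)"
    unfolding distr_norm_sq_disc
    by (intro nn_integral_cong, subst nn_integral_density)
       (auto intro!: nn_integral_cong split: split_indicator simp: ennreal_mult)
  finally show ?thesis .
qed


text \<open>Substitution on growing compact intervals, then monotone convergence on both
  sides.\<close>

lemma nn_integral_square_substitution:
  fixes f :: "real \<Rightarrow> ennreal"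
  assumes [measurable]: "f \<in> borel_measurable borel" and a: "0 \<le> a"
  shows "(\<integral>\<^sup>+ t. f (t + a\<^sup>2) * indicator {0..} t \<partial>lborel)
    = (\<integral>\<^sup>+ r. f (r\<^sup>2) * ennreal (2 * r) * indicator {a..} r \<partial>lborel)"
proof -
  have "(\<integral>\<^sup>+ t. f t * indicator {a\<^sup>2..} t \<partial>lborel) = (\<integral>\<^sup>+ r. f (r\<^sup>2) * ennreal (2 * r) * indicator {a..} r \<partial>lborel)"
  proof (rule LIMSEQ_unique)
    \<comment> \<open>The summand 1 keeps the interval nondegenerate and makes the right end at most
      its own square, so that the squared intervals exhaust the half-line as well.\<close>
    have fin: "(\<integral>\<^sup>+ t. f t * indicator {a\<^sup>2..(a + (1 + real n))\<^sup>2} t \<partial>lborel)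
      = (\<integral>\<^sup>+ r. f (r\<^sup>2) * ennreal (2 * r) * indicator {a..a + (1 + real n)} r \<partial>lborel)" for n
      using a by (intro nn_integral_substitution_aux)
        (auto intro!: derivative_eq_intros continuous_intros)
    have b: "\<forall>\<^sub>F n in sequentially. x \<le> a + (1 + real n)" for x
      using eventually_ge_at_top[of "nat \<lceil>x\<rceil>"] 
      by eventually_elim (use a in linarith)
    show "(\<lambda>n. \<integral>\<^sup>+ r. f (r\<^sup>2) * ennreal (2 * r) * indicator {a..a + (1 + real n)} r \<partial>lborel)
      \<longlonglongrightarrow> (\<integral>\<^sup>+ r. f (r\<^sup>2) * ennreal (2 * r) * indicator {a..} r \<partial>lborel)"
    proof (rule nn_integral_LIMSEQ)
      show "incseq (\<lambda>n r. f (r\<^sup>2) * ennreal (2 * r) * indicator {a..a + (1 + real n)} r)"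
        by (auto simp: incseq_def le_fun_def intro!: mult_left_mono split: split_indicator)
      show "(\<lambda>n. f (x\<^sup>2) * ennreal (2 * x) * indicator {a..a + (1 + real n)} x)
        \<longlonglongrightarrow> f (x\<^sup>2) * ennreal (2 * x) * indicator {a..} x" for x
        by (rule tendsto_eventually, rule eventually_mono[OF b[of x]]) (auto split: split_indicator)
    qed auto
    have b2: "\<forall>\<^sub>F n in sequentially. x \<le> (a + (1 + real n))\<^sup>2" for x
      using b[of x]
    proof eventually_elim
      case (elim n)
      have "a + (1 + real n) \<le> (a + (1 + real n))\<^sup>2"
        using a by (simp add: power2_eq_square)
      with elim show ?case by linarith
    qed
    show "(\<lambda>n. \<integral>\<^sup>+ r. f (r\<^sup>2) * ennreal (2 * r) * indicator {a..a + (1 + real n)} r \<partial>lborel)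
      \<longlonglongrightarrow> (\<integral>\<^sup>+ t. f t * indicator {a\<^sup>2..} t \<partial>lborel)"
      unfolding fin[symmetric]
    proof (rule nn_integral_LIMSEQ)
      show "incseq (\<lambda>n t. f t * indicator {a\<^sup>2..(a + (1 + real n))\<^sup>2} t)"
      proof (rule incseq_SucI)
        have "(a + (1 + real n))\<^sup>2 \<le> (a + (1 + real (Suc n)))\<^sup>2" for n
          using a by (intro power_mono) auto
        then show "(\<lambda>t. f t * indicator {a\<^sup>2..(a + (1 + real n))\<^sup>2} t) \<le> (\<lambda>t. f t * indicator {a\<^sup>2..(a + (1 + real (Suc n)))\<^sup>2} t)" for n
          by (auto simp: le_fun_def intro: order_trans split: split_indicator)
      qed
      show "(\<lambda>n. f x * indicator {a\<^sup>2..(a + (1 + real n))\<^sup>2} x)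
        \<longlonglongrightarrow> f x * indicator {a\<^sup>2..} x" for x
        by (rule tendsto_eventually, rule eventually_mono[OF b2[of x]]) (auto split: split_indicator)
    qed auto
  qed
  moreover have "(\<integral>\<^sup>+ t. f t * indicator {a\<^sup>2..} t \<partial>lborel) = (\<integral>\<^sup>+ t. f (t + a\<^sup>2) * indicator {0..} t \<partial>lborel)"
    by (subst nn_integral_real_affine[where c=1 and t="a\<^sup>2"])
       (auto simp: add.commute intro!: nn_integral_cong split: split_indicator)
  ultimately show ?thesis by simp
qed

text \<open>At height z the squared planar radius is t = r^2 - z^2, so pi dt becomes 2 pi r dr with
  r running from |z|. The density depends on z only through the constraint |z| <= r, which is
  Archimedes' theorem on spherical zones.\<close>

lemma nn_integral_spherical:
  fixes \<Psi> :: "real \<times> real \<Rightarrow> ennreal" and e :: "real ^ 3"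
  assumes [measurable]: "\<Psi> \<in> borel_measurable borel" and e: "norm e = 1"
  shows "(\<integral>\<^sup>+ x. \<Psi> (norm x, e \<bullet> x) \<partial>lborel)
    = (\<integral>\<^sup>+ p. ennreal (2 * pi * fst p) * indicator {p. \<bar>snd p\<bar> \<le> fst p} p * \<Psi> p \<partial>lborel)"
proof -
  have [measurable]: "\<Psi> \<in> borel_measurable (borel \<Otimes>\<^sub>M borel)"
    by (simp add: borel_prod)
  have "(\<integral>\<^sup>+ x. \<Psi> (norm x, e \<bullet> x) \<partial>lborel) = (\<integral>\<^sup>+ x. (\<lambda>(t, z). \<Psi> (sqrt t, z)) ((norm x)\<^sup>2, e \<bullet> x) \<partial>lborel)"
    by simp
  also have "\<dots> = (\<integral>\<^sup>+ z. (\<integral>\<^sup>+ t. ennreal pi * \<Psi> (sqrt (t + z\<^sup>2), z) * indicator {0..} t \<partial>lborel) \<partial>lborel)"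
    by (subst nn_integral_cylindrical[OF _ e]) (auto simp: borel_prod[symmetric])
  also have "\<dots> = (\<integral>\<^sup>+ z. (\<integral>\<^sup>+ r. ennreal (2 * pi * r) * indicator {p. \<bar>snd p\<bar> \<le> fst p} (r, z) * \<Psi> (r, z) \<partial>lborel) \<partial>lborel)"
  proof (rule nn_integral_cong)
    fix z :: real
    have "(\<integral>\<^sup>+ t. ennreal pi * \<Psi> (sqrt (t + z\<^sup>2), z) * indicator {0..} t \<partial>lborel)
      = (\<integral>\<^sup>+ r. ennreal pi * \<Psi> (sqrt (r\<^sup>2), z) * ennreal (2 * r) * indicator {\<bar>z\<bar>..} r \<partial>lborel)"
      using nn_integral_square_substitution[of "\<lambda>t. ennreal pi * \<Psi> (sqrt t, z)" "\<bar>z\<bar>"] by simp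
    also have "\<dots> = (\<integral>\<^sup>+ r. ennreal (2 * pi * r) * indicator {p. \<bar>snd p\<bar> \<le> fst p} (r, z) * \<Psi> (r, z) \<partial>lborel)"
      by (intro nn_integral_cong) (auto split: split_indicator simp: ennreal_mult' mult_ac)
    finally show "(\<integral>\<^sup>+ t. ennreal pi * \<Psi> (sqrt (t + z\<^sup>2), z) * indicator {0..} t \<partial>lborel)
      = (\<integral>\<^sup>+ r. ennreal (2 * pi * r) * indicator {p. \<bar>snd p\<bar> \<le> fst p} (r, z) * \<Psi> (r, z) \<partial>lborel)" .
  qed
  also have "\<dots> = (\<integral>\<^sup>+ p. ennreal (2 * pi * fst p) * indicator {p. \<bar>snd p\<bar> \<le> fst p} p * \<Psi> p \<partial>(lborel \<Otimes>\<^sub>M lborel))"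
    by (subst lborel_pair.nn_integral_snd[symmetric]) auto
  finally show ?thesis by (simp add: lborel_prod)
qed

text \<open>The same density as an identity of measures. The previous form covers nonnegative
  integrands only; from this one complex integrals can be transported too.\<close>

lemma distr_norm_inner:
  fixes e :: "real ^ 3"
  assumes e: "norm e = 1"
  shows "distr lborel borel (\<lambda>x. (norm x, e \<bullet> x))
    = density lborel (\<lambda>p. ennreal (2 * pi * fst p) * indicator {p. \<bar>snd p\<bar> \<le> fst p} p)"
proof (rule measure_eqI)
  fix A assume "A \<in> sets (distr lborel borel (\<lambda>x. (norm x, e \<bullet> x)))"
  then have [measurable]: "A \<in> sets borel" by simp
  have "emeasure (distr lborel borel (\<lambda>x. (norm x, e \<bullet> x))) A
    = (\<integral>\<^sup>+ p. indicator A p \<partial>distr lborel borel (\<lambda>x. (norm x, e \<bullet> x)))"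
    by (subst nn_integral_indicator) auto
  also have "\<dots> = (\<integral>\<^sup>+ x. indicator A (norm x, e \<bullet> x) \<partial>lborel)"
    by (subst nn_integral_distr) (auto simp: borel_prod)
  also have "\<dots> = (\<integral>\<^sup>+ p. ennreal (2 * pi * fst p) * indicator {p. \<bar>snd p\<bar> \<le> fst p} p * indicator A p \<partial>lborel)"
    by (rule nn_integral_spherical[OF _ e]) (auto simp: borel_prod)
  also have "\<dots> = emeasure (density lborel (\<lambda>p. ennreal (2 * pi * fst p) * indicator {p. \<bar>snd p\<bar> \<le> fst p} p)) A"
  proof (subst emeasure_density)
    have "(\<lambda>p::real\<times>real. ennreal (2 * pi * fst p) * indicator {p. \<bar>snd p\<bar> \<le> fst p} p) \<in> borel_measurable (borel \<Otimes>\<^sub>M borel)"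
      by measurable
    then show "(\<lambda>p::real\<times>real. ennreal (2 * pi * fst p) * indicator {p. \<bar>snd p\<bar> \<le> fst p} p) \<in> borel_measurable lborel"
      by (simp add: borel_prod)
  qed auto
  finally show "emeasure (distr lborel borel (\<lambda>x. (norm x, e \<bullet> x))) A
    = emeasure (density lborel (\<lambda>p. ennreal (2 * pi * fst p) * indicator {p. \<bar>snd p\<bar> \<le> fst p} p)) A" .
qed (simp add: borel_prod)

text \<open>For fixed r = |p| the squared distance |\<zeta> - p|^2 = r^2 + s^2 - 2 s z is affine in
  the height z, so z can be exchanged for v = |\<zeta> - p| with s dz = - v dv. Together with the
  density 2 pi r the weight 1 / (r v) cancels, and 2 pi / s remains. The inequality comes from
  letting r and v vary independently instead of obeying the triangle inequality.\<close>

lemma nn_integral_bipolar: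
  fixes g h :: "real \<Rightarrow> ennreal" and \<zeta> :: "real ^ 3"
  assumes [measurable]: "g \<in> borel_measurable borel" "h \<in> borel_measurable borel" and "\<zeta> \<noteq> 0"
  shows "(\<integral>\<^sup>+ p. g (norm p) * h (norm (\<zeta> - p)) * ennreal (1 / (norm p * norm (\<zeta> - p))) \<partial>lborel)
    \<le> ennreal (2 * pi / norm \<zeta>) * (\<integral>\<^sup>+ u. g u * indicator {0..} u \<partial>lborel) * (\<integral>\<^sup>+ v. h v * indicator {0..} v \<partial>lborel)"
proof -
  define s where "s = norm \<zeta>"
  have s: "s > 0" using assms by (simp add: s_def)
  define e where "e = \<zeta> /\<^sub>R s"
  have e: "norm e = 1" using s by (simp add: e_def s_def)
  define w where "w r z = sqrt (r\<^sup>2 + s\<^sup>2 + (- 2 * s) * z)" for r z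
  have [measurable]: "case_prod w \<in> borel_measurable (borel \<Otimes>\<^sub>M borel)"
    unfolding w_def by measurable
  have nw: "norm (\<zeta> - p) = w (norm p) (e \<bullet> p)" for p
  proof -
    have "(norm (\<zeta> - p))\<^sup>2 = (norm p)\<^sup>2 + s\<^sup>2 + (- 2 * s) * (e \<bullet> p)"
      using s by (simp add: power2_norm_eq_inner inner_diff e_def s_def inner_commute algebra_simps)
    then show ?thesis unfolding w_def by (metis norm_ge_zero real_sqrt_unique)
  qed
  define k where "k r z = h (w r z) * ennreal (1 / w r z) * indicator {0..} (r\<^sup>2 + s\<^sup>2 + (- 2 * s) * z)" for r z
  have [measurable]: "case_prod k \<in> borel_measurable (borel \<Otimes>\<^sub>M borel)"
    unfolding k_def by measurable
  have inner: "(\<integral>\<^sup>+ z. k r z \<partial>lborel) = ennreal (1 / s) * (\<integral>\<^sup>+ v. h v * indicator {0..} v \<partial>lborel)" for r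
  proof -
    define f where "f y = h (sqrt y) * ennreal (1 / sqrt y) * indicator {0..} y" for y
    have [measurable]: "f \<in> borel_measurable borel" unfolding f_def by measurable
    have "(\<integral>\<^sup>+ y. f y \<partial>lborel) = (\<integral>\<^sup>+ v. h (sqrt (v\<^sup>2)) * ennreal (1 / sqrt (v\<^sup>2)) * ennreal (2 * v) * indicator {0..} v \<partial>lborel)"
      using nn_integral_square_substitution[of "\<lambda>y. h (sqrt y) * ennreal (1 / sqrt y)" 0]
      by (simp add: f_def)
    also have "\<dots> = (\<integral>\<^sup>+ v. 2 * (h v * indicator {0..} v) \<partial>lborel)"
    proof (rule nn_integral_cong_AE)
      \<comment> \<open>At v = 0 the left side vanishes because 1 / 0 = 0, whereas the right side
        need not.\<close>
      have "AE v in lborel. v \<noteq> (0::real)" by (rule AE_lborel_singleton)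
      then show "AE v in lborel. h (sqrt (v\<^sup>2)) * ennreal (1 / sqrt (v\<^sup>2)) * ennreal (2 * v) * indicator {0..} v
        = 2 * (h v * indicator {0..} v)"
      proof eventually_elim
        case (elim v)
        show ?case
        proof (cases "v > 0")
          case True
          then have "ennreal (1 / v) * ennreal (2 * v) = ennreal 2"
            by (subst ennreal_mult[symmetric]) auto
          with True show ?thesis by (simp add: mult.assoc) (simp add: mult.commute)
        qed (use elim in \<open>auto split: split_indicator\<close>)
      qed
    qed
    also have "\<dots> = 2 * (\<integral>\<^sup>+ v. h v * indicator {0..} v \<partial>lborel)"
      by (subst nn_integral_cmult) auto
    finally have 1: "(\<integral>\<^sup>+ y. f y \<partial>lborel) = 2 * (\<integral>\<^sup>+ v. h v * indicator {0..} v \<partial>lborel)" .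
    have "(\<integral>\<^sup>+ y. f y \<partial>lborel) = \<bar>- 2 * s\<bar> * (\<integral>\<^sup>+ z. f (r\<^sup>2 + s\<^sup>2 + (- 2 * s) * z) \<partial>lborel)"
      by (rule nn_integral_real_affine) (use s in auto)
    also have "(\<lambda>z. f (r\<^sup>2 + s\<^sup>2 + (- 2 * s) * z)) = k r"
      by (auto simp: f_def k_def w_def)
    finally have 2: "ennreal (2 * s) * (\<integral>\<^sup>+ z. k r z \<partial>lborel) = 2 * (\<integral>\<^sup>+ v. h v * indicator {0..} v \<partial>lborel)"
      using 1 s by simp
    have "ennreal (1 / (2 * s)) * (ennreal (2 * s) * (\<integral>\<^sup>+ z. k r z \<partial>lborel)) = (\<integral>\<^sup>+ z. k r z \<partial>lborel)"
      unfolding mult.assoc[symmetric] using s by (subst ennreal_mult[symmetric]) auto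
    then have "(\<integral>\<^sup>+ z. k r z \<partial>lborel) = ennreal (1 / (2 * s)) * (ennreal 2 * (\<integral>\<^sup>+ v. h v * indicator {0..} v \<partial>lborel))"
      using 2 by simp
    also have "\<dots> = ennreal (1 / s) * (\<integral>\<^sup>+ v. h v * indicator {0..} v \<partial>lborel)"
      unfolding mult.assoc[symmetric] using s by (subst ennreal_mult[symmetric]) auto
    finally show ?thesis .
  qed
  let ?\<Psi> = "\<lambda>(r, z). g r * h (w r z) * ennreal (1 / (r * w r z))"
  have "(\<integral>\<^sup>+ p. g (norm p) * h (norm (\<zeta> - p)) * ennreal (1 / (norm p * norm (\<zeta> - p))) \<partial>lborel)
    = (\<integral>\<^sup>+ p. ?\<Psi> (norm p, e \<bullet> p) \<partial>lborel)"
    by (simp add: nw)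
  also have "\<dots> = (\<integral>\<^sup>+ p. ennreal (2 * pi * fst p) * indicator {p. \<bar>snd p\<bar> \<le> fst p} p * ?\<Psi> p \<partial>lborel)"
    by (rule nn_integral_spherical[OF _ e]) (auto simp: borel_prod[symmetric])
  also have "\<dots> \<le> (\<integral>\<^sup>+ p. (g (fst p) * indicator {0..} (fst p)) * ennreal (2 * pi) * k (fst p) (snd p) \<partial>lborel)"
  proof (rule nn_integral_mono)
    fix p :: "real \<times> real"
    obtain r z where p: "p = (r, z)" by force
    show "ennreal (2 * pi * fst p) * indicator {p. \<bar>snd p\<bar> \<le> fst p} p * ?\<Psi> p
      \<le> (g (fst p) * indicator {0..} (fst p)) * ennreal (2 * pi) * k (fst p) (snd p)"
    proof (cases "\<bar>z\<bar> \<le> r \<and> r > 0")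
      case True
      have "s * z \<le> s * r" using True s by (intro mult_left_mono) auto
      then have "(r - s)\<^sup>2 + 2 * (s * r - s * z) \<ge> 0" by simp
      then have nn: "r\<^sup>2 + s\<^sup>2 + (- 2 * s) * z \<ge> 0"
        by (simp add: power2_eq_square algebra_simps)
      then have w0: "w r z \<ge> 0" by (simp add: w_def)
      have "ennreal (2 * pi * r) * ennreal (1 / (r * w r z)) = ennreal (2 * pi) * ennreal (1 / w r z)"
        using True w0 by (simp add: ennreal_mult[symmetric])
      then have "ennreal (2 * pi * r) * (g r * h (w r z) * ennreal (1 / (r * w r z)))
         = g r * ennreal (2 * pi) * (h (w r z) * ennreal (1 / w r z))"
        by (metis (no_types, lifting) mult.assoc mult.left_commute)
      then show ?thesis using True nn by (simp add: p k_def)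
    next
      case False
      then have "\<bar>z\<bar> \<le> r \<Longrightarrow> r = 0" by auto
      then show ?thesis by (auto simp: p split: split_indicator)
    qed
  qed
  also have "\<dots> = (\<integral>\<^sup>+ r. (\<integral>\<^sup>+ z. (g r * indicator {0..} r) * ennreal (2 * pi) * k r z \<partial>lborel) \<partial>lborel)"
    by (subst lborel_prod[symmetric], subst lborel.nn_integral_fst[symmetric]) auto
  also have "\<dots> = (\<integral>\<^sup>+ r. (g r * indicator {0..} r) * (ennreal (2 * pi) * (ennreal (1 / s) * (\<integral>\<^sup>+ v. h v * indicator {0..} v \<partial>lborel))) \<partial>lborel)"
    by (subst nn_integral_cmult) (auto simp: inner mult.assoc)
  also have "\<dots> = (\<integral>\<^sup>+ r. g r * indicator {0..} r \<partial>lborel) * (ennreal (2 * pi) * (ennreal (1 / s) * (\<integral>\<^sup>+ v. h v * indicator {0..} v \<partial>lborel)))"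
    by (subst nn_integral_multc) auto
  also have "\<dots> = ennreal (2 * pi / s) * (\<integral>\<^sup>+ u. g u * indicator {0..} u \<partial>lborel) * (\<integral>\<^sup>+ v. h v * indicator {0..} v \<partial>lborel)"
  proof -
    have "ennreal (2 * pi / s) = ennreal (2 * pi) * ennreal (1 / s)"
      using s by (simp add: ennreal_mult[symmetric])
    then show ?thesis by (simp add: mult_ac)
  qed
  finally show ?thesis by (simp add: s_def)
qed

section \<open>Convolution estimates for shell weights\<close>

lemma nn_integral_translate:
  fixes f :: "'a::euclidean_space \<Rightarrow> ennreal"
  assumes [measurable]: "f \<in> borel_measurable borel"
  shows "(\<integral>\<^sup>+ x. f (a + x) \<partial>lborel) = (\<integral>\<^sup>+ x. f x \<partial>lborel)"
proof -
  have "(\<integral>\<^sup>+ x. f x \<partial>lborel) = (\<integral>\<^sup>+ x. f x \<partial>distr lborel borel ((+) a))"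
    by (simp add: lborel_distr_plus)
  also have "\<dots> = (\<integral>\<^sup>+ x. f (a + x) \<partial>lborel)"
    by (subst nn_integral_distr) auto
  finally show ?thesis ..
qed

lemma lborel_distr_minus:
  fixes a :: "'a::euclidean_space"
  shows "distr lborel borel (\<lambda>x. a - x) = lborel"
  using lborel_affine[of "-1" a] by (simp add: density_1)

lemma nn_integral_reflect:
  fixes f :: "'a::euclidean_space \<Rightarrow> ennreal"
  assumes [measurable]: "f \<in> borel_measurable borel"
  shows "(\<integral>\<^sup>+ x. f (a - x) \<partial>lborel) = (\<integral>\<^sup>+ x. f x \<partial>lborel)"
proof -
  have "(\<integral>\<^sup>+ x. f x \<partial>lborel) = (\<integral>\<^sup>+ x. f x \<partial>distr lborel borel (\<lambda>x. a - x))"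
    by (simp add: lborel_distr_minus)
  also have "\<dots> = (\<integral>\<^sup>+ x. f (a - x) \<partial>lborel)"
    by (subst nn_integral_distr) auto
  finally show ?thesis ..
qed

definition convolve :: "('a::euclidean_space \<Rightarrow> ennreal) \<Rightarrow> ('a \<Rightarrow> ennreal) \<Rightarrow> 'a \<Rightarrow> ennreal" where
  "convolve F G \<zeta> = (\<integral>\<^sup>+ p. F p * G (\<zeta> - p) \<partial>lborel)"

definition correlate :: "('a::euclidean_space \<Rightarrow> ennreal) \<Rightarrow> ('a \<Rightarrow> ennreal) \<Rightarrow> 'a \<Rightarrow> ennreal" where
  "correlate F G \<zeta> = (\<integral>\<^sup>+ p. F p * G (p - \<zeta>) \<partial>lborel)"

lemma borel_measurable_convolve [measurable]:
  assumes [measurable]: "F \<in> borel_measurable borel" "G \<in> borel_measurable borel"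
  shows "convolve F G \<in> borel_measurable borel"
  unfolding convolve_def by measurable

lemma borel_measurable_correlate [measurable]:
  assumes [measurable]: "F \<in> borel_measurable borel" "G \<in> borel_measurable borel"
  shows "correlate F G \<in> borel_measurable borel"
  unfolding correlate_def by measurable

lemma ennreal_power2_nn_integral:
  assumes [measurable]: "f \<in> borel_measurable M"
  shows "(\<integral>\<^sup>+ x. f x \<partial>M)\<^sup>2 = (\<integral>\<^sup>+ x. (\<integral>\<^sup>+ y. f x * f y \<partial>M) \<partial>M)"
  by (simp add: nn_integral_cmult nn_integral_multc power2_eq_square)

lemma nn_integral_swap:
  fixes f :: "'a::euclidean_space \<Rightarrow> 'b::euclidean_space \<Rightarrow> ennreal"
  assumes "case_prod f \<in> borel_measurable (borel \<Otimes>\<^sub>M borel)"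
  shows "(\<integral>\<^sup>+ x. (\<integral>\<^sup>+ y. f x y \<partial>lborel) \<partial>lborel) = (\<integral>\<^sup>+ y. (\<integral>\<^sup>+ x. f x y \<partial>lborel) \<partial>lborel)"
  by (rule lborel_pair.Fubini'[symmetric]) (use assms in simp)

text \<open>Both sides count quadruples \<open>p + r' = p' + r\<close>, grouped in two ways.\<close>

lemma nn_integral_correlate_sq:
  fixes F G :: "'a::euclidean_space \<Rightarrow> ennreal"
  assumes [measurable]: "F \<in> borel_measurable borel" "G \<in> borel_measurable borel"
  shows "(\<integral>\<^sup>+ \<zeta>. (correlate F G \<zeta>)\<^sup>2 \<partial>lborel) = (\<integral>\<^sup>+ \<eta>. correlate F F \<eta> * correlate G G \<eta> \<partial>lborel)"
proof -
  have "(\<integral>\<^sup>+ \<zeta>. (correlate F G \<zeta>)\<^sup>2 \<partial>lborel)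
     = (\<integral>\<^sup>+ \<zeta>. (\<integral>\<^sup>+ p. (\<integral>\<^sup>+ p'. F p * G (p - \<zeta>) * (F p' * G (p' - \<zeta>)) \<partial>lborel) \<partial>lborel) \<partial>lborel)"
    unfolding correlate_def by (simp add: ennreal_power2_nn_integral)
  also have "\<dots> = (\<integral>\<^sup>+ \<zeta>. (\<integral>\<^sup>+ p. (\<integral>\<^sup>+ \<eta>. F p * G (p - \<zeta>) * (F (p - \<eta>) * G (p - \<eta> - \<zeta>)) \<partial>lborel) \<partial>lborel) \<partial>lborel)"
  proof (rule nn_integral_cong, rule nn_integral_cong)
    fix \<zeta> p
    show "(\<integral>\<^sup>+ p'. F p * G (p - \<zeta>) * (F p' * G (p' - \<zeta>)) \<partial>lborel)
      = (\<integral>\<^sup>+ \<eta>. F p * G (p - \<zeta>) * (F (p - \<eta>) * G (p - \<eta> - \<zeta>)) \<partial>lborel)"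
      using nn_integral_reflect[of "\<lambda>p'. F p * G (p - \<zeta>) * (F p' * G (p' - \<zeta>))" p] by simp
  qed
  also have "\<dots> = (\<integral>\<^sup>+ \<zeta>. (\<integral>\<^sup>+ \<eta>. (\<integral>\<^sup>+ p. F p * G (p - \<zeta>) * (F (p - \<eta>) * G (p - \<eta> - \<zeta>)) \<partial>lborel) \<partial>lborel) \<partial>lborel)"
    by (intro nn_integral_cong nn_integral_swap) measurable
  also have "\<dots> = (\<integral>\<^sup>+ \<eta>. (\<integral>\<^sup>+ \<zeta>. (\<integral>\<^sup>+ p. F p * G (p - \<zeta>) * (F (p - \<eta>) * G (p - \<eta> - \<zeta>)) \<partial>lborel) \<partial>lborel) \<partial>lborel)"
    by (intro nn_integral_swap) measurable
  also have "\<dots> = (\<integral>\<^sup>+ \<eta>. (\<integral>\<^sup>+ p. (\<integral>\<^sup>+ \<zeta>. F p * G (p - \<zeta>) * (F (p - \<eta>) * G (p - \<eta> - \<zeta>)) \<partial>lborel) \<partial>lborel) \<partial>lborel)"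
    by (intro nn_integral_cong nn_integral_swap) measurable
  also have "\<dots> = (\<integral>\<^sup>+ \<eta>. (\<integral>\<^sup>+ p. F p * F (p - \<eta>) * (\<integral>\<^sup>+ \<zeta>. G (p - \<zeta>) * G (p - \<zeta> - \<eta>) \<partial>lborel) \<partial>lborel) \<partial>lborel)"
    by (intro nn_integral_cong, subst nn_integral_cmult[symmetric])
       (auto intro!: nn_integral_cong simp: mult_ac diff_diff_eq add.commute)
  also have "\<dots> = (\<integral>\<^sup>+ \<eta>. (\<integral>\<^sup>+ p. F p * F (p - \<eta>) * correlate G G \<eta> \<partial>lborel) \<partial>lborel)"
    unfolding correlate_def
    by (intro nn_integral_cong arg_cong2[where f=times] refl nn_integral_reflect[where f="\<lambda>x. G x * G (x - _)"]) measurable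
  also have "\<dots> = (\<integral>\<^sup>+ \<eta>. correlate F F \<eta> * correlate G G \<eta> \<partial>lborel)"
    by (intro nn_integral_cong, subst nn_integral_multc) (auto simp: correlate_def)
  finally show ?thesis .
qed

text \<open>Equal differences p - p' = r - r' are equal crosswise sums p + r' = r + p'. In the
  integrals, \<sigma> = p + r - \<zeta> replaces the common difference \<zeta>. This is where
  differences are exchanged for sums.\<close>

lemma nn_integral_autocorrelate_sq:
  fixes F :: "'a::euclidean_space \<Rightarrow> ennreal"
  assumes [measurable]: "F \<in> borel_measurable borel"
  shows "(\<integral>\<^sup>+ \<zeta>. (correlate F F \<zeta>)\<^sup>2 \<partial>lborel) = (\<integral>\<^sup>+ \<zeta>. (convolve F F \<zeta>)\<^sup>2 \<partial>lborel)"
proof -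
  have "(\<integral>\<^sup>+ \<zeta>. (correlate F F \<zeta>)\<^sup>2 \<partial>lborel)
     = (\<integral>\<^sup>+ \<zeta>. (\<integral>\<^sup>+ p. (\<integral>\<^sup>+ r. F p * F (p - \<zeta>) * (F r * F (r - \<zeta>)) \<partial>lborel) \<partial>lborel) \<partial>lborel)"
    unfolding correlate_def by (simp add: ennreal_power2_nn_integral)
  also have "\<dots> = (\<integral>\<^sup>+ p. (\<integral>\<^sup>+ \<zeta>. (\<integral>\<^sup>+ r. F p * F (p - \<zeta>) * (F r * F (r - \<zeta>)) \<partial>lborel) \<partial>lborel) \<partial>lborel)"
    by (intro nn_integral_swap) measurable
  also have "\<dots> = (\<integral>\<^sup>+ p. (\<integral>\<^sup>+ r. (\<integral>\<^sup>+ \<zeta>. F p * F (p - \<zeta>) * (F r * F (r - \<zeta>)) \<partial>lborel) \<partial>lborel) \<partial>lborel)"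
    by (intro nn_integral_cong nn_integral_swap) measurable
  also have "\<dots> = (\<integral>\<^sup>+ p. (\<integral>\<^sup>+ r. (\<integral>\<^sup>+ \<sigma>. F p * F (\<sigma> - r) * (F r * F (\<sigma> - p)) \<partial>lborel) \<partial>lborel) \<partial>lborel)"
  proof (rule nn_integral_cong, rule nn_integral_cong)
    fix p r
    show "(\<integral>\<^sup>+ \<zeta>. F p * F (p - \<zeta>) * (F r * F (r - \<zeta>)) \<partial>lborel)
      = (\<integral>\<^sup>+ \<sigma>. F p * F (\<sigma> - r) * (F r * F (\<sigma> - p)) \<partial>lborel)"
      using nn_integral_reflect[of "\<lambda>\<zeta>. F p * F (p - \<zeta>) * (F r * F (r - \<zeta>))" "p + r"]
      by (simp add: algebra_simps)
  qed
  also have "\<dots> = (\<integral>\<^sup>+ p. (\<integral>\<^sup>+ \<sigma>. (\<integral>\<^sup>+ r. F p * F (\<sigma> - r) * (F r * F (\<sigma> - p)) \<partial>lborel) \<partial>lborel) \<partial>lborel)"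
    by (intro nn_integral_cong nn_integral_swap) measurable
  also have "\<dots> = (\<integral>\<^sup>+ \<sigma>. (\<integral>\<^sup>+ p. (\<integral>\<^sup>+ r. F p * F (\<sigma> - r) * (F r * F (\<sigma> - p)) \<partial>lborel) \<partial>lborel) \<partial>lborel)"
    by (intro nn_integral_swap) measurable
  also have "\<dots> = (\<integral>\<^sup>+ \<sigma>. (convolve F F \<sigma>)\<^sup>2 \<partial>lborel)"
    unfolding convolve_def by (simp add: ennreal_power2_nn_integral mult_ac)
  finally show ?thesis .
qed

text \<open>Cauchy-Schwarz separates \<open>f\<close> from \<open>w\<close> at each \<zeta>. The
  weights contribute at most \<open>D\<close>, uniformly, and the self-convolution of f^2 integrates
  to the square of the integral of f^2. The point \<zeta> = 0, about which \<open>H\<close> says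
  nothing, is a null set.\<close>

lemma nn_integral_convolve_sq_le:
  fixes f w :: "'a::euclidean_space \<Rightarrow> ennreal"
  assumes [measurable]: "f \<in> borel_measurable borel" "w \<in> borel_measurable borel"
    and H: "\<And>\<zeta>. \<zeta> \<noteq> 0 \<Longrightarrow> convolve (\<lambda>p. (w p)\<^sup>2) (\<lambda>p. (w p)\<^sup>2) \<zeta> \<le> D"
  shows "(\<integral>\<^sup>+ \<zeta>. (convolve (\<lambda>p. f p * w p) (\<lambda>p. f p * w p) \<zeta>)\<^sup>2 \<partial>lborel) \<le> D * (\<integral>\<^sup>+ p. (f p)\<^sup>2 \<partial>lborel)\<^sup>2"
proof -
  have "(\<integral>\<^sup>+ \<zeta>. (convolve (\<lambda>p. f p * w p) (\<lambda>p. f p * w p) \<zeta>)\<^sup>2 \<partial>lborel)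
    \<le> (\<integral>\<^sup>+ \<zeta>. D * convolve (\<lambda>p. (f p)\<^sup>2) (\<lambda>p. (f p)\<^sup>2) \<zeta> \<partial>lborel)"
  proof (rule nn_integral_mono_AE, use AE_lborel_singleton[of 0] in eventually_elim)
    case (elim \<zeta>)
    have "(convolve (\<lambda>p. f p * w p) (\<lambda>p. f p * w p) \<zeta>)\<^sup>2
       = (\<integral>\<^sup>+ p. (f p * f (\<zeta> - p)) * (w p * w (\<zeta> - p)) \<partial>lborel)\<^sup>2"
      unfolding convolve_def by (simp add: mult_ac)
    also have "\<dots> \<le> (\<integral>\<^sup>+ p. (f p * f (\<zeta> - p))\<^sup>2 \<partial>lborel) * (\<integral>\<^sup>+ p. (w p * w (\<zeta> - p))\<^sup>2 \<partial>lborel)"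
      by (rule Cauchy_Schwarz_nn_integral) measurable
    also have "\<dots> = convolve (\<lambda>p. (f p)\<^sup>2) (\<lambda>p. (f p)\<^sup>2) \<zeta> * convolve (\<lambda>p. (w p)\<^sup>2) (\<lambda>p. (w p)\<^sup>2) \<zeta>"
      by (simp add: convolve_def power_mult_distrib)
    also have "\<dots> \<le> convolve (\<lambda>p. (f p)\<^sup>2) (\<lambda>p. (f p)\<^sup>2) \<zeta> * D"
      by (intro mult_left_mono H elim) auto
    finally show ?case by (simp add: mult.commute)
  qed
  also have "\<dots> = D * (\<integral>\<^sup>+ \<zeta>. convolve (\<lambda>p. (f p)\<^sup>2) (\<lambda>p. (f p)\<^sup>2) \<zeta> \<partial>lborel)"
    by (intro nn_integral_cmult) auto
  also have "(\<integral>\<^sup>+ \<zeta>. convolve (\<lambda>p. (f p)\<^sup>2) (\<lambda>p. (f p)\<^sup>2) \<zeta> \<partial>lborel)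
    = (\<integral>\<^sup>+ p. (\<integral>\<^sup>+ \<zeta>. (f p)\<^sup>2 * (f (\<zeta> - p))\<^sup>2 \<partial>lborel) \<partial>lborel)"
    unfolding convolve_def by (intro nn_integral_swap) measurable
  also have "\<dots> = (\<integral>\<^sup>+ p. (f p)\<^sup>2 * (\<integral>\<^sup>+ \<zeta>. (f \<zeta>)\<^sup>2 \<partial>lborel) \<partial>lborel)"
  proof (rule nn_integral_cong)
    fix p
    have "(\<integral>\<^sup>+ \<zeta>. (f (\<zeta> - p))\<^sup>2 \<partial>lborel) = (\<integral>\<^sup>+ \<zeta>. (f \<zeta>)\<^sup>2 \<partial>lborel)"
      using nn_integral_translate[of "\<lambda>\<zeta>. (f \<zeta>)\<^sup>2" "- p"] by simp
    then show "(\<integral>\<^sup>+ \<zeta>. (f p)\<^sup>2 * (f (\<zeta> - p))\<^sup>2 \<partial>lborel) = (f p)\<^sup>2 * (\<integral>\<^sup>+ \<zeta>. (f \<zeta>)\<^sup>2 \<partial>lborel)"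
      by (subst nn_integral_cmult) auto
  qed
  also have "\<dots> = (\<integral>\<^sup>+ p. (f p)\<^sup>2 \<partial>lborel)\<^sup>2"
    by (subst nn_integral_multc) (auto simp: power2_eq_square)
  finally show ?thesis .
qed

lemma ennreal_le_of_power2_le:
  fixes a b :: ennreal
  assumes "a\<^sup>2 \<le> b\<^sup>2" shows "a \<le> b"
  using assms
  by (cases a; cases b)
     (auto simp: ennreal_power power2_eq_square ennreal_mult[symmetric] ennreal_top_mult ennreal_mult_top
        top_unique abs_le_square_iff[unfolded power2_eq_square, symmetric] split: if_splits)

lemma ennreal_sum_power2_le:
  fixes a :: "'i \<Rightarrow> ennreal"
  assumes "finite I"
  shows "(\<Sum>i\<in>I. a i)\<^sup>2 \<le> of_nat (card I) * (\<Sum>i\<in>I. (a i)\<^sup>2)"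
proof -
  have "(\<integral>\<^sup>+ i. 1 * a i \<partial>count_space I)\<^sup>2 \<le> (\<integral>\<^sup>+ i. 1 ^ 2 \<partial>count_space I) * (\<integral>\<^sup>+ i. (a i)\<^sup>2 \<partial>count_space I)"
    by (rule Cauchy_Schwarz_nn_integral) auto
  then show ?thesis using assms by (simp add: nn_integral_count_space_finite)
qed

section \<open>Shell weights and octants\<close>

definition shell_weight :: "real \<Rightarrow> 'a::real_normed_vector \<Rightarrow> real" where
  "shell_weight k p = 1 / ((1 + norm p) * (1 + \<bar>norm p - k\<bar>))"

lemma shell_weight_pos: "0 < shell_weight k p"
  by (simp add: shell_weight_def add_pos_nonneg)

lemma borel_measurable_shell_weight [measurable (raw)]:
  fixes g :: "'b \<Rightarrow> 'a::euclidean_space"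
  assumes [measurable]: "f \<in> borel_measurable M" "g \<in> borel_measurable M"
  shows "(\<lambda>x. shell_weight (f x) (g x)) \<in> borel_measurable M"
  unfolding shell_weight_def by measurable

lemma shell_weight_le:
  assumes "0 \<le> k" shows "shell_weight k p \<le> 1 / (1 + k)"
proof -
  have "1 + k \<le> 1 + norm p + \<bar>norm p - k\<bar>" by linarith
  also have "\<dots> \<le> (1 + norm p) * (1 + \<bar>norm p - k\<bar>)" by (simp add: algebra_simps)
  finally show ?thesis
    unfolding shell_weight_def using assms by (intro divide_left_mono mult_pos_pos) (auto intro: add_pos_nonneg)
qed

text \<open>Logarithmic antiderivatives on the two sides of k, each at most ln (1 + max s k). This
  logarithm is what the exponent \<delta> later pays for.\<close>

lemma nn_integral_shell:
  assumes "0 \<le> s" "0 \<le> k"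
  shows "(\<integral>\<^sup>+ u. ennreal (1 / (1 + \<bar>u - k\<bar>)) * indicator {..s} u * indicator {0..} u \<partial>lborel)
    \<le> ennreal (2 * ln (1 + max s k))"
proof -
  define m where "m = max s k"
  have m: "s \<le> m" "k \<le> m" by (auto simp: m_def)
  have 1: "(\<integral>\<^sup>+ u. ennreal (1 / (1 + (k - u))) * indicator {0..k} u \<partial>lborel) = - ln (1 + (k - k)) - (- ln (1 + (k - 0)))"
    using assms by (intro nn_integral_FTC_Icc) (auto intro!: derivative_eq_intros)
  have 2: "(\<integral>\<^sup>+ u. ennreal (1 / (1 + (u - k))) * indicator {k..m} u \<partial>lborel) = ln (1 + (m - k)) - ln (1 + (k - k))"
    using assms m by (intro nn_integral_FTC_Icc) (auto intro!: derivative_eq_intros)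
  have "(\<integral>\<^sup>+ u. ennreal (1 / (1 + \<bar>u - k\<bar>)) * indicator {..s} u * indicator {0..} u \<partial>lborel)
    \<le> (\<integral>\<^sup>+ u. ennreal (1 / (1 + (k - u))) * indicator {0..k} u + ennreal (1 / (1 + (u - k))) * indicator {k..m} u \<partial>lborel)"
    using m by (intro nn_integral_mono) (auto split: split_indicator)
  also have "\<dots> = ennreal (ln (1 + k)) + ennreal (ln (1 + (m - k)))"
    by (subst nn_integral_add) (auto simp: 1 2)
  also have "\<dots> = ennreal (ln (1 + k) + ln (1 + (m - k)))"
    using assms m by (intro ennreal_plus[symmetric]) auto
  also have "\<dots> \<le> ennreal (2 * ln (1 + m))"
    using assms m by (intro ennreal_leI) (auto intro!: add_mono[of _ "ln (1+m)" _ "ln (1+m)", simplified])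
  finally show ?thesis by (simp add: m_def)
qed

text \<open>Up to k / 2 the shell is at distance at least k / 2, so the integrand is at most 2 / k.
  The factor s gained here, once for each of the two points, outweighs the 1 / s of the bipolar
  formula. The case k = 0 leaves only the point 0.\<close>

lemma nn_integral_shell_small:
  assumes "0 \<le> s" "s \<le> k / 2" 
  shows "(\<integral>\<^sup>+ u. ennreal (1 / (1 + \<bar>u - k\<bar>)) * indicator {..s} u * indicator {0..} u \<partial>lborel)
    \<le> ennreal (2 * s / k)"
proof (cases "k = 0")
  case False
  then have k: "k > 0" using assms by auto
  have "(\<integral>\<^sup>+ u. ennreal (1 / (1 + \<bar>u - k\<bar>)) * indicator {..s} u * indicator {0..} u \<partial>lborel)
    \<le> (\<integral>\<^sup>+ u. ennreal (2 / k) * indicator {0..s} u \<partial>lborel)"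
  proof (intro nn_integral_mono)
    fix u :: real
    have "1 / (1 + \<bar>u - k\<bar>) \<le> 1 / (k / 2)" if "u \<le> s"
      using that assms k by (intro divide_left_mono) auto
    then show "ennreal (1 / (1 + \<bar>u - k\<bar>)) * indicator {..s} u * indicator {0..} u \<le> ennreal (2 / k) * indicator {0..s} u"
      by (auto split: split_indicator intro!: ennreal_leI)
  qed
  also have "\<dots> = ennreal (2 * s / k)"
    using assms k by (subst nn_integral_cmult_indicator) (auto simp: ennreal_mult[symmetric])
  finally show ?thesis .
next
  case True
  have "(\<integral>\<^sup>+ u. ennreal (1 / (1 + \<bar>u - k\<bar>)) * indicator {..s} u * indicator {0..} u \<partial>lborel) = (\<integral>\<^sup>+ u. 0 \<partial>(lborel :: real measure))"
  proof (rule nn_integral_cong_AE, use AE_lborel_singleton[of "0::real"] in eventually_elim)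
    case (elim u)
    then show ?case using assms True by (auto split: split_indicator)
  qed
  then show ?thesis by simp
qed

text \<open>Zero counts as nonnegative, so the octants are disjoint and cover the space, and their
  indicators sum to exactly 1.\<close>

definition octant :: "('n::finite \<Rightarrow> bool) \<Rightarrow> (real ^ 'n) set" where
  "octant \<sigma> = {p. \<forall>i. (0 \<le> p $ i) = \<sigma> i}"

lemma octant_sets [measurable]: "octant \<sigma> \<in> sets borel"
  unfolding octant_def by measurable

lemma sum_indicator_octant: "(\<Sum>\<sigma>\<in>UNIV. indicator (octant \<sigma>) p) = (1 :: ennreal)"
proof -
  have "indicator (octant \<sigma>) p = (if \<sigma> = (\<lambda>i. 0 \<le> p $ i) then 1 else 0 :: ennreal)" for \<sigma>
    by (auto simp: octant_def indicator_def)
  then show ?thesis by simp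
qed

text \<open>Two points of one octant do not cancel; hence neither summand is longer than the sum.\<close>

lemma norm_le_sum_octant:
  assumes "p \<in> octant \<sigma>" "\<zeta> - p \<in> octant \<sigma>"
  shows "norm p \<le> norm \<zeta>"
proof (rule norm_le_componentwise_cart)
  fix i
  have "(0 \<le> p $ i) = (0 \<le> (\<zeta> - p) $ i)" using assms by (auto simp: octant_def)
  then show "norm (p $ i) \<le> norm (\<zeta> $ i)" by (auto simp: not_le abs_if split: if_splits)
qed

text \<open>Inside one octant both points are at most as long as s = |\<zeta>|. If s <= k / 2, the
  bipolar formula yields 2 pi / s times (2 s / k)^2, which is at most 4 pi / k. If s > k / 2, it
  yields a squared logarithm over s; the logarithms cost s powr (2 \<delta>), and the exponent 2
  \<delta> - 1 is negative, which lets s be replaced by k / 2.\<close>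

lemma convolve_shell_octant_le:
  fixes \<zeta> :: "real ^ 3"
  assumes k: "1 \<le> k" and \<delta>: "0 < \<delta>" "\<delta> < 1 / 2" and "\<zeta> \<noteq> 0"
  shows "convolve (\<lambda>p. ennreal (shell_weight k p) * indicator (octant \<sigma>) p)
      (\<lambda>p. ennreal (shell_weight k p) * indicator (octant \<sigma>) p) \<zeta>
    \<le> ennreal (64 * pi / \<delta>\<^sup>2 * k powr (2 * \<delta> - 1))"
proof -
  define s where "s = norm \<zeta>"
  have s: "s > 0" using assms by (simp add: s_def)
  let ?g = "\<lambda>u. ennreal (1 / (1 + \<bar>u - k\<bar>)) * indicator {..s} u"
  define J where "J = (\<integral>\<^sup>+ u. ?g u * indicator {0..} u \<partial>lborel)"
  have "convolve (\<lambda>p. ennreal (shell_weight k p) * indicator (octant \<sigma>) p)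
      (\<lambda>p. ennreal (shell_weight k p) * indicator (octant \<sigma>) p) \<zeta>
    \<le> (\<integral>\<^sup>+ p. ?g (norm p) * ?g (norm (\<zeta> - p)) * ennreal (1 / (norm p * norm (\<zeta> - p))) \<partial>lborel)"
    unfolding convolve_def
  proof (rule nn_integral_mono_AE, use AE_lborel_singleton[of 0] AE_lborel_singleton[of \<zeta>] in eventually_elim)
    case (elim p)
    have W: "shell_weight k q \<le> 1 / (1 + \<bar>norm q - k\<bar>) * (1 / norm q)" if "q \<noteq> 0" for q :: "real^3"
    proof -
      have "1 / ((1 + norm q) * (1 + \<bar>norm q - k\<bar>)) \<le> 1 / (norm q * (1 + \<bar>norm q - k\<bar>))"
        using that by (intro divide_left_mono mult_right_mono mult_pos_pos) (auto intro: add_pos_nonneg)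
      then show ?thesis by (simp add: shell_weight_def mult.commute)
    qed
    have "ennreal (shell_weight k p) * ennreal (shell_weight k (\<zeta> - p)) \<le>
       ennreal (1 / (1 + \<bar>norm p - k\<bar>)) * ennreal (1 / (1 + \<bar>norm (\<zeta> - p) - k\<bar>)) * ennreal (1 / (norm p * norm (\<zeta> - p)))"
    proof -
      have "shell_weight k p * shell_weight k (\<zeta> - p)
         \<le> (1 / (1 + \<bar>norm p - k\<bar>) * (1 / norm p)) * (1 / (1 + \<bar>norm (\<zeta> - p) - k\<bar>) * (1 / norm (\<zeta> - p)))"
        using elim by (intro mult_mono W) (auto intro: less_imp_le shell_weight_pos)
      also have "\<dots> = 1 / (1 + \<bar>norm p - k\<bar>) * (1 / (1 + \<bar>norm (\<zeta> - p) - k\<bar>)) * (1 / (norm p * norm (\<zeta> - p)))"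
        by simp
      finally show ?thesis
        by (simp only: ennreal_mult[symmetric] less_imp_le[OF shell_weight_pos] mult_nonneg_nonneg divide_nonneg_nonneg
              abs_ge_zero add_nonneg_nonneg zero_le_one norm_ge_zero ennreal_leI)
    qed
    moreover have "norm p \<le> s \<and> norm (\<zeta> - p) \<le> s" if "p \<in> octant \<sigma>" "\<zeta> - p \<in> octant \<sigma>"
      using norm_le_sum_octant[OF that] norm_le_sum_octant[of "\<zeta> - p" \<sigma> \<zeta>] that by (simp add: s_def)
    ultimately show ?case by (auto split: split_indicator)
  qed
  also have "\<dots> \<le> ennreal (2 * pi / s) * J * J"
    unfolding J_def s_def by (rule nn_integral_bipolar) (use assms in auto)
  also have "\<dots> \<le> ennreal (64 * pi / \<delta>\<^sup>2 * k powr (2 * \<delta> - 1))"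
  proof (cases "s \<le> k / 2")
    case True
    have "ennreal (2 * pi / s) * J * J \<le> ennreal (2 * pi / s) * ennreal (2 * s / k) * ennreal (2 * s / k)"
      unfolding J_def using s True by (intro mult_mono nn_integral_shell_small) auto
    also have "\<dots> = ennreal (8 * pi * s / k\<^sup>2)"
      using s k by (simp add: ennreal_mult[symmetric] power2_eq_square field_simps)
    also have "\<dots> \<le> ennreal (64 * pi / \<delta>\<^sup>2 * k powr (2 * \<delta> - 1))"
    proof (rule ennreal_leI)
      have "8 * pi * s / k\<^sup>2 \<le> 8 * pi * (k / 2) / k\<^sup>2"
        using True k by (intro divide_right_mono mult_left_mono) auto
      also have "\<dots> = 4 * pi * k powr (-1)"
        using k by (simp add: powr_minus field_simps power2_eq_square)
      also have "\<dots> \<le> 64 * pi / \<delta>\<^sup>2 * k powr (2 * \<delta> - 1)"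
      proof (intro mult_mono powr_mono)
        have "\<delta>\<^sup>2 \<le> 1" using \<delta> by (simp add: power_le_one)
        then show "4 * pi \<le> 64 * pi / \<delta>\<^sup>2"
          using \<delta> by (simp add: field_simps)
      qed (use \<delta> k in auto)
      finally show "8 * pi * s / k\<^sup>2 \<le> 64 * pi / \<delta>\<^sup>2 * k powr (2 * \<delta> - 1)" .
    qed
    finally show ?thesis .
  next
    case False
    \<comment> \<open>Here s > k / 2 and k >= 1 give 1 < 2 s and max s k <= 2 s, so the argument of
      the logarithm is at most 4 s.\<close>
    have l: "2 * ln (1 + max s k) \<le> 2 / \<delta> * (4 * s) powr \<delta>"
    proof -
      have "ln (1 + max s k) \<le> ln (4 * s)" using s k False by (subst ln_le_cancel_iff) auto
      also have "\<dots> \<le> (4 * s) powr \<delta> / \<delta>" using s k False \<delta> by (intro ln_powr_bound) auto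
      finally show ?thesis by simp
    qed
    have l0: "0 \<le> ln (1 + max s k)" using s by simp
    have "ennreal (2 * pi / s) * J * J \<le> ennreal (2 * pi / s) * ennreal (2 * ln (1 + max s k)) * ennreal (2 * ln (1 + max s k))"
      unfolding J_def using s k by (intro mult_mono nn_integral_shell) auto
    also have "\<dots> = ennreal (2 * pi / s * (2 * ln (1 + max s k)) * (2 * ln (1 + max s k)))"
    proof -
      have "0 \<le> 2 * pi / s" "0 \<le> 2 * pi / s * (2 * ln (1 + max s k))" "0 \<le> 2 * ln (1 + max s k)"
        using s l0 by (auto intro!: mult_nonneg_nonneg divide_nonneg_nonneg)
      then show ?thesis by (simp only: ennreal_mult)
    qed
    also have "\<dots> \<le> ennreal (64 * pi / \<delta>\<^sup>2 * k powr (2 * \<delta> - 1))"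
    proof (rule ennreal_leI)
      have "2 * pi / s * (2 * ln (1 + max s k)) * (2 * ln (1 + max s k))
         \<le> 2 * pi / s * (2 / \<delta> * (4 * s) powr \<delta>) * (2 / \<delta> * (4 * s) powr \<delta>)"
      proof -
        have "c * X * X \<le> c * Y * Y" if "0 \<le> c" "0 \<le> X" "X \<le> Y" for c X Y :: real
          using that by (intro mult_mono mult_nonneg_nonneg) auto
        note mono = this
        show ?thesis by (rule mono) (use s l l0 in auto)
      qed
      also have "\<dots> = 8 * pi / \<delta>\<^sup>2 * (4 powr (2 * \<delta>) * s powr (2 * \<delta> - 1))"
      proof -
        have "(4 * s) powr \<delta> * (4 * s) powr \<delta> = (4 * s) powr (2 * \<delta>)"
          by (simp add: powr_add[symmetric])
        also have "\<dots> = 4 powr (2 * \<delta>) * s powr (2 * \<delta>)"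
          by (simp add: powr_mult)
        also have "s powr (2 * \<delta>) = s powr (2 * \<delta> - 1) * s"
          using s by (simp add: powr_diff)
        finally have y: "(4 * s) powr \<delta> * (4 * s) powr \<delta> = 4 powr (2 * \<delta>) * (s powr (2 * \<delta> - 1) * s)" .
        have "2 * pi / s * (2 / \<delta> * (4 * s) powr \<delta>) * (2 / \<delta> * (4 * s) powr \<delta>)
           = 8 * pi / (s * \<delta>\<^sup>2) * ((4 * s) powr \<delta> * (4 * s) powr \<delta>)"
          by (simp add: power2_eq_square)
        then show ?thesis unfolding y using s by simp
      qed
      \<comment> \<open>The constant 64 is 8 * 4 * 2: \<delta> < 1 / 2 bounds 4 powr (2 \<delta>) by
        4, and passing from k / 2 to k costs at most 2.\<close>
      also have "\<dots> \<le> 8 * pi / \<delta>\<^sup>2 * (4 powr 1 * (k / 2) powr (2 * \<delta> - 1))"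
        using s k False \<delta> by (intro mult_left_mono mult_mono powr_mono powr_mono2') auto
      also have "(k / 2) powr (2 * \<delta> - 1) \<le> 2 * k powr (2 * \<delta> - 1)"
      proof -
        have "(k / 2) powr (2 * \<delta> - 1) = 2 powr (1 - 2 * \<delta>) * k powr (2 * \<delta> - 1)"
          using k by (simp add: powr_divide powr_diff field_simps)
        also have "\<dots> \<le> 2 powr 1 * k powr (2 * \<delta> - 1)"
          using \<delta> by (intro mult_right_mono powr_mono) auto
        finally show ?thesis by simp
      qed
      finally show "2 * pi / s * (2 * ln (1 + max s k)) * (2 * ln (1 + max s k)) \<le> 64 * pi / \<delta>\<^sup>2 * k powr (2 * \<delta> - 1)"
        using \<delta> by (simp add: mult_left_mono divide_right_mono)
    qed
    finally show ?thesis .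
  qed
  finally show ?thesis .
qed

lemma correlate_sum:
  fixes F G :: "'i \<Rightarrow> 'a::euclidean_space \<Rightarrow> ennreal"
  assumes "finite I" and [measurable]: "\<And>i. F i \<in> borel_measurable borel" "\<And>i. G i \<in> borel_measurable borel"
  shows "correlate (\<lambda>p. \<Sum>i\<in>I. F i p) (\<lambda>p. \<Sum>i\<in>I. G i p) \<zeta> = (\<Sum>(i, j)\<in>I \<times> I. correlate (F i) (G j) \<zeta>)"
  unfolding correlate_def sum_product sum.cartesian_product
  by (subst nn_integral_sum) (auto simp: case_prod_beta)

text \<open>Cutting both functions along the octants gives 64 pairs. For each pair the squared norm
  of the cross-correlation is an integral of a product of two autocorrelations, and each of these
  turns into a self-convolution inside a single octant, whichever two octants were paired.\<close>

lemma nn_integral_correlate_shell_le: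
  fixes f g :: "real ^ 3 \<Rightarrow> ennreal"
  assumes [measurable]: "f \<in> borel_measurable borel" "g \<in> borel_measurable borel"
    and k: "1 \<le> k" and \<delta>: "0 < \<delta>" "\<delta> < 1 / 2"
  defines "w \<equiv> (\<lambda>p. ennreal (sqrt (shell_weight k p)))"
  shows "(\<integral>\<^sup>+ \<zeta>. (correlate (\<lambda>p. f p * w p) (\<lambda>p. g p * w p) \<zeta>)\<^sup>2 \<partial>lborel)
    \<le> 64 * (ennreal (64 * pi / \<delta>\<^sup>2 * k powr (2 * \<delta> - 1)) * (\<integral>\<^sup>+ p. (f p)\<^sup>2 \<partial>lborel) * (\<integral>\<^sup>+ p. (g p)\<^sup>2 \<partial>lborel))"
proof -
  let ?I = "UNIV :: (3 \<Rightarrow> bool) set"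
  define D where "D = ennreal (64 * pi / \<delta>\<^sup>2 * k powr (2 * \<delta> - 1))"
  define L where "L f \<sigma> = (\<lambda>p. f p * indicator (octant \<sigma>) p :: ennreal)" for f and \<sigma> :: "3 \<Rightarrow> bool"
  define W where "W \<sigma> = (\<lambda>p. w p * indicator (octant \<sigma>) p)" for \<sigma> :: "3 \<Rightarrow> bool"
  have [measurable]: "w \<in> borel_measurable borel" unfolding w_def by measurable
  have [measurable]: "W \<sigma> \<in> borel_measurable borel" for \<sigma> unfolding W_def by measurable
  have [measurable]: "L h \<sigma> \<in> borel_measurable borel" if [measurable]: "h \<in> borel_measurable borel" for h \<sigma>
    unfolding L_def by measurable
  have split: "h p * w p = (\<Sum>\<sigma>\<in>?I. L h \<sigma> p * W \<sigma> p)" for h p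
  proof -
    have "(\<Sum>\<sigma>\<in>?I. L h \<sigma> p * W \<sigma> p) = (\<Sum>\<sigma>\<in>?I. (h p * w p) * indicator (octant \<sigma>) p)"
      by (intro sum.cong) (auto simp: L_def W_def split: split_indicator)
    then show ?thesis by (simp add: sum_distrib_left[symmetric] sum_indicator_octant)
  qed
  have W2: "(\<lambda>p. (W \<sigma> p)\<^sup>2) = (\<lambda>p. ennreal (shell_weight k p) * indicator (octant \<sigma>) p)" for \<sigma>
    by (auto simp: W_def w_def fun_eq_iff ennreal_power less_imp_le[OF shell_weight_pos] split: split_indicator)
  have conv: "(\<integral>\<^sup>+ \<zeta>. (convolve (\<lambda>p. L h \<sigma> p * W \<sigma> p) (\<lambda>p. L h \<sigma> p * W \<sigma> p) \<zeta>)\<^sup>2 \<partial>lborel)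
     \<le> D * (\<integral>\<^sup>+ p. (L h \<sigma> p)\<^sup>2 \<partial>lborel)\<^sup>2" if [measurable]: "h \<in> borel_measurable borel" for h \<sigma>
  proof (rule nn_integral_convolve_sq_le)
    show "convolve (\<lambda>p. (W \<sigma> p)\<^sup>2) (\<lambda>p. (W \<sigma> p)\<^sup>2) \<zeta> \<le> D" if "\<zeta> \<noteq> 0" for \<zeta>
      unfolding W2 D_def by (rule convolve_shell_octant_le[OF k \<delta> that])
  qed auto
  have corr: "(\<integral>\<^sup>+ \<zeta>. (correlate (\<lambda>p. L f \<sigma> p * W \<sigma> p) (\<lambda>p. L g \<tau> p * W \<tau> p) \<zeta>)\<^sup>2 \<partial>lborel)
     \<le> D * (\<integral>\<^sup>+ p. (L f \<sigma> p)\<^sup>2 \<partial>lborel) * (\<integral>\<^sup>+ p. (L g \<tau> p)\<^sup>2 \<partial>lborel)" for \<sigma> \<tau>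
  proof (rule ennreal_le_of_power2_le)
    let ?F = "\<lambda>p. L f \<sigma> p * W \<sigma> p" and ?G = "\<lambda>p. L g \<tau> p * W \<tau> p"
    have "(\<integral>\<^sup>+ \<zeta>. (correlate ?F ?G \<zeta>)\<^sup>2 \<partial>lborel)\<^sup>2 = (\<integral>\<^sup>+ \<eta>. correlate ?F ?F \<eta> * correlate ?G ?G \<eta> \<partial>lborel)\<^sup>2"
      by (subst nn_integral_correlate_sq) auto
    also have "\<dots> \<le> (\<integral>\<^sup>+ \<eta>. (correlate ?F ?F \<eta>)\<^sup>2 \<partial>lborel) * (\<integral>\<^sup>+ \<eta>. (correlate ?G ?G \<eta>)\<^sup>2 \<partial>lborel)"
      by (rule Cauchy_Schwarz_nn_integral) auto
    also have "\<dots> \<le> (D * (\<integral>\<^sup>+ p. (L f \<sigma> p)\<^sup>2 \<partial>lborel)\<^sup>2) * (D * (\<integral>\<^sup>+ p. (L g \<tau> p)\<^sup>2 \<partial>lborel)\<^sup>2)"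
      by (subst (1 2) nn_integral_autocorrelate_sq) (auto intro!: mult_mono conv)
    finally show "(\<integral>\<^sup>+ \<zeta>. (correlate ?F ?G \<zeta>)\<^sup>2 \<partial>lborel)\<^sup>2
      \<le> (D * (\<integral>\<^sup>+ p. (L f \<sigma> p)\<^sup>2 \<partial>lborel) * (\<integral>\<^sup>+ p. (L g \<tau> p)\<^sup>2 \<partial>lborel))\<^sup>2"
      by (simp add: power2_eq_square mult_ac)
  qed
  \<comment> \<open>The octants are disjoint, so the masses of the pieces add up without
    loss.\<close>
  have tot: "(\<Sum>\<sigma>\<in>?I. (\<integral>\<^sup>+ p. (L h \<sigma> p)\<^sup>2 \<partial>lborel)) = (\<integral>\<^sup>+ p. (h p)\<^sup>2 \<partial>lborel)"
    if [measurable]: "h \<in> borel_measurable borel" for h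
  proof -
    have "(\<Sum>\<sigma>\<in>?I. (\<integral>\<^sup>+ p. (L h \<sigma> p)\<^sup>2 \<partial>lborel)) = (\<integral>\<^sup>+ p. (\<Sum>\<sigma>\<in>?I. (L h \<sigma> p)\<^sup>2) \<partial>lborel)"
      by (subst nn_integral_sum) auto
    also have "\<dots> = (\<integral>\<^sup>+ p. (\<Sum>\<sigma>\<in>?I. (h p)\<^sup>2 * indicator (octant \<sigma>) p) \<partial>lborel)"
      by (intro nn_integral_cong sum.cong) (auto simp: L_def split: split_indicator)
    finally show ?thesis by (simp add: sum_distrib_left[symmetric] sum_indicator_octant)
  qed
  have "(\<integral>\<^sup>+ \<zeta>. (correlate (\<lambda>p. f p * w p) (\<lambda>p. g p * w p) \<zeta>)\<^sup>2 \<partial>lborel)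
     = (\<integral>\<^sup>+ \<zeta>. (\<Sum>(\<sigma>, \<tau>)\<in>?I \<times> ?I. correlate (\<lambda>p. L f \<sigma> p * W \<sigma> p) (\<lambda>p. L g \<tau> p * W \<tau> p) \<zeta>)\<^sup>2 \<partial>lborel)"
    unfolding split by (subst correlate_sum) auto
  also have "\<dots> \<le> (\<integral>\<^sup>+ \<zeta>. 64 * (\<Sum>(\<sigma>, \<tau>)\<in>?I \<times> ?I. (correlate (\<lambda>p. L f \<sigma> p * W \<sigma> p) (\<lambda>p. L g \<tau> p * W \<tau> p) \<zeta>)\<^sup>2) \<partial>lborel)"
  proof (rule nn_integral_mono)
    fix \<zeta>
    have "card (?I \<times> ?I) = 64" by (simp add: card_cartesian_product card_fun)
    then show "(\<Sum>(\<sigma>, \<tau>)\<in>?I \<times> ?I. correlate (\<lambda>p. L f \<sigma> p * W \<sigma> p) (\<lambda>p. L g \<tau> p * W \<tau> p) \<zeta>)\<^sup>2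
      \<le> 64 * (\<Sum>(\<sigma>, \<tau>)\<in>?I \<times> ?I. (correlate (\<lambda>p. L f \<sigma> p * W \<sigma> p) (\<lambda>p. L g \<tau> p * W \<tau> p) \<zeta>)\<^sup>2)"
      using ennreal_sum_power2_le[of "?I \<times> ?I" "\<lambda>(\<sigma>, \<tau>). correlate (\<lambda>p. L f \<sigma> p * W \<sigma> p) (\<lambda>p. L g \<tau> p * W \<tau> p) \<zeta>"]
      by (simp add: case_prod_beta)
  qed
  also have "\<dots> = 64 * (\<Sum>(\<sigma>, \<tau>)\<in>?I \<times> ?I. \<integral>\<^sup>+ \<zeta>. (correlate (\<lambda>p. L f \<sigma> p * W \<sigma> p) (\<lambda>p. L g \<tau> p * W \<tau> p) \<zeta>)\<^sup>2 \<partial>lborel)"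
    by (simp add: nn_integral_cmult nn_integral_sum case_prod_beta)
  also have "\<dots> \<le> 64 * (\<Sum>(\<sigma>, \<tau>)\<in>?I \<times> ?I. D * (\<integral>\<^sup>+ p. (L f \<sigma> p)\<^sup>2 \<partial>lborel) * (\<integral>\<^sup>+ p. (L g \<tau> p)\<^sup>2 \<partial>lborel))"
    by (intro mult_left_mono sum_mono) (auto intro!: corr)
  also have "(\<Sum>(\<sigma>, \<tau>)\<in>?I \<times> ?I. D * (\<integral>\<^sup>+ p. (L f \<sigma> p)\<^sup>2 \<partial>lborel) * (\<integral>\<^sup>+ p. (L g \<tau> p)\<^sup>2 \<partial>lborel))
    = D * (\<Sum>\<sigma>\<in>?I. (\<integral>\<^sup>+ p. (L f \<sigma> p)\<^sup>2 \<partial>lborel)) * (\<Sum>\<tau>\<in>?I. (\<integral>\<^sup>+ p. (L g \<tau> p)\<^sup>2 \<partial>lborel))"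
  proof -
    have "(\<Sum>(\<sigma>, \<tau>)\<in>?I \<times> ?I. D * u \<sigma> * v \<tau>) = D * (\<Sum>\<sigma>\<in>?I. u \<sigma>) * (\<Sum>\<tau>\<in>?I. v \<tau>)"
      for u v :: "(3 \<Rightarrow> bool) \<Rightarrow> ennreal"
      unfolding mult.assoc sum_product unfolding sum_distrib_left sum.cartesian_product
      by (simp add: case_prod_beta)
    then show ?thesis .
  qed
  finally show ?thesis
    by (simp add: tot D_def)
qed

section \<open>The operators between momentum shells\<close>

text \<open>Each weight of the chain is divided into two square roots, one for the factor on either
  side. This makes the kernel symmetric in its weights and brings it into the form controlled by the
  correlation estimate.\<close>

definition shell_op :: "real \<Rightarrow> (real ^ 3 \<Rightarrow> ennreal) \<Rightarrow> (real ^ 3 \<Rightarrow> ennreal) \<Rightarrow> real ^ 3 \<Rightarrow> ennreal" where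
  "shell_op k a g p =
     ennreal (sqrt (shell_weight k p)) * (\<integral>\<^sup>+ r. a (p - r) * (ennreal (sqrt (shell_weight k r)) * g r) \<partial>lborel)"

lemma borel_measurable_shell_op [measurable]:
  assumes [measurable]: "a \<in> borel_measurable borel" "g \<in> borel_measurable borel"
  shows "shell_op k a g \<in> borel_measurable borel"
  unfolding shell_op_def by measurable

text \<open>After the substitution \<zeta> = p - r the pairing is the integral of \<open>a\<close>
  against a correlation, and Cauchy-Schwarz reduces it to the octant estimate. The constant 4096 is
  64 * 64.\<close>

lemma nn_integral_mult_shell_op_le:
  fixes a f g :: "real ^ 3 \<Rightarrow> ennreal"
  assumes [measurable]: "a \<in> borel_measurable borel" "f \<in> borel_measurable borel" "g \<in> borel_measurable borel"
    and k: "1 \<le> k" and \<delta>: "0 < \<delta>" "\<delta> < 1 / 2"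
  shows "(\<integral>\<^sup>+ p. f p * shell_op k a g p \<partial>lborel)\<^sup>2
    \<le> ennreal (4096 * pi / \<delta>\<^sup>2 * k powr (2 * \<delta> - 1)) * (\<integral>\<^sup>+ p. (a p)\<^sup>2 \<partial>lborel)
        * (\<integral>\<^sup>+ p. (f p)\<^sup>2 \<partial>lborel) * (\<integral>\<^sup>+ p. (g p)\<^sup>2 \<partial>lborel)"
proof -
  let ?w = "\<lambda>p. ennreal (sqrt (shell_weight k p))"
  have "(\<integral>\<^sup>+ p. f p * shell_op k a g p \<partial>lborel)
    = (\<integral>\<^sup>+ p. (\<integral>\<^sup>+ r. a (p - r) * (f p * ?w p * (g r * ?w r)) \<partial>lborel) \<partial>lborel)"
    unfolding shell_op_def by (subst nn_integral_cmult[symmetric], simp)+ (simp add: mult_ac)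
  also have "\<dots> = (\<integral>\<^sup>+ p. (\<integral>\<^sup>+ \<zeta>. a \<zeta> * (f p * ?w p * (g (p - \<zeta>) * ?w (p - \<zeta>))) \<partial>lborel) \<partial>lborel)"
  proof (rule nn_integral_cong)
    fix p
    show "(\<integral>\<^sup>+ r. a (p - r) * (f p * ?w p * (g r * ?w r)) \<partial>lborel)
      = (\<integral>\<^sup>+ \<zeta>. a \<zeta> * (f p * ?w p * (g (p - \<zeta>) * ?w (p - \<zeta>))) \<partial>lborel)"
      using nn_integral_reflect[of "\<lambda>\<zeta>. a \<zeta> * (f p * ?w p * (g (p - \<zeta>) * ?w (p - \<zeta>)))" p] by simp
  qed
  also have "\<dots> = (\<integral>\<^sup>+ \<zeta>. (\<integral>\<^sup>+ p. a \<zeta> * (f p * ?w p * (g (p - \<zeta>) * ?w (p - \<zeta>))) \<partial>lborel) \<partial>lborel)"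
    by (intro nn_integral_swap) measurable
  also have "\<dots> = (\<integral>\<^sup>+ \<zeta>. a \<zeta> * correlate (\<lambda>p. f p * ?w p) (\<lambda>p. g p * ?w p) \<zeta> \<partial>lborel)"
    unfolding correlate_def by (intro nn_integral_cong nn_integral_cmult) measurable
  finally have "(\<integral>\<^sup>+ p. f p * shell_op k a g p \<partial>lborel)\<^sup>2
    \<le> (\<integral>\<^sup>+ p. (a p)\<^sup>2 \<partial>lborel) * (\<integral>\<^sup>+ \<zeta>. (correlate (\<lambda>p. f p * ?w p) (\<lambda>p. g p * ?w p) \<zeta>)\<^sup>2 \<partial>lborel)"
    using Cauchy_Schwarz_nn_integral[of a lborel "correlate (\<lambda>p. f p * ?w p) (\<lambda>p. g p * ?w p)"] by simp
  also have "\<dots> \<le> (\<integral>\<^sup>+ p. (a p)\<^sup>2 \<partial>lborel) * (64 * (ennreal (64 * pi / \<delta>\<^sup>2 * k powr (2 * \<delta> - 1))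
     * (\<integral>\<^sup>+ p. (f p)\<^sup>2 \<partial>lborel) * (\<integral>\<^sup>+ p. (g p)\<^sup>2 \<partial>lborel)))"
    by (intro mult_left_mono nn_integral_correlate_shell_le k \<delta>) auto
  also have "ennreal (4096 * pi / \<delta>\<^sup>2 * k powr (2 * \<delta> - 1)) = 64 * ennreal (64 * pi / \<delta>\<^sup>2 * k powr (2 * \<delta> - 1))"
  proof -
    have "64 * ennreal (64 * pi / \<delta>\<^sup>2 * k powr (2 * \<delta> - 1)) = ennreal (64 * (64 * pi / \<delta>\<^sup>2 * k powr (2 * \<delta> - 1)))"
      by (subst ennreal_mult) auto
    then show ?thesis by (simp add: mult.assoc)
  qed
  then have "(\<integral>\<^sup>+ p. (a p)\<^sup>2 \<partial>lborel) * (64 * (ennreal (64 * pi / \<delta>\<^sup>2 * k powr (2 * \<delta> - 1))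
     * (\<integral>\<^sup>+ p. (f p)\<^sup>2 \<partial>lborel) * (\<integral>\<^sup>+ p. (g p)\<^sup>2 \<partial>lborel)))
    = ennreal (4096 * pi / \<delta>\<^sup>2 * k powr (2 * \<delta> - 1)) * (\<integral>\<^sup>+ p. (a p)\<^sup>2 \<partial>lborel)
        * (\<integral>\<^sup>+ p. (f p)\<^sup>2 \<partial>lborel) * (\<integral>\<^sup>+ p. (g p)\<^sup>2 \<partial>lborel)"
    by (simp add: mult_ac)
  finally show ?thesis .
qed

text \<open>Testing with \<open>u\<close> itself would give I^2 <= B I for I the integral of u^2,
  and I can be cancelled only if it is finite. Hence the tests are \<open>u\<close> cut off in
  height and in space, followed by monotone convergence.\<close>

lemma nn_integral_power2_le_of_pairing:
  fixes u :: "'a::euclidean_space \<Rightarrow> ennreal"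
  assumes [measurable]: "u \<in> borel_measurable borel"
    and pair: "\<And>f. f \<in> borel_measurable borel \<Longrightarrow>
      (\<integral>\<^sup>+ x. f x * u x \<partial>lborel)\<^sup>2 \<le> B * (\<integral>\<^sup>+ x. (f x)\<^sup>2 \<partial>lborel)"
  shows "(\<integral>\<^sup>+ x. (u x)\<^sup>2 \<partial>lborel) \<le> B"
proof (cases "B = \<top>")
  case False
  define f where "f n x = min (u x) (of_nat n) * indicator (cball 0 (real n)) x" for n :: nat and x
  have [measurable]: "cball 0 (real n) \<in> sets (borel :: 'a measure)" for n by simp
  have [measurable]: "f n \<in> borel_measurable borel" for n unfolding f_def by measurable
  have le: "f n x \<le> u x" for n x by (auto simp: f_def split: split_indicator)
  have bd: "(\<integral>\<^sup>+ x. (f n x)\<^sup>2 \<partial>lborel) \<le> B" for n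
  proof -
    define I where "I = (\<integral>\<^sup>+ x. (f n x)\<^sup>2 \<partial>lborel)"
    have "I \<le> (\<integral>\<^sup>+ x. (of_nat n)\<^sup>2 * indicator (cball 0 (real n)) x \<partial>(lborel :: 'a measure))"
      unfolding I_def by (intro nn_integral_mono) (auto simp: f_def split: split_indicator intro!: power_mono)
    also have "\<dots> = (of_nat n)\<^sup>2 * emeasure (lborel :: 'a measure) (cball 0 (real n))"
      by (subst nn_integral_cmult_indicator) auto
    also have "\<dots> < \<top>"
      using emeasure_lborel_cball_finite[of "0::'a" "real n"] by (simp add: ennreal_mult_less_top power_less_top_ennreal ennreal_of_nat_eq_real_of_nat)
    finally have fin: "I < \<top>" .
    have "I \<le> (\<integral>\<^sup>+ x. f n x * u x \<partial>lborel)"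
      unfolding I_def by (intro nn_integral_mono) (auto simp: power2_eq_square intro!: mult_left_mono le)
    then have "I\<^sup>2 \<le> (\<integral>\<^sup>+ x. f n x * u x \<partial>lborel)\<^sup>2" by (intro power_mono) auto
    also have "\<dots> \<le> B * I" unfolding I_def by (rule pair) measurable
    finally have "I * I \<le> I * B" by (simp add: power2_eq_square mult.commute)
    show ?thesis
    proof (cases "I = 0")
      case False
      then show ?thesis using fin \<open>I * I \<le> I * B\<close> 
        by (simp add: ennreal_mult_le_mult_iff I_def)
    qed (simp add: I_def)
  qed
  have "(\<lambda>n. \<integral>\<^sup>+ x. (f n x)\<^sup>2 \<partial>lborel) \<longlonglongrightarrow> (\<integral>\<^sup>+ x. (u x)\<^sup>2 \<partial>lborel)"
  proof (rule nn_integral_LIMSEQ)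
    show "incseq (\<lambda>n x. (f n x)\<^sup>2)"
    proof (rule incseq_SucI, rule le_funI, rule power_mono)
      fix n x
      show "f n x \<le> f (Suc n) x"
        by (auto simp: f_def split: split_indicator intro!: min.coboundedI2 add_increasing)
    qed simp
    fix x
    have lim: "(\<lambda>n. min (u x) (of_nat n)) \<longlonglongrightarrow> u x"
    proof -
      have "(\<lambda>n. min (u x) (of_nat n)) \<longlonglongrightarrow> min (u x) \<top>"
        by (intro tendsto_min tendsto_const) (rule of_nat_tendsto_top_ennreal)
      then show ?thesis by simp
    qed
    have "\<forall>\<^sub>F n in sequentially. f n x = min (u x) (of_nat n)"
      using eventually_ge_at_top[of "nat \<lceil>norm x\<rceil>"]
    proof eventually_elim
      case (elim n)
      then have "norm x \<le> real n" by linarith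
      then show ?case by (simp add: f_def)
    qed
    then have "(\<lambda>n. f n x) \<longlonglongrightarrow> u x"
      using lim by (simp add: tendsto_cong)
    then show "(\<lambda>n. (f n x)\<^sup>2) \<longlonglongrightarrow> (u x)\<^sup>2"
      unfolding power2_eq_square by (intro tendsto_mult_ennreal) auto
  qed auto
  then show ?thesis by (rule LIMSEQ_le_const2) (use bd in auto)
qed simp

lemma nn_integral_shell_op_sq_le:
  fixes a g :: "real ^ 3 \<Rightarrow> ennreal"
  assumes [measurable]: "a \<in> borel_measurable borel" "g \<in> borel_measurable borel"
    and k: "1 \<le> k" and \<delta>: "0 < \<delta>" "\<delta> < 1 / 2"
  shows "(\<integral>\<^sup>+ p. (shell_op k a g p)\<^sup>2 \<partial>lborel)
    \<le> ennreal (4096 * pi / \<delta>\<^sup>2 * k powr (2 * \<delta> - 1)) * (\<integral>\<^sup>+ p. (a p)\<^sup>2 \<partial>lborel) * (\<integral>\<^sup>+ p. (g p)\<^sup>2 \<partial>lborel)"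
proof (rule nn_integral_power2_le_of_pairing)
  fix f :: "real ^ 3 \<Rightarrow> ennreal" assume [measurable]: "f \<in> borel_measurable borel"
  show "(\<integral>\<^sup>+ x. f x * shell_op k a g x \<partial>lborel)\<^sup>2
    \<le> ennreal (4096 * pi / \<delta>\<^sup>2 * k powr (2 * \<delta> - 1)) * (\<integral>\<^sup>+ p. (a p)\<^sup>2 \<partial>lborel) * (\<integral>\<^sup>+ p. (g p)\<^sup>2 \<partial>lborel)
        * (\<integral>\<^sup>+ x. (f x)\<^sup>2 \<partial>lborel)"
    using nn_integral_mult_shell_op_le[of a f g k \<delta>] k \<delta> by (simp add: mult_ac)
qed simp

text \<open>The four potentials are separate arguments so that one of them at a time can be replaced
  by its part at frequencies of length at least k / 2.\<close>

definition quartic_chain ::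
  "real \<Rightarrow> (real ^ 3 \<Rightarrow> ennreal) \<Rightarrow> (real ^ 3 \<Rightarrow> ennreal) \<Rightarrow> (real ^ 3 \<Rightarrow> ennreal) \<Rightarrow> (real ^ 3 \<Rightarrow> ennreal)
    \<Rightarrow> real ^ 3 \<Rightarrow> real ^ 3 \<Rightarrow> ennreal" where
  "quartic_chain k a\<^sub>1 a\<^sub>2 a\<^sub>3 a\<^sub>4 x y =
     (\<integral>\<^sup>+ p\<^sub>1. (\<integral>\<^sup>+ p\<^sub>2. (\<integral>\<^sup>+ p\<^sub>3.
        ennreal (shell_weight k p\<^sub>1) * ennreal (shell_weight k p\<^sub>2) * ennreal (shell_weight k p\<^sub>3)
        * (a\<^sub>1 (x - p\<^sub>1) * a\<^sub>2 (p\<^sub>1 - p\<^sub>2) * a\<^sub>3 (p\<^sub>2 - p\<^sub>3) * a\<^sub>4 (p\<^sub>3 - y)) \<partial>lborel) \<partial>lborel) \<partial>lborel)"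

text \<open>The chain is the pairing of \<open>f\<^sub>1\<close> with two operators applied to
  \<open>f\<^sub>4\<close>, and these end factors absorb the outer square roots. After squaring,
  each operator contributes k powr (2 \<delta> - 1) and each end 1 / k, so the total exponent is 4
  \<delta> - 4.\<close>

lemma quartic_chain_sq_le:
  assumes [measurable]: "a\<^sub>1 \<in> borel_measurable borel" "a\<^sub>2 \<in> borel_measurable borel"
      "a\<^sub>3 \<in> borel_measurable borel" "a\<^sub>4 \<in> borel_measurable borel"
    and k: "1 \<le> k" and \<delta>: "0 < \<delta>" "\<delta> < 1 / 2"
  shows "(quartic_chain k a\<^sub>1 a\<^sub>2 a\<^sub>3 a\<^sub>4 x y)\<^sup>2
    \<le> ennreal ((4096 * pi / \<delta>\<^sup>2)\<^sup>2 * k powr (4 * \<delta> - 4)) *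
       ((\<integral>\<^sup>+ p. (a\<^sub>1 p)\<^sup>2 \<partial>lborel) * (\<integral>\<^sup>+ p. (a\<^sub>2 p)\<^sup>2 \<partial>lborel) * (\<integral>\<^sup>+ p. (a\<^sub>3 p)\<^sup>2 \<partial>lborel) * (\<integral>\<^sup>+ p. (a\<^sub>4 p)\<^sup>2 \<partial>lborel))"
proof -
  let ?w = "\<lambda>p. ennreal (sqrt (shell_weight k p))"
  define N where "N = ennreal (4096 * pi / \<delta>\<^sup>2 * k powr (2 * \<delta> - 1))"
  define c where "c = ennreal (1 / k)"
  define f\<^sub>1 where "f\<^sub>1 p = ?w p * a\<^sub>1 (x - p)" for p
  define f\<^sub>4 where "f\<^sub>4 p = ?w p * a\<^sub>4 (p - y)" for p
  have [measurable]: "f\<^sub>1 \<in> borel_measurable borel" "f\<^sub>4 \<in> borel_measurable borel"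
    unfolding f\<^sub>1_def f\<^sub>4_def by measurable
  have w2: "ennreal (shell_weight k p) = ?w p * ?w p" for p
    by (simp add: ennreal_mult[symmetric] less_imp_le[OF shell_weight_pos])
  have w2': "(?w p)\<^sup>2 \<le> c" for p
  proof -
    have "shell_weight k p \<le> 1 / (1 + k)" using k by (intro shell_weight_le) auto
    also have "\<dots> \<le> 1 / k" using k by (intro divide_left_mono) auto
    finally show ?thesis by (simp add: power2_eq_square w2[symmetric] c_def ennreal_leI)
  qed
  have "quartic_chain k a\<^sub>1 a\<^sub>2 a\<^sub>3 a\<^sub>4 x y
     = (\<integral>\<^sup>+ p\<^sub>1. f\<^sub>1 p\<^sub>1 * shell_op k a\<^sub>2 (shell_op k a\<^sub>3 f\<^sub>4) p\<^sub>1 \<partial>lborel)"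
    unfolding quartic_chain_def shell_op_def f\<^sub>1_def f\<^sub>4_def w2
    by (subst nn_integral_cmult[symmetric], measurable)+
       (intro nn_integral_cong, simp add: mult_ac)
  then have "(quartic_chain k a\<^sub>1 a\<^sub>2 a\<^sub>3 a\<^sub>4 x y)\<^sup>2
    \<le> N * (\<integral>\<^sup>+ p. (a\<^sub>2 p)\<^sup>2 \<partial>lborel) * (\<integral>\<^sup>+ p. (f\<^sub>1 p)\<^sup>2 \<partial>lborel) * (\<integral>\<^sup>+ p. (shell_op k a\<^sub>3 f\<^sub>4 p)\<^sup>2 \<partial>lborel)"
    unfolding N_def by (simp only:) (intro nn_integral_mult_shell_op_le k \<delta>, measurable)
  also have "\<dots> \<le> N * (\<integral>\<^sup>+ p. (a\<^sub>2 p)\<^sup>2 \<partial>lborel) * (c * (\<integral>\<^sup>+ p. (a\<^sub>1 p)\<^sup>2 \<partial>lborel))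
      * (N * (\<integral>\<^sup>+ p. (a\<^sub>3 p)\<^sup>2 \<partial>lborel) * (c * (\<integral>\<^sup>+ p. (a\<^sub>4 p)\<^sup>2 \<partial>lborel)))"
  proof (intro mult_mono order_refl)
    have "(\<integral>\<^sup>+ p. (f\<^sub>1 p)\<^sup>2 \<partial>lborel) \<le> (\<integral>\<^sup>+ p. c * (a\<^sub>1 (x - p))\<^sup>2 \<partial>lborel)"
      unfolding f\<^sub>1_def power_mult_distrib by (intro nn_integral_mono mult_right_mono w2') auto
    also have "\<dots> = c * (\<integral>\<^sup>+ p. (a\<^sub>1 p)\<^sup>2 \<partial>lborel)"
      using nn_integral_reflect[of "\<lambda>p. (a\<^sub>1 p)\<^sup>2" x] by (simp add: nn_integral_cmult)
    finally show "(\<integral>\<^sup>+ p. (f\<^sub>1 p)\<^sup>2 \<partial>lborel) \<le> c * (\<integral>\<^sup>+ p. (a\<^sub>1 p)\<^sup>2 \<partial>lborel)" .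
    have "(\<integral>\<^sup>+ p. (f\<^sub>4 p)\<^sup>2 \<partial>lborel) \<le> (\<integral>\<^sup>+ p. c * (a\<^sub>4 (p - y))\<^sup>2 \<partial>lborel)"
      unfolding f\<^sub>4_def power_mult_distrib by (intro nn_integral_mono mult_right_mono w2') auto
    also have "\<dots> = c * (\<integral>\<^sup>+ p. (a\<^sub>4 p)\<^sup>2 \<partial>lborel)"
      using nn_integral_translate[of "\<lambda>p. (a\<^sub>4 p)\<^sup>2" "- y"] by (simp add: nn_integral_cmult)
    finally have f4: "(\<integral>\<^sup>+ p. (f\<^sub>4 p)\<^sup>2 \<partial>lborel) \<le> c * (\<integral>\<^sup>+ p. (a\<^sub>4 p)\<^sup>2 \<partial>lborel)" .
    have "(\<integral>\<^sup>+ p. (shell_op k a\<^sub>3 f\<^sub>4 p)\<^sup>2 \<partial>lborel) \<le> N * (\<integral>\<^sup>+ p. (a\<^sub>3 p)\<^sup>2 \<partial>lborel) * (\<integral>\<^sup>+ p. (f\<^sub>4 p)\<^sup>2 \<partial>lborel)"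
      unfolding N_def by (intro nn_integral_shell_op_sq_le k \<delta>) measurable
    also have "\<dots> \<le> N * (\<integral>\<^sup>+ p. (a\<^sub>3 p)\<^sup>2 \<partial>lborel) * (c * (\<integral>\<^sup>+ p. (a\<^sub>4 p)\<^sup>2 \<partial>lborel))"
      by (intro mult_left_mono f4) auto
    finally show "(\<integral>\<^sup>+ p. (shell_op k a\<^sub>3 f\<^sub>4 p)\<^sup>2 \<partial>lborel) \<le> N * (\<integral>\<^sup>+ p. (a\<^sub>3 p)\<^sup>2 \<partial>lborel) * (c * (\<integral>\<^sup>+ p. (a\<^sub>4 p)\<^sup>2 \<partial>lborel))" .
  qed auto
  also have "\<dots> = (N * N * (c * c)) * ((\<integral>\<^sup>+ p. (a\<^sub>1 p)\<^sup>2 \<partial>lborel) * (\<integral>\<^sup>+ p. (a\<^sub>2 p)\<^sup>2 \<partial>lborel) * (\<integral>\<^sup>+ p. (a\<^sub>3 p)\<^sup>2 \<partial>lborel) * (\<integral>\<^sup>+ p. (a\<^sub>4 p)\<^sup>2 \<partial>lborel))"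
    by (simp add: mult_ac)
  also have "N * N * (c * c) = ennreal ((4096 * pi / \<delta>\<^sup>2)\<^sup>2 * k powr (4 * \<delta> - 4))"
  proof -
    have "4 * \<delta> - 4 = (2 * \<delta> - 1) + (2 * \<delta> - 1) + (- 1 + - 1)" by simp
    then have "k powr (4 * \<delta> - 4) = k powr (2 * \<delta> - 1) * k powr (2 * \<delta> - 1) * (k powr - 1 * k powr - 1)"
      by (simp only: powr_add)
    also have "k powr - 1 = 1 / k" using k by (simp add: powr_minus divide_inverse)
    finally have p: "k powr (4 * \<delta> - 4) = k powr (2 * \<delta> - 1) * k powr (2 * \<delta> - 1) * (1 / k * (1 / k))" .
    have "0 \<le> 4096 * pi / \<delta>\<^sup>2 * k powr (2 * \<delta> - 1)" "0 \<le> 1 / k" using k by auto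
    then have "N * N * (c * c) = ennreal (4096 * pi / \<delta>\<^sup>2 * k powr (2 * \<delta> - 1) * (4096 * pi / \<delta>\<^sup>2 * k powr (2 * \<delta> - 1)) * (1 / k * (1 / k)))"
      unfolding N_def c_def by (simp only: ennreal_mult mult_nonneg_nonneg)
    then show ?thesis unfolding p by (simp add: power2_eq_square mult_ac)
  qed
  finally show ?thesis .
qed

lemma quartic_chain_split:
  assumes [measurable]: "a \<in> borel_measurable borel" and xy: "norm (x - y) = 2 * k"
  defines "b \<equiv> (\<lambda>p. a p * indicator {p. k / 2 \<le> norm p} p)"
  shows "quartic_chain k a a a a x y \<le> quartic_chain k b a a a x y + quartic_chain k a b a a x y
    + quartic_chain k a a b a x y + quartic_chain k a a a b x y"
proof -
  have [measurable]: "b \<in> borel_measurable borel" unfolding b_def by measurable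
  have main: "a (x - p\<^sub>1) * a (p\<^sub>1 - p\<^sub>2) * a (p\<^sub>2 - p\<^sub>3) * a (p\<^sub>3 - y)
     \<le> b (x - p\<^sub>1) * a (p\<^sub>1 - p\<^sub>2) * a (p\<^sub>2 - p\<^sub>3) * a (p\<^sub>3 - y) + a (x - p\<^sub>1) * b (p\<^sub>1 - p\<^sub>2) * a (p\<^sub>2 - p\<^sub>3) * a (p\<^sub>3 - y)
      + a (x - p\<^sub>1) * a (p\<^sub>1 - p\<^sub>2) * b (p\<^sub>2 - p\<^sub>3) * a (p\<^sub>3 - y) + a (x - p\<^sub>1) * a (p\<^sub>1 - p\<^sub>2) * a (p\<^sub>2 - p\<^sub>3) * b (p\<^sub>3 - y)"
    (is "?A \<le> ?B1 + ?B2 + ?B3 + ?B4") for p\<^sub>1 p\<^sub>2 p\<^sub>3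
  proof -
    have "2 * k \<le> norm (x - p\<^sub>1) + norm (p\<^sub>1 - p\<^sub>2) + norm (p\<^sub>2 - p\<^sub>3) + norm (p\<^sub>3 - y)"
      using norm_triangle_ineq[of "x - p\<^sub>1" "p\<^sub>1 - y"] norm_triangle_ineq[of "p\<^sub>1 - p\<^sub>2" "p\<^sub>2 - y"]
        norm_triangle_ineq[of "p\<^sub>2 - p\<^sub>3" "p\<^sub>3 - y"] xy by simp
    then consider "k / 2 \<le> norm (x - p\<^sub>1)" | "k / 2 \<le> norm (p\<^sub>1 - p\<^sub>2)" | "k / 2 \<le> norm (p\<^sub>2 - p\<^sub>3)" | "k / 2 \<le> norm (p\<^sub>3 - y)"
      by linarith
    then show ?thesis
    proof cases
      case 1
      then have "?A = ?B1" by (simp add: b_def)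
      then show ?thesis by (metis add_increasing2 order_refl zero_le)
    next
      case 2
      then have "?A = ?B2" by (simp add: b_def)
      then show ?thesis by (metis add_increasing2 add_increasing order_refl zero_le)
    next
      case 3
      then have "?A = ?B3" by (simp add: b_def)
      then show ?thesis by (metis add_increasing2 add_increasing order_refl zero_le)
    next
      case 4
      then have "?A = ?B4" by (simp add: b_def)
      then show ?thesis by (metis add_increasing order_refl zero_le)
    qed
  qed
  have "quartic_chain k a a a a x y \<le> (\<integral>\<^sup>+ p\<^sub>1. (\<integral>\<^sup>+ p\<^sub>2. (\<integral>\<^sup>+ p\<^sub>3.
        ennreal (shell_weight k p\<^sub>1) * ennreal (shell_weight k p\<^sub>2) * ennreal (shell_weight k p\<^sub>3) *
     (b (x - p\<^sub>1) * a (p\<^sub>1 - p\<^sub>2) * a (p\<^sub>2 - p\<^sub>3) * a (p\<^sub>3 - y) + a (x - p\<^sub>1) * b (p\<^sub>1 - p\<^sub>2) * a (p\<^sub>2 - p\<^sub>3) * a (p\<^sub>3 - y)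
      + a (x - p\<^sub>1) * a (p\<^sub>1 - p\<^sub>2) * b (p\<^sub>2 - p\<^sub>3) * a (p\<^sub>3 - y) + a (x - p\<^sub>1) * a (p\<^sub>1 - p\<^sub>2) * a (p\<^sub>2 - p\<^sub>3) * b (p\<^sub>3 - y))
      \<partial>lborel) \<partial>lborel) \<partial>lborel)"
    unfolding quartic_chain_def by (intro nn_integral_mono mult_left_mono main) auto
  also have "\<dots> = quartic_chain k b a a a x y + quartic_chain k a b a a x y
    + quartic_chain k a a b a x y + quartic_chain k a a a b x y"
    unfolding distrib_left quartic_chain_def
    by (simp add: nn_integral_add)
  finally show ?thesis .
qed

text \<open>Cauchy-Schwarz for the sum of four chains, followed by the same bound for each of them,
  accounts for the factor 16 = 4 * 4.\<close>

lemma quartic_chain_decay: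
  assumes [measurable]: "a \<in> borel_measurable borel" and xy: "norm (x - y) = 2 * k"
    and k: "1 \<le> k" and \<delta>: "0 < \<delta>" "\<delta> < 1 / 2"
  shows "(quartic_chain k a a a a x y)\<^sup>2
    \<le> ennreal (16 * (4096 * pi / \<delta>\<^sup>2)\<^sup>2 * k powr (4 * \<delta> - 4)) *
       ((\<integral>\<^sup>+ p. (a p)\<^sup>2 \<partial>lborel) ^ 3 * (\<integral>\<^sup>+ p. (a p)\<^sup>2 * indicator {p. k / 2 \<le> norm p} p \<partial>lborel))"
proof -
  define b where "b = (\<lambda>p. a p * indicator {p. k / 2 \<le> norm p} p)"
  have [measurable]: "b \<in> borel_measurable borel" unfolding b_def by measurable
  define C where "C = ennreal ((4096 * pi / \<delta>\<^sup>2)\<^sup>2 * k powr (4 * \<delta> - 4))"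
  define A where "A = (\<integral>\<^sup>+ p. (a p)\<^sup>2 \<partial>lborel)"
  define B where "B = (\<integral>\<^sup>+ p. (b p)\<^sup>2 \<partial>lborel)"
  have B: "B = (\<integral>\<^sup>+ p. (a p)\<^sup>2 * indicator {p. k / 2 \<le> norm p} p \<partial>lborel)"
    unfolding B_def b_def by (intro nn_integral_cong) (auto split: split_indicator)
  let ?c = "\<lambda>i::nat. if i = 0 then quartic_chain k b a a a x y else if i = 1 then quartic_chain k a b a a x y
     else if i = 2 then quartic_chain k a a b a x y else quartic_chain k a a a b x y"
  have le: "(?c i)\<^sup>2 \<le> C * (A ^ 3 * B)" for i
    using quartic_chain_sq_le[of b a a a k \<delta> x y] quartic_chain_sq_le[of a b a a k \<delta> x y]
      quartic_chain_sq_le[of a a b a k \<delta> x y] quartic_chain_sq_le[of a a a b k \<delta> x y] k \<delta>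
    by (simp add: A_def B_def C_def power3_eq_cube mult_ac)
  have "quartic_chain k a a a a x y \<le> (\<Sum>i<4. ?c i)"
    using quartic_chain_split[of a x y k] xy by (simp add: b_def eval_nat_numeral add_ac)
  then have "(quartic_chain k a a a a x y)\<^sup>2 \<le> (\<Sum>i<4. ?c i)\<^sup>2" by (intro power_mono) auto
  also have "\<dots> \<le> of_nat (card {..<4::nat}) * (\<Sum>i<4. (?c i)\<^sup>2)"
    by (rule ennreal_sum_power2_le) simp
  also have "\<dots> \<le> of_nat (card {..<4::nat}) * (\<Sum>i<4::nat. C * (A ^ 3 * B))"
    by (intro mult_left_mono sum_mono le) auto
  also have "\<dots> = 16 * C * (A ^ 3 * B)" by (simp add: mult.assoc[symmetric])
  also have "16 * C = ennreal (16 * (4096 * pi / \<delta>\<^sup>2)\<^sup>2 * k powr (4 * \<delta> - 4))"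
  proof -
    have "16 * C = ennreal (16 * ((4096 * pi / \<delta>\<^sup>2)\<^sup>2 * k powr (4 * \<delta> - 4)))"
      unfolding C_def by (subst ennreal_mult) auto
    then show ?thesis by (simp add: mult.assoc)
  qed
  finally show ?thesis unfolding A_def B .
qed

section \<open>Fourier inversion\<close>

lemma integrable_pairI:
  fixes f :: "'a::euclidean_space \<Rightarrow> 'b::euclidean_space \<Rightarrow> complex"
  assumes [measurable]: "case_prod f \<in> borel_measurable (borel \<Otimes>\<^sub>M borel)"
    and "(\<integral>\<^sup>+ x. (\<integral>\<^sup>+ y. ennreal (norm (f x y)) \<partial>lborel) \<partial>lborel) < \<infinity>"
  shows "integrable (lborel \<Otimes>\<^sub>M lborel) (case_prod f)"
proof (rule integrableI_bounded)
  have "(\<integral>\<^sup>+ p. ennreal (norm (case_prod f p)) \<partial>(lborel \<Otimes>\<^sub>M lborel))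
    = (\<integral>\<^sup>+ x. (\<integral>\<^sup>+ y. ennreal (norm (f x y)) \<partial>lborel) \<partial>lborel)"
    by (subst lborel.nn_integral_fst[symmetric]) auto
  then show "(\<integral>\<^sup>+ p. ennreal (norm (case_prod f p)) \<partial>(lborel \<Otimes>\<^sub>M lborel)) < \<infinity>"
    using assms by simp
qed simp

text \<open>Exchanges of integrals with an oscillating kernel reduce to this form: a bounded kernel
  times a product of two integrable functions.\<close>

lemma integrable_pair_kernel:
  fixes g :: "'a::euclidean_space \<Rightarrow> complex" and h :: "'b::euclidean_space \<Rightarrow> complex"
  assumes g: "integrable lborel g" and h: "integrable lborel h"
    and [measurable]: "case_prod c \<in> borel_measurable (borel \<Otimes>\<^sub>M borel)"
    and c: "\<And>x y. norm (c x y) \<le> B"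
  shows "integrable (lborel \<Otimes>\<^sub>M lborel) (\<lambda>(x, y). c x y * (g x * h y) :: complex)"
proof (rule integrable_pairI)
  have [measurable]: "g \<in> borel_measurable borel" "h \<in> borel_measurable borel"
    using g h by auto
  show "(\<lambda>(x, y). c x y * (g x * h y)) \<in> borel_measurable (borel \<Otimes>\<^sub>M borel)"
    by measurable
  have "0 \<le> B" using c norm_ge_zero order_trans by blast
  then have "(\<integral>\<^sup>+ x. (\<integral>\<^sup>+ y. ennreal (norm (c x y * (g x * h y))) \<partial>lborel) \<partial>lborel)
    \<le> (\<integral>\<^sup>+ x. (\<integral>\<^sup>+ y. ennreal B * ennreal (norm (g x)) * ennreal (norm (h y)) \<partial>lborel) \<partial>lborel)"
    by (intro nn_integral_mono) (auto simp: norm_mult ennreal_mult[symmetric] mult.assoc intro!: ennreal_leI mult_right_mono c)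
  also have "\<dots> = ennreal B * (\<integral>\<^sup>+ x. ennreal (norm (g x)) \<partial>lborel) * (\<integral>\<^sup>+ y. ennreal (norm (h y)) \<partial>lborel)"
    by (simp add: nn_integral_cmult nn_integral_multc)
  also have "\<dots> < \<infinity>"
    using g h by (auto simp: integrable_iff_bounded ennreal_mult_less_top)
  finally show "(\<integral>\<^sup>+ x. (\<integral>\<^sup>+ y. ennreal (norm (c x y * (g x * h y))) \<partial>lborel) \<partial>lborel) < \<infinity>" .
qed

lemma integral_swap:
  fixes f :: "'a::euclidean_space \<Rightarrow> 'b::euclidean_space \<Rightarrow> complex"
  assumes "integrable (lborel \<Otimes>\<^sub>M lborel) (case_prod f)"
  shows "(LINT x|lborel. (LINT y|lborel. f x y)) = (LINT y|lborel. (LINT x|lborel. f x y))"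
  using lborel_pair.integral_fst[OF assms] lborel_pair.integral_snd[OF assms] by simp

text \<open>On a large box the positive and the negative part of \<open>f\<close> are densities of
  two finite measures. These agree on boxes, which are closed under intersection and generate the
  Borel sets, so the densities agree almost everywhere.\<close>

lemma AE_zero_if_box_integrals_zero_real:
  fixes f :: "'a::euclidean_space \<Rightarrow> real"
  assumes int: "\<And>a b. set_integrable lborel (box a b) f"
    and zero: "\<And>a b. set_lebesgue_integral lborel (box a b) f = 0"
  shows "AE x in lborel. f x = 0"
proof -
  let ?U = "\<lambda>n::nat. box (- (real n *\<^sub>R One)) (real n *\<^sub>R One) :: 'a set"
  have loc: "AE x in lborel. x \<in> ?U n \<longrightarrow> f x = 0" for n
  proof -
    define p where "p x = ennreal (max 0 (f x * indicator (?U n) x))" for x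
    define m where "m x = ennreal (max 0 (- (f x * indicator (?U n) x)))" for x
    have fU: "integrable lborel (\<lambda>x. f x * indicator (box a b) x)" for a b
      using int[of a b] by (simp add: set_integrable_def mult.commute)
    have [measurable]: "(\<lambda>x. f x * indicator (?U n) x) \<in> borel_measurable borel"
      using borel_measurable_integrable[OF fU[of "- (real n *\<^sub>R One)" "real n *\<^sub>R One"]] by simp
    have [measurable]: "p \<in> borel_measurable lborel" "m \<in> borel_measurable lborel"
      unfolding p_def m_def by measurable
    have eq: "(\<integral>\<^sup>+ x. p x * indicator (box a b) x \<partial>lborel) = (\<integral>\<^sup>+ x. m x * indicator (box a b) x \<partial>lborel)
       \<and> (\<integral>\<^sup>+ x. p x * indicator (box a b) x \<partial>lborel) \<noteq> \<infinity>" for a b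
    proof -
      obtain a' b' where ab: "?U n \<inter> box a b = box a' b'" using box_Int_box by blast
      let ?h = "\<lambda>x. f x * indicator (box a' b') x"
      have p: "p x * indicator (box a b) x = ennreal (max 0 (?h x))"
        and m: "m x * indicator (box a b) x = ennreal (max 0 (- ?h x))" for x
        unfolding ab[symmetric] by (auto simp: p_def m_def split: split_indicator)
      have h: "integrable lborel ?h" "integral\<^sup>L lborel ?h = 0"
        using fU zero[of a' b'] by (auto simp: set_lebesgue_integral_def mult.commute)
      have hp: "integrable lborel (\<lambda>x. max 0 (?h x))" "integrable lborel (\<lambda>x. max 0 (- ?h x))"
        using h by auto
      have "integral\<^sup>L lborel ?h = (LINT x|lborel. max 0 (?h x) - max 0 (- ?h x))"
        by (intro Bochner_Integration.integral_cong) auto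
      also have "\<dots> = (LINT x|lborel. max 0 (?h x)) - (LINT x|lborel. max 0 (- ?h x))"
        using hp by (rule Bochner_Integration.integral_diff)
      finally have "(LINT x|lborel. max 0 (?h x)) = (LINT x|lborel. max 0 (- ?h x))" using h by simp
      then show ?thesis unfolding p m
        using hp by (subst (1 2 3) nn_integral_eq_integral) auto
    qed
    have "density lborel p = density lborel m"
    proof (rule measure_eqI_generator_eq)
      let ?E = "range (\<lambda>(a, b). box a b::'a set)"
      show "Int_stable ?E" by (auto simp: Int_stable_def box_Int_box)
      show "?E \<subseteq> Pow UNIV" "sets (density lborel p) = sigma_sets UNIV ?E" "sets (density lborel m) = sigma_sets UNIV ?E"
        by (simp_all add: borel_eq_box)
      show "range ?U \<subseteq> ?E" "(\<Union>i. ?U i) = UNIV" unfolding UN_box_eq_UNIV by auto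
      show "emeasure (density lborel p) (?U i) \<noteq> \<infinity>" for i
        using eq[of "- (real i *\<^sub>R One)" "real i *\<^sub>R One"] by (subst emeasure_density) auto
      show "emeasure (density lborel p) X = emeasure (density lborel m) X" if "X \<in> ?E" for X
        using that eq by (auto simp: emeasure_density)
    qed
    then have "AE x in lborel. p x = m x" by (intro sigma_finite_measure.density_unique[OF sigma_finite_lborel]) auto
    then show ?thesis
      by eventually_elim (auto simp: p_def m_def max_def split: if_splits)
  qed
  have "AE x in lborel. \<forall>n. x \<in> ?U n \<longrightarrow> f x = 0" unfolding AE_all_countable using loc by blast
  then show ?thesis
  proof eventually_elim
    case (elim x)
    then show ?case using UN_box_eq_UNIV[where 'a='a] by blast
  qed
qed

lemma AE_zero_if_box_integrals_zero:
  fixes f :: "'a::euclidean_space \<Rightarrow> complex"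
  assumes int: "\<And>a b. set_integrable lborel (box a b) f"
    and zero: "\<And>a b. set_lebesgue_integral lborel (box a b) f = 0"
  shows "AE x in lborel. f x = 0"
proof -
  have i: "integrable lborel (\<lambda>x. indicator (box a b) x *\<^sub>R f x)"
    and z: "(LINT x|lborel. indicator (box a b) x *\<^sub>R f x) = 0" for a b
    using int zero by (auto simp: set_integrable_def set_lebesgue_integral_def)
  have "AE x in lborel. Re (f x) = 0" "AE x in lborel. Im (f x) = 0"
    using integrable_Re[OF i] integral_Re[OF i] integrable_Im[OF i] integral_Im[OF i] 
    by (auto simp: set_integrable_def set_lebesgue_integral_def z intro!: AE_zero_if_box_integrals_zero_real)
  then show ?thesis by eventually_elim (simp add: complex_eq_iff)
qed

text \<open>Lebesgue measure is the image of a product measure under summation over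
  \<open>Basis\<close>, so products of one-dimensional functions factorize. Gaussians and power
  weights are both treated this way.\<close>

lemma
  fixes f :: "'a::euclidean_space \<Rightarrow> real \<Rightarrow> complex"
  assumes "\<And>b. b \<in> Basis \<Longrightarrow> integrable lborel (f b)"
  shows integrable_lborel_prod_Basis: "integrable lborel (\<lambda>x::'a. \<Prod>b\<in>Basis. f b (x \<bullet> b))"
    and integral_lborel_prod_Basis:
      "(LINT x|lborel. (\<Prod>b\<in>Basis. f b ((x::'a) \<bullet> b))) = (\<Prod>b\<in>Basis. LINT t|lborel. f b t)"
proof -
  interpret product_sigma_finite "\<lambda>_::'a. lborel :: real measure" by standard
  let ?P = "\<Pi>\<^sub>M b\<in>(Basis::'a set). (lborel :: real measure)"
  let ?S = "\<lambda>g. \<Sum>b\<in>Basis. g b *\<^sub>R (b::'a)"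
  have [measurable]: "f b \<in> borel_measurable borel" if "b \<in> Basis" for b
    using assms[OF that] by auto
  have S[measurable]: "?S \<in> measurable ?P borel" by measurable
  have co: "(\<Prod>b\<in>Basis. f b (?S g \<bullet> b)) = (\<Prod>b\<in>Basis. f b (g b))" for g
    by (intro prod.cong refl) (simp add: inner_sum_left_Basis)
  have m: "(\<lambda>x::'a. \<Prod>b\<in>Basis. f b (x \<bullet> b)) \<in> borel_measurable borel"
  proof (rule borel_measurable_prod)
    fix b :: 'a assume "b \<in> Basis"
    then have [measurable]: "f b \<in> borel_measurable borel" using assms by auto
    show "(\<lambda>x::'a. f b (x \<bullet> b)) \<in> borel_measurable borel" by measurable
  qed
  show "integrable lborel (\<lambda>x::'a. \<Prod>b\<in>Basis. f b (x \<bullet> b))"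
    using product_integrable_prod[of "Basis::'a set" f] assms
    by (subst lborel_eq, subst integrable_distr_eq[OF S]) (auto simp: co m simp del: euclidean_representation)
  show "(LINT x|lborel. (\<Prod>b\<in>Basis. f b ((x::'a) \<bullet> b))) = (\<Prod>b\<in>Basis. LINT t|lborel. f b t)"
    using product_integral_prod[of "Basis::'a set" f] assms
    by (subst lborel_eq, subst integral_distr[OF S]) (auto simp: co m simp del: euclidean_representation)
qed

text \<open>The integral is the characteristic function of the standard normal law, whose closed
  form is known; the factor \<open>s\<close> enters by rescaling the line.\<close>

lemma gaussian_fourier_real:
  assumes s: "s > 0"
  shows "integrable lborel (\<lambda>t::real. cis (y * t) * of_real (exp (- (s * t)\<^sup>2 / 2)))"
    and "(LINT t|lborel. cis (y * t) * of_real (exp (- (s * t)\<^sup>2 / 2)))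
       = of_real (sqrt (2 * pi) / s * exp (- (y / s)\<^sup>2 / 2))"
proof -
  let ?g = "\<lambda>t::real. cis (y / s * t) * of_real (exp (- t\<^sup>2 / 2))"
  have int: "integrable lborel (\<lambda>t. of_real (std_normal_density t) :: complex)"
    using integrable_std_normal_moment[of 0] by (simp add: integrable_of_real)
  have dens: "?g t = of_real (sqrt (2 * pi)) * (iexp (y / s * t) * of_real (std_normal_density t))" for t
    by (simp add: std_normal_density_def cis_conv_exp)
  have i: "integrable lborel ?g"
    unfolding dens
    by (intro integrable_mult_right Bochner_Integration.integrable_bound[OF int]) (auto simp: norm_mult)
  have "(LINT t|lborel. ?g t) = of_real (sqrt (2 * pi)) * char std_normal_distribution (y / s)"
    unfolding dens char_def by (subst integral_density) (auto simp: scaleR_conv_of_real mult.commute)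
  then have v: "(LINT t|lborel. ?g t) = of_real (sqrt (2 * pi) * exp (- (y / s)\<^sup>2 / 2))"
    by (simp add: char_std_normal_distribution)
  have g: "?g (0 + s * t) = cis (y * t) * of_real (exp (- (s * t)\<^sup>2 / 2))" for t
    using s by simp
  show "integrable lborel (\<lambda>t::real. cis (y * t) * of_real (exp (- (s * t)\<^sup>2 / 2)))"
    using lborel_integrable_real_affine[OF i, of s 0] s unfolding g by simp
  have "(LINT t|lborel. ?g t) = \<bar>s\<bar> *\<^sub>R (LINT t|lborel. ?g (0 + s * t))"
    by (rule lborel_integral_real_affine) (use s in auto)
  then show "(LINT t|lborel. cis (y * t) * of_real (exp (- (s * t)\<^sup>2 / 2)))
       = of_real (sqrt (2 * pi) / s * exp (- (y / s)\<^sup>2 / 2))"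
    unfolding g v using s by (simp add: scaleR_conv_of_real field_simps)
qed

lemma
  fixes y :: "'a::euclidean_space"
  assumes s: "s > 0"
  shows integrable_gaussian: "integrable lborel (\<lambda>x. cis (y \<bullet> x) * of_real (exp (- (norm (s *\<^sub>R x))\<^sup>2 / 2)))"
    and integral_gaussian: "(LINT x|lborel. cis (y \<bullet> x) * of_real (exp (- (norm (s *\<^sub>R x))\<^sup>2 / 2)))
       = of_real ((sqrt (2 * pi) / s) ^ DIM('a) * exp (- (norm (y /\<^sub>R s))\<^sup>2 / 2))"
proof -
  let ?f = "\<lambda>b t. cis (y \<bullet> b * t) * of_real (exp (- (s * t)\<^sup>2 / 2))"
  have nrm: "(norm x)\<^sup>2 = (\<Sum>b\<in>Basis. (x \<bullet> b)\<^sup>2)" for x :: 'a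
    unfolding power2_norm_eq_inner by (subst euclidean_inner) (simp add: power2_eq_square)
  have e: "cis (y \<bullet> x) * of_real (exp (- (norm (s *\<^sub>R x))\<^sup>2 / 2)) = (\<Prod>b\<in>Basis. ?f b (x \<bullet> b))" for x :: 'a
  proof -
    have "cis (y \<bullet> x) = (\<Prod>b\<in>Basis. cis (y \<bullet> b * (x \<bullet> b)))"
      by (subst euclidean_inner) (simp add: cis_conv_exp exp_sum sum_distrib_left)
    moreover have "complex_of_real (exp (- (norm (s *\<^sub>R x))\<^sup>2 / 2)) = (\<Prod>b\<in>Basis. of_real (exp (- (s * (x \<bullet> b))\<^sup>2 / 2)))"
      unfolding nrm by (simp add: exp_sum[symmetric] sum_negf sum_divide_distrib flip: of_real_prod)
    ultimately show ?thesis by (simp add: prod.distrib)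
  qed
  show "integrable lborel (\<lambda>x. cis (y \<bullet> x) * of_real (exp (- (norm (s *\<^sub>R x))\<^sup>2 / 2)))"
    unfolding e by (rule integrable_lborel_prod_Basis) (rule gaussian_fourier_real(1)[OF s])
  have "(LINT x|lborel. cis (y \<bullet> x) * of_real (exp (- (norm (s *\<^sub>R x))\<^sup>2 / 2)))
    = (\<Prod>b\<in>Basis. of_real (sqrt (2 * pi) / s * exp (- ((y \<bullet> b) / s)\<^sup>2 / 2)))"
    unfolding e by (subst integral_lborel_prod_Basis, rule gaussian_fourier_real(1)[OF s])
      (intro prod.cong refl gaussian_fourier_real(2)[OF s])
  also have "\<dots> = of_real ((sqrt (2 * pi) / s) ^ DIM('a) * exp (- (norm (y /\<^sub>R s))\<^sup>2 / 2))"
  proof -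
    have "(\<Prod>b\<in>Basis. exp (- ((y \<bullet> b) / s)\<^sup>2 / 2)) = exp (\<Sum>b\<in>Basis. - ((y \<bullet> b) / s)\<^sup>2 / 2)"
      by (rule exp_sum[symmetric]) simp
    also have "(\<Sum>b\<in>Basis. - ((y \<bullet> b) / s)\<^sup>2 / 2) = - (norm (y /\<^sub>R s))\<^sup>2 / 2"
    proof -
      have "(y /\<^sub>R s) \<bullet> b = (y \<bullet> b) / s" for b by (simp add: divide_inverse mult.commute)
      then show ?thesis unfolding nrm by (simp only: sum_negf flip: sum_divide_distrib)
    qed
    finally show ?thesis
      by (simp only: of_real_prod[symmetric] prod.distrib prod_constant)
  qed
  finally show "(LINT x|lborel. cis (y \<bullet> x) * of_real (exp (- (norm (s *\<^sub>R x))\<^sup>2 / 2)))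
       = of_real ((sqrt (2 * pi) / s) ^ DIM('a) * exp (- (norm (y /\<^sub>R s))\<^sup>2 / 2))" .
qed

lemma borel_measurable_cis [measurable (raw)]:
  assumes [measurable]: "f \<in> borel_measurable M"
  shows "(\<lambda>x. cis (f x)) \<in> borel_measurable M"
  unfolding cis_conv_exp by measurable

lemma borel_measurable_fourier [measurable]:
  assumes [measurable]: "g \<in> borel_measurable borel"
  shows "fourier g \<in> borel_measurable borel"
  unfolding fourier_def by measurable

lemma norm_fourier_le: "norm (fourier g \<xi>) \<le> (LINT x|lborel. norm (g x))"
  unfolding fourier_def by (rule order_trans[OF integral_norm_bound]) (simp add: norm_mult)

lemma integrable_cis_mult:
  fixes g :: "'a::euclidean_space \<Rightarrow> complex"
  assumes "integrable lborel g" and [measurable]: "f \<in> borel_measurable borel"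
  shows "integrable lborel (\<lambda>x. cis (f x) * g x)"
proof (rule Bochner_Integration.integrable_bound[OF assms(1)])
  have [measurable]: "g \<in> borel_measurable borel" using assms(1) by auto
  show "(\<lambda>x. cis (f x) * g x) \<in> borel_measurable lborel" by measurable
qed (simp add: norm_mult)

text \<open>Off the boundary the indicator is locally constant, so for each \<open>w\<close> the
  shifted indicator eventually equals its value at x. The Gaussian is the majorant.\<close>

lemma mollified_box_tendsto:
  fixes a b x :: "'a::euclidean_space"
  assumes x: "x \<notin> cbox a b - box a b"
  shows "(\<lambda>n. LINT w|lborel. indicator (box a b) (x + (1 / real (Suc n)) *\<^sub>R w) * exp (- (norm w)\<^sup>2 / 2))
    \<longlonglongrightarrow> indicator (box a b) x * sqrt (2 * pi) ^ DIM('a)"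
proof -
  have "integrable lborel (\<lambda>x::'a. of_real (exp (- (norm x)\<^sup>2 / 2)) :: complex)"
    using integrable_gaussian[of 1 "0::'a"] by simp
  from integrable_Re[OF this] have i: "integrable lborel (\<lambda>x::'a. exp (- (norm x)\<^sup>2 / 2))" by simp
  have "(LINT x|lborel. complex_of_real (exp (- (norm (x::'a))\<^sup>2 / 2))) = of_real (sqrt (2 * pi) ^ DIM('a))"
    using integral_gaussian[of 1 "0::'a"] by simp
  then have v: "(LINT x|lborel. exp (- (norm (x::'a))\<^sup>2 / 2)) = sqrt (2 * pi) ^ DIM('a)"
    unfolding integral_complex_of_real of_real_eq_iff .
  have "(\<lambda>n. LINT w|lborel. indicator (box a b) (x + (1 / real (Suc n)) *\<^sub>R w) * exp (- (norm w)\<^sup>2 / 2))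
    \<longlonglongrightarrow> (LINT w|lborel. indicator (box a b) x * exp (- (norm (w::'a))\<^sup>2 / 2))"
  proof (rule integral_dominated_convergence[where w="\<lambda>w. exp (- (norm w)\<^sup>2 / 2)"])
    show "AE w in lborel. (\<lambda>n. indicator (box a b) (x + (1 / real (Suc n)) *\<^sub>R w) * exp (- (norm w)\<^sup>2 / 2))
       \<longlonglongrightarrow> indicator (box a b) x * exp (- (norm (w::'a))\<^sup>2 / 2)"
    proof (rule AE_I2)
      fix w :: 'a
      have lim: "(\<lambda>n. x + (1 / real (Suc n)) *\<^sub>R w) \<longlonglongrightarrow> x"
      proof -
        have "(\<lambda>n. x + (1 / real (Suc n)) *\<^sub>R w) \<longlonglongrightarrow> x + 0 *\<^sub>R w"
          by (intro tendsto_intros LIMSEQ_Suc lim_1_over_n)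
        then show ?thesis by simp
      qed
      have "\<forall>\<^sub>F n in sequentially. indicator (box a b) (x + (1 / real (Suc n)) *\<^sub>R w) = (indicator (box a b) x :: real)"
      proof (cases "x \<in> box a b")
        case True
        have "\<forall>\<^sub>F n in sequentially. x + (1 / real (Suc n)) *\<^sub>R w \<in> box a b"
          using topological_tendstoD[OF lim open_box True] .
        then show ?thesis by eventually_elim (use True in simp)
      next
        case False
        then have "x \<in> - cbox a b" using x by auto
        have "\<forall>\<^sub>F n in sequentially. x + (1 / real (Suc n)) *\<^sub>R w \<in> - cbox a b"
          by (rule topological_tendstoD[OF lim _ \<open>x \<in> - cbox a b\<close>]) (simp add: closed_cbox open_Compl)
        then show ?thesis by eventually_elim (use False box_subset_cbox in \<open>auto simp: indicator_def\<close>)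
      qed
      then show "(\<lambda>n. indicator (box a b) (x + (1 / real (Suc n)) *\<^sub>R w) * exp (- (norm w)\<^sup>2 / 2))
       \<longlonglongrightarrow> indicator (box a b) x * exp (- (norm (w::'a))\<^sup>2 / 2)"
        by (intro tendsto_eventually) (auto elim: eventually_mono)
    qed
  qed (use i in \<open>auto split: split_indicator\<close>)
  then show ?thesis by (simp only: integral_mult_right_zero v)
qed

text \<open>The identity is tested on boxes B. The integral \<open>I n\<close> contains a widening
  Gaussian \<open>G n\<close>, the transform \<open>E\<close> of the indicator of B and the
  transform of g, and it is evaluated twice. Letting \<open>G n\<close> tend to 1 gives the integral
  over B of the inversion integral of g; unfolding the transform of g first gives g against a
  Gaussian mollification of the indicator. Thus the mollifier acts on an indicator, whose
  convergence is elementary, and not on g.\<close>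

lemma fourier_inversion:
  fixes g :: "'a::euclidean_space \<Rightarrow> complex"
  assumes g: "integrable lborel g" and gh: "integrable lborel (fourier g)"
  shows "AE x in lborel. g x = inv_fourier (fourier g) x"
proof -
  have [measurable]: "g \<in> borel_measurable borel" using g by auto
  define u where "u y = (LINT p|lborel. cis (y \<bullet> p) * fourier g p)" for y
  have [measurable]: "u \<in> borel_measurable borel" unfolding u_def by measurable
  have u_bd: "norm (u y) \<le> (LINT p|lborel. norm (fourier g p))" for y
    unfolding u_def by (rule order_trans[OF integral_norm_bound]) (simp add: norm_mult)
  \<comment> \<open>One factor \<open>?c\<close> comes from the transform of the Gaussian, the other
    is the mass of exp (- |w|^2 / 2); together they form the (2 pi)^d of the inversion
    formula.\<close>
  let ?c = "sqrt (2 * pi) ^ DIM('a)"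
  have cc: "(2 * pi) ^ DIM('a) = ?c * ?c"
    unfolding power_mult_distrib[symmetric] by simp
  have main: "set_lebesgue_integral lborel (box a b) u = of_real ((2 * pi) ^ DIM('a)) * set_lebesgue_integral lborel (box a b) g" for a b
  proof -
    let ?B = "box a b"
    let ?one = "\<lambda>y::'a. indicator ?B y :: complex"
    have one: "integrable lborel ?one"
    proof -
      have "integrable lborel (\<lambda>y. complex_of_real (indicator ?B y))"
        by (intro integrable_of_real integrable_real_indicator) (use emeasure_lborel_box_finite[of a b] in auto)
      moreover have "(\<lambda>y. complex_of_real (indicator ?B y)) = ?one"
        by (auto split: split_indicator)
      ultimately show ?thesis by simp
    qed
    define E where "E p = (LINT y|lborel. ?one y * cis (y \<bullet> p))" for p
    have [measurable]: "E \<in> borel_measurable borel" unfolding E_def by measurable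
    have E_bd: "norm (E p) \<le> measure lborel ?B" for p
    proof -
      have "norm (E p) \<le> (LINT y|lborel. norm (?one y * cis (y \<bullet> p)))"
        unfolding E_def by (rule integral_norm_bound)
      also have "\<dots> = (LINT y|lborel. indicator ?B y)"
        by (intro Bochner_Integration.integral_cong refl) (auto simp: norm_mult split: split_indicator)
      finally show ?thesis by simp
    qed
    let ?\<epsilon> = "\<lambda>n. 1 / real (Suc n)"
    define G where "G n p = exp (- (norm (?\<epsilon> n *\<^sub>R p))\<^sup>2 / 2)" for n and p :: 'a
    have [measurable]: "G n \<in> borel_measurable borel" for n unfolding G_def by measurable
    have G01: "0 \<le> G n p" "G n p \<le> 1" for n p by (auto simp: G_def)
    have Gint: "integrable lborel (\<lambda>p. complex_of_real (G n p))" for n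
      using integrable_gaussian[of "?\<epsilon> n" "0::'a"] by (simp add: G_def)
    define I where "I n = (LINT p|lborel. of_real (G n p) * E p * fourier g p)" for n
    have "I \<longlonglongrightarrow> (LINT p|lborel. E p * fourier g p)"
      unfolding I_def
    proof (rule integral_dominated_convergence[where w="\<lambda>p. measure lborel ?B * norm (fourier g p)"])
      show "AE p in lborel. (\<lambda>n. of_real (G n p) * E p * fourier g p) \<longlonglongrightarrow> E p * fourier g p"
      proof (rule AE_I2)
        fix p
        have "(\<lambda>n. G n p) \<longlonglongrightarrow> exp (- (norm (0 *\<^sub>R p))\<^sup>2 / 2)"
          unfolding G_def by (intro tendsto_intros LIMSEQ_Suc lim_1_over_n) auto
        then have "(\<lambda>n. complex_of_real (G n p)) \<longlonglongrightarrow> of_real 1"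
          by (intro tendsto_of_real) simp
        then have "(\<lambda>n. of_real (G n p) * E p * fourier g p) \<longlonglongrightarrow> of_real 1 * E p * fourier g p"
          by (intro tendsto_mult tendsto_const)
        then show "(\<lambda>n. of_real (G n p) * E p * fourier g p) \<longlonglongrightarrow> E p * fourier g p" by simp
      qed
      show "AE p in lborel. norm (of_real (G n p) * E p * fourier g p) \<le> measure lborel ?B * norm (fourier g p)" for n
      proof (rule AE_I2)
        fix p
        have "G n p * norm (E p) \<le> 1 * measure lborel ?B"
          using G01[of n p] E_bd[of p] by (intro mult_mono) auto
        then show "norm (of_real (G n p) * E p * fourier g p) \<le> measure lborel ?B * norm (fourier g p)"
          using G01[of n p] by (simp add: norm_mult mult_right_mono)
      qed
    qed (use gh in auto)
    also have "(LINT p|lborel. E p * fourier g p) = (LINT p|lborel. (LINT y|lborel. cis (y \<bullet> p) * (fourier g p * ?one y)))"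
      unfolding E_def by (subst integral_mult_left_zero[symmetric]) (simp add: mult_ac)
    also have "\<dots> = (LINT y|lborel. (LINT p|lborel. cis (y \<bullet> p) * (fourier g p * ?one y)))"
      by (rule integral_swap, rule integrable_pair_kernel[OF gh one, where B=1]) auto
    also have "\<dots> = (LINT y|lborel. ?one y * u y)"
      unfolding u_def by (subst integral_mult_right_zero[symmetric]) (simp add: mult_ac)
    finally have lim1: "I \<longlonglongrightarrow> (LINT y|lborel. ?one y * u y)" .

    \<comment> \<open>The mollified indicator up to a constant, in the rescaled variable w = (y - x)
      / \<epsilon>, so that the Gaussian no longer depends on n.\<close>
    define h where "h n x = (LINT w|lborel. indicator ?B (x + ?\<epsilon> n *\<^sub>R w) * exp (- (norm w)\<^sup>2 / 2))" for n x
    have Ih: "I n = (LINT x|lborel. of_real (?c * h n x) * g x)" for n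
    proof -
      define \<epsilon> where "\<epsilon> = ?\<epsilon> n"
      have \<epsilon>: "\<epsilon> > 0" by (simp add: \<epsilon>_def)
      have GE: "integrable lborel (\<lambda>p. of_real (G n p) * E p)"
        by (rule Bochner_Integration.integrable_bound[where f="\<lambda>p. of_real (measure lborel ?B) * complex_of_real (G n p)"])
           (auto intro!: integrable_mult_right Gint AE_I2 mult_left_mono E_bd simp: norm_mult mult.commute[of "measure lborel ?B"])
      have "I n = (LINT p|lborel. (LINT x|lborel. cis (- (p \<bullet> x)) * (of_real (G n p) * E p * g x)))"
        unfolding I_def fourier_def by (subst integral_mult_right_zero[symmetric]) (simp add: mult_ac)
      also have "\<dots> = (LINT x|lborel. (LINT p|lborel. cis (- (p \<bullet> x)) * (of_real (G n p) * E p * g x)))"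
        by (rule integral_swap, rule integrable_pair_kernel[OF GE g, where B=1]) auto
      also have "\<dots> = (LINT x|lborel. of_real (?c * h n x) * g x)"
      proof (rule Bochner_Integration.integral_cong[OF refl])
        fix x
        have "(LINT p|lborel. cis (- (p \<bullet> x)) * (of_real (G n p) * E p * g x))
           = (LINT p|lborel. (LINT y|lborel. cis (- (p \<bullet> x) + y \<bullet> p) * (of_real (G n p) * ?one y))) * g x"
        proof (subst integral_mult_left_zero[symmetric], rule Bochner_Integration.integral_cong[OF refl])
          fix p
          have "cis (- (p \<bullet> x)) * (of_real (G n p) * E p * g x)
            = (LINT y|lborel. (cis (- (p \<bullet> x)) * of_real (G n p) * g x) * (?one y * cis (y \<bullet> p)))"
            unfolding integral_mult_right_zero E_def by (simp only: mult_ac)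
          also have "\<dots> = (LINT y|lborel. cis (- (p \<bullet> x) + y \<bullet> p) * (of_real (G n p) * ?one y) * g x)"
            by (intro Bochner_Integration.integral_cong refl) (simp only: cis_mult[symmetric] mult_ac)
          finally show "cis (- (p \<bullet> x)) * (of_real (G n p) * E p * g x)
            = (LINT y|lborel. cis (- (p \<bullet> x) + y \<bullet> p) * (of_real (G n p) * ?one y)) * g x"
            by simp
        qed
        also have "(LINT p|lborel. (LINT y|lborel. cis (- (p \<bullet> x) + y \<bullet> p) * (of_real (G n p) * ?one y)))
          = (LINT y|lborel. (LINT p|lborel. cis (- (p \<bullet> x) + y \<bullet> p) * (of_real (G n p) * ?one y)))"
          by (rule integral_swap, rule integrable_pair_kernel[OF Gint one, where B=1]) auto
        also have "\<dots> = (LINT y|lborel. ?one y * of_real ((sqrt (2 * pi) / \<epsilon>) ^ DIM('a) * exp (- (norm ((y - x) /\<^sub>R \<epsilon>))\<^sup>2 / 2)))"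
        proof (rule Bochner_Integration.integral_cong[OF refl])
          fix y
          have "(LINT p|lborel. cis (- (p \<bullet> x) + y \<bullet> p) * (of_real (G n p) * ?one y))
            = (LINT p|lborel. cis ((y - x) \<bullet> p) * of_real (exp (- (norm (\<epsilon> *\<^sub>R p))\<^sup>2 / 2))) * ?one y"
          proof -
            have "cis (- (p \<bullet> x) + y \<bullet> p) * (of_real (G n p) * ?one y)
              = cis ((y - x) \<bullet> p) * of_real (exp (- (norm (\<epsilon> *\<^sub>R p))\<^sup>2 / 2)) * ?one y" for p
              by (simp add: G_def \<epsilon>_def inner_diff_left inner_commute[of p x])
            then show ?thesis by (simp only: integral_mult_left_zero)
          qed
          then show "(LINT p|lborel. cis (- (p \<bullet> x) + y \<bullet> p) * (of_real (G n p) * ?one y))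
             = ?one y * of_real ((sqrt (2 * pi) / \<epsilon>) ^ DIM('a) * exp (- (norm ((y - x) /\<^sub>R \<epsilon>))\<^sup>2 / 2))"
            unfolding integral_gaussian[OF \<epsilon>] by (simp add: mult.commute)
        qed
        also have "\<dots> = of_real (LINT y|lborel. indicator ?B y * ((sqrt (2 * pi) / \<epsilon>) ^ DIM('a) * exp (- (norm ((y - x) /\<^sub>R \<epsilon>))\<^sup>2 / 2)))"
          unfolding integral_complex_of_real[symmetric]
          by (intro Bochner_Integration.integral_cong refl) (auto split: split_indicator)
        also have "(LINT y|lborel. indicator ?B y * ((sqrt (2 * pi) / \<epsilon>) ^ DIM('a) * exp (- (norm ((y - x) /\<^sub>R \<epsilon>))\<^sup>2 / 2)))
          = ?c * h n x"
        proof -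
          have L: "lborel = density (distr lborel borel (\<lambda>w::'a. x + \<epsilon> *\<^sub>R w)) (\<lambda>_. ennreal (\<bar>\<epsilon>\<bar> ^ DIM('a)))"
            using lborel_affine[of \<epsilon> x] \<epsilon> by simp
          have "(LINT y|lborel. indicator ?B y * ((sqrt (2 * pi) / \<epsilon>) ^ DIM('a) * exp (- (norm ((y - x) /\<^sub>R \<epsilon>))\<^sup>2 / 2)))
            = (LINT w|lborel. \<epsilon> ^ DIM('a) * (indicator ?B (x + \<epsilon> *\<^sub>R w) * ((sqrt (2 * pi) / \<epsilon>) ^ DIM('a) * exp (- (norm w)\<^sup>2 / 2))))"
          proof -
            have "(x + \<epsilon> *\<^sub>R w - x) /\<^sub>R \<epsilon> = w" for w using \<epsilon> by simp
            then show ?thesis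
              by (subst L, subst integral_density) (use \<epsilon> in \<open>auto simp: integral_distr simp del: norm_scaleR\<close>)
          qed
          also have "\<dots> = (LINT w|lborel. ?c * (indicator ?B (x + \<epsilon> *\<^sub>R w) * exp (- (norm w)\<^sup>2 / 2)))"
            using \<epsilon> by (intro Bochner_Integration.integral_cong refl) (simp add: power_divide field_simps)
          finally show ?thesis by (simp add: h_def \<epsilon>_def)
        qed
        finally show "(LINT p|lborel. cis (- (p \<bullet> x)) * (of_real (G n p) * E p * g x)) = of_real (?c * h n x) * g x" .
      qed
      finally show ?thesis .
    qed
    have h_bd: "\<bar>h n x\<bar> \<le> ?c" for n x
    proof -
      have i: "integrable lborel (\<lambda>x::'a. exp (- (norm x)\<^sup>2 / 2))"
        using integrable_Re[OF integrable_gaussian[of 1 "0::'a"]] by simp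
      have "(LINT x|lborel. complex_of_real (exp (- (norm (x::'a))\<^sup>2 / 2))) = of_real ?c"
        using integral_gaussian[of 1 "0::'a"] by simp
      then have v: "(LINT x|lborel. exp (- (norm (x::'a))\<^sup>2 / 2)) = ?c"
        unfolding integral_complex_of_real of_real_eq_iff .
      have "\<bar>h n x\<bar> \<le> (LINT w|lborel. \<bar>indicator ?B (x + ?\<epsilon> n *\<^sub>R w) * exp (- (norm w)\<^sup>2 / 2)\<bar>)"
        unfolding h_def using integral_norm_bound[of lborel "\<lambda>w. indicator ?B (x + ?\<epsilon> n *\<^sub>R w) * exp (- (norm w)\<^sup>2 / 2)"] by simp
      also have "\<dots> \<le> (LINT w|lborel. exp (- (norm (w::'a))\<^sup>2 / 2))"
        by (rule integral_mono') (use i in \<open>auto split: split_indicator\<close>)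
      finally show ?thesis unfolding v .
    qed
    have [measurable]: "h n \<in> borel_measurable borel" for n unfolding h_def by measurable
    have "I \<longlonglongrightarrow> (LINT x|lborel. of_real (?c * (indicator ?B x * ?c)) * g x)"
      unfolding Ih
    proof (rule integral_dominated_convergence[where w="\<lambda>x. ?c * ?c * norm (g x)"])
      have "AE x in lborel. x \<notin> cbox a b - box a b"
        using null_sets_cbox_Diff_box by (rule AE_not_in)
      then show "AE x in lborel. (\<lambda>n. of_real (?c * h n x) * g x) \<longlonglongrightarrow> of_real (?c * (indicator ?B x * ?c)) * g x"
      proof eventually_elim
        case (elim x)
        then show ?case unfolding h_def
          by (intro tendsto_mult tendsto_of_real tendsto_const mollified_box_tendsto)
      qed
      show "AE x in lborel. norm (of_real (?c * h n x) * g x) \<le> ?c * ?c * norm (g x)" for n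
      proof (rule AE_I2)
        fix x
        have "\<bar>?c * h n x\<bar> \<le> ?c * ?c"
          using mult_left_mono[OF h_bd[of n x], of ?c] by (simp add: abs_mult)
        then show "norm (of_real (?c * h n x) * g x) \<le> ?c * ?c * norm (g x)"
          unfolding norm_mult norm_of_real by (rule mult_right_mono) simp
      qed
    qed (use g in auto)
    then have "(LINT y|lborel. ?one y * u y) = (LINT x|lborel. of_real (?c * (indicator ?B x * ?c)) * g x)"
      by (rule LIMSEQ_unique[OF lim1])
    also have "\<dots> = (LINT x|lborel. of_real (?c * ?c) * (indicator ?B x *\<^sub>R g x))"
      by (intro Bochner_Integration.integral_cong refl) (auto split: split_indicator)
    also have "(LINT y|lborel. ?one y * u y) = (LINT y|lborel. indicator ?B y *\<^sub>R u y)"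
      by (intro Bochner_Integration.integral_cong refl) (auto split: split_indicator)
    finally show ?thesis
      unfolding cc set_lebesgue_integral_def integral_mult_right_zero .
  qed
  have "AE x in lborel. u x - of_real ((2 * pi) ^ DIM('a)) * g x = 0"
  proof (rule AE_zero_if_box_integrals_zero)
    fix a b :: 'a
    have iu: "set_integrable lborel (box a b) u"
      unfolding set_integrable_def
    proof (rule integrableI_bounded_set_indicator[where B="LINT p|lborel. norm (fourier g p)"])
      show "AE x in lborel. x \<in> box a b \<longrightarrow> norm (u x) \<le> (LINT p|lborel. norm (fourier g p))"
        using u_bd by auto
    qed (use emeasure_lborel_box_finite[of a b] in auto)
    have ig: "set_integrable lborel (box a b) (\<lambda>x. of_real ((2 * pi) ^ DIM('a)) * g x)"
      unfolding set_integrable_def using g by (intro integrable_mult_indicator integrable_mult_right) auto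
    show "set_integrable lborel (box a b) (\<lambda>x. u x - of_real ((2 * pi) ^ DIM('a)) * g x)"
      using iu ig by (rule set_integral_diff)
    show "set_lebesgue_integral lborel (box a b) (\<lambda>x. u x - of_real ((2 * pi) ^ DIM('a)) * g x) = 0"
      using set_integral_diff(2)[OF iu ig] main[of a b] by simp
  qed
  then show ?thesis
  proof eventually_elim
    case (elim x)
    then have "u x = of_real ((2 * pi) ^ DIM('a)) * g x" by simp
    moreover have "inv_fourier (fourier g) x = of_real (1 / (2 * pi) ^ DIM('a)) * u x"
      by (simp add: inv_fourier_def u_def inner_commute)
    ultimately show ?case by (simp add: field_simps)
  qed
qed

lemma fourier_zero_imp_AE_zero:
  fixes g :: "'a::euclidean_space \<Rightarrow> complex"
  assumes "integrable lborel g" and "\<And>\<xi>. fourier g \<xi> = 0"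
  shows "AE x in lborel. g x = 0"
proof -
  have z: "fourier g = (\<lambda>_. 0)" using assms(2) by auto
  have "AE x in lborel. g x = inv_fourier (fourier g) x"
    by (rule fourier_inversion[OF assms(1)]) (simp add: z)
  then show ?thesis by (simp add: z inv_fourier_def)
qed

section \<open>Integrable power weights\<close>

lemma integrable_one_plus_abs_powr:
  fixes r :: real
  assumes r: "r > 1"
  shows "integrable lborel (\<lambda>t::real. (1 + \<bar>t\<bar>) powr (- r))"
proof (rule integrableI_bounded)
  let ?f = "\<lambda>t::real. (1 + \<bar>t\<bar>) powr (- r)"
  have half: "(\<integral>\<^sup>+ t. ennreal (?f t) * indicator {0..} t \<partial>lborel) = ennreal (0 - (- ((1 + 0) powr (1 - r) / (r - 1))))"
  proof (rule nn_integral_FTC_atLeast)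
    show "((\<lambda>t. - ((1 + t) powr (1 - r) / (r - 1))) has_real_derivative ?f x) (at x)" if "0 \<le> x" for x
    proof -
      have "((\<lambda>t. (1 + t) powr (1 - r)) has_real_derivative (1 - r) * (1 + x) powr (1 - r - of_nat 1) * 1) (at x)"
        by (rule DERIV_fun_powr) (use that in \<open>auto intro!: derivative_eq_intros\<close>)
      from DERIV_minus[OF DERIV_cdivide[OF this, of "r - 1"]]
      show ?thesis by (rule DERIV_cong) (use that r in \<open>simp add: field_simps\<close>)
    qed
    have "((\<lambda>t::real. (1 + t) powr (1 - r)) \<longlongrightarrow> 0) at_top"
      by (rule tendsto_neg_powr) (use r in \<open>auto intro: filterlim_tendsto_add_at_top tendsto_const filterlim_ident\<close>)
    then have "((\<lambda>t. - ((1 + t) powr (1 - r) / (r - 1))) \<longlongrightarrow> - (0 / (r - 1))) at_top"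
      using r by (intro tendsto_intros) auto
    then show "((\<lambda>t. - ((1 + t) powr (1 - r) / (r - 1))) \<longlongrightarrow> 0) at_top" by simp
  qed auto
  have "(\<integral>\<^sup>+ t. ennreal (norm (?f t)) \<partial>lborel)
    \<le> (\<integral>\<^sup>+ t. ennreal (?f t) * indicator {0..} t + ennreal (?f (0 + (-1) * t)) * indicator {0..} (0 + (-1) * t) \<partial>lborel)"
    by (intro nn_integral_mono) (auto split: split_indicator)
  also have "\<dots> = (\<integral>\<^sup>+ t. ennreal (?f t) * indicator {0..} t \<partial>lborel) + (\<integral>\<^sup>+ t. ennreal (?f (0 + (-1) * t)) * indicator {0..} (0 + (-1) * t) \<partial>lborel)"
    by (intro nn_integral_add) auto
  also have "(\<integral>\<^sup>+ t. ennreal (?f (0 + (-1) * t)) * indicator {0..} (0 + (-1) * t) \<partial>lborel) = (\<integral>\<^sup>+ t. ennreal (?f t) * indicator {0..} t \<partial>lborel)"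
    using nn_integral_real_affine[of "\<lambda>t. ennreal (?f t) * indicator {0..} t" "-1" 0] by simp
  also have "\<dots> + \<dots> < \<infinity>" unfolding half by simp
  finally show "(\<integral>\<^sup>+ t. ennreal (norm (?f t)) \<partial>lborel) < \<infinity>" .
qed simp

text \<open>The exponent is shared equally among the d coordinates. Each 1 + |x_b| is at most 1 +
  |x|, so the product of one-dimensional weights with exponent s / d > 1 is an integrable
  majorant.\<close>

lemma integrable_one_plus_norm_powr:
  fixes s :: real
  assumes s: "s > DIM('a::euclidean_space)"
  shows "integrable lborel (\<lambda>x::'a. (1 + norm x) powr (- s))"
proof -
  let ?r = "s / DIM('a)"
  have r: "?r > 1" using s by (simp add: field_simps)
  have i: "integrable lborel (\<lambda>x::'a. \<Prod>b\<in>Basis. (1 + \<bar>x \<bullet> b\<bar>) powr (- ?r))"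
  proof -
    have "integrable lborel (\<lambda>x::'a. \<Prod>b\<in>Basis. complex_of_real ((1 + \<bar>x \<bullet> b\<bar>) powr (- ?r)))"
      by (rule integrable_lborel_prod_Basis[where f="\<lambda>b t. complex_of_real ((1 + \<bar>t\<bar>) powr (- ?r))"])
         (intro integrable_of_real integrable_one_plus_abs_powr r)
    then have "integrable lborel (\<lambda>x::'a. complex_of_real (\<Prod>b\<in>Basis. (1 + \<bar>x \<bullet> b\<bar>) powr (- ?r)))"
      by (simp only: of_real_prod)
    from integrable_Re[OF this] show ?thesis by (simp only: Re_complex_of_real)
  qed
  show ?thesis
  proof (rule Bochner_Integration.integrable_bound[OF i])
    show "AE x in lborel. norm ((1 + norm x) powr (- s)) \<le> norm (\<Prod>b\<in>Basis. (1 + \<bar>x \<bullet> (b::'a)\<bar>) powr (- ?r))"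
    proof (rule AE_I2)
      fix x :: 'a
      have "(1 + norm x) powr (- s) = (\<Prod>b\<in>(Basis::'a set). (1 + norm x) powr (- ?r))"
      proof -
        have "0 < (1 + norm x) powr (- ?r)" using norm_ge_zero[of x] by (simp del: norm_ge_zero)
        then have "((1 + norm x) powr (- ?r)) ^ DIM('a) = ((1 + norm x) powr (- ?r)) powr DIM('a)"
          by (rule powr_realpow[symmetric])
        also have "\<dots> = (1 + norm x) powr (- s)" by (simp add: powr_powr)
        finally show ?thesis by simp
      qed
      also have "\<dots> \<le> (\<Prod>b\<in>Basis. (1 + \<bar>x \<bullet> b\<bar>) powr (- ?r))"
        using r by (intro prod_mono conjI powr_mono2') (auto simp: Basis_le_norm)
      also have "\<dots> \<le> norm (\<Prod>b\<in>Basis. (1 + \<bar>x \<bullet> b\<bar>) powr (- ?r))" by simp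
      finally show "norm ((1 + norm x) powr (- s)) \<le> norm (\<Prod>b\<in>Basis. (1 + \<bar>x \<bullet> (b::'a)\<bar>) powr (- ?r))" by simp
    qed
  qed simp
qed

section \<open>Schwartz functions\<close>

text \<open>A set of multipliers of Schwartz functions that is closed under directional derivatives.\<close>

inductive_set slow :: "('a::euclidean_space \<Rightarrow> complex) set" where
  const: "(\<lambda>x. c) \<in> slow"
| inner: "(\<lambda>x. of_real (x \<bullet> v)) \<in> slow"
| powr: "(\<lambda>x. of_real ((1 + (norm x)\<^sup>2) powr s)) \<in> slow"
| add: "g \<in> slow \<Longrightarrow> h \<in> slow \<Longrightarrow> (\<lambda>x. g x + h x) \<in> slow"
| mult: "g \<in> slow \<Longrightarrow> h \<in> slow \<Longrightarrow> (\<lambda>x. g x * h x) \<in> slow"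

text \<open>The derivative is asserted inside the class, so iteration never leaves it. The power
  weight differentiates to 2 s (1 + |x|^2)^(s - 1) times an inner product, which explains the
  generators \<open>inner\<close> and \<open>powr\<close> with arbitrary real exponents.\<close>

lemma slow_has_derivative:
  assumes "g \<in> slow"
  shows "\<exists>D. (\<forall>x. (g has_derivative (\<lambda>v. D v x)) (at x)) \<and> (\<forall>v. D v \<in> slow)"
  using assms
proof induction
  case (const c)
  show ?case by (rule exI[of _ "\<lambda>v x. 0"]) (auto intro: slow.const)
next
  case (inner w)
  have "((\<lambda>x. complex_of_real (x \<bullet> w)) has_derivative (\<lambda>v. of_real (v \<bullet> w))) (at x)" for x
    by (auto intro!: derivative_eq_intros)
  then show ?case by (intro exI[of _ "\<lambda>v x. of_real (v \<bullet> w)"]) (auto intro: slow.const)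
next
  case (powr s)
  let ?D = "\<lambda>v x::'a. of_real (2 * s) * of_real ((1 + (norm x)\<^sup>2) powr (s - 1)) * of_real (x \<bullet> v) :: complex"
  have "((\<lambda>x. complex_of_real ((1 + (norm x)\<^sup>2) powr s)) has_derivative (\<lambda>v. ?D v x)) (at x)" for x :: 'a
  proof -
    have pos: "1 + x \<bullet> x > 0" by (simp add: add_pos_nonneg)
    have "((\<lambda>x. (1 + x \<bullet> x) powr s) has_derivative (\<lambda>v. 2 * s * (1 + x \<bullet> x) powr (s - 1) * (x \<bullet> v))) (at x)"
      using pos by (auto intro!: derivative_eq_intros simp: powr_diff inner_commute fun_eq_iff field_simps)
    then have "((\<lambda>x. complex_of_real ((1 + x \<bullet> x) powr s)) has_derivative (\<lambda>v. of_real (2 * s * (1 + x \<bullet> x) powr (s - 1) * (x \<bullet> v)))) (at x)"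
      by (rule has_derivative_of_real)
    then show ?thesis by (simp add: power2_norm_eq_inner)
  qed
  moreover have "?D v \<in> slow" for v by (intro slow.mult slow.const slow.powr slow.inner)
  ultimately show ?case by (intro exI[of _ ?D]) auto
next
  case (add g h)
  then obtain D E where "\<forall>x. (g has_derivative (\<lambda>v. D v x)) (at x)" "\<forall>v. D v \<in> slow"
    "\<forall>x. (h has_derivative (\<lambda>v. E v x)) (at x)" "\<forall>v. E v \<in> slow" by blast
  then show ?case
    by (intro exI[of _ "\<lambda>v x. D v x + E v x"]) (auto intro: slow.add has_derivative_add)
next
  case (mult g h)
  then obtain D E where "\<forall>x. (g has_derivative (\<lambda>v. D v x)) (at x)" "\<forall>v. D v \<in> slow"
    "\<forall>x. (h has_derivative (\<lambda>v. E v x)) (at x)" "\<forall>v. E v \<in> slow" by blast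
  then show ?case using mult
    by (intro exI[of _ "\<lambda>v x. g x * E v x + D v x * h x"]) (auto intro!: slow.add slow.mult has_derivative_mult)
qed

lemma slow_growth:
  assumes "g \<in> slow"
  shows "\<exists>C N. \<forall>x. norm (g x) \<le> C * (1 + norm x) ^ N"
  using assms
proof induction
  case (const c)
  show ?case by (intro exI[of _ "norm c"] exI[of _ 0]) auto
next
  case (inner v)
  have "norm (complex_of_real (x \<bullet> v)) \<le> norm v * (1 + norm x) ^ 1" for x
    using Cauchy_Schwarz_ineq2[of x v] by (simp add: algebra_simps add_increasing)
  then show ?case by blast
next
  case (powr s)
  obtain N :: nat where N: "s \<le> real N" using real_arch_simple by blast
  have "norm (complex_of_real ((1 + (norm x)\<^sup>2) powr s)) \<le> 1 * (1 + norm x) ^ (2 * N)" for x :: 'a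
  proof -
    have "(1 + (norm x)\<^sup>2) powr s \<le> (1 + (norm x)\<^sup>2) powr real N" by (intro powr_mono N) auto
    also have "\<dots> = (1 + (norm x)\<^sup>2) ^ N" by (intro powr_realpow) (simp add: add_pos_nonneg)
    also have "\<dots> \<le> ((1 + norm x)\<^sup>2) ^ N" by (intro power_mono) (auto simp: power2_sum)
    finally show ?thesis by (simp add: power_mult)
  qed
  then show ?case by blast
next
  case (add g h)
  then obtain C N D M where g: "\<And>x. norm (g x) \<le> C * (1 + norm x) ^ N" and h: "\<And>x. norm (h x) \<le> D * (1 + norm x) ^ M"
    by blast
  have "norm (g x + h x) \<le> (\<bar>C\<bar> + \<bar>D\<bar>) * (1 + norm x) ^ (N + M)" for x
  proof -
    have "norm (g x) \<le> \<bar>C\<bar> * (1 + norm x) ^ (N + M)"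
      by (rule order_trans[OF g]) (intro mult_mono power_increasing, auto)
    moreover have "norm (h x) \<le> \<bar>D\<bar> * (1 + norm x) ^ (N + M)"
      by (rule order_trans[OF h]) (intro mult_mono power_increasing, auto)
    ultimately show ?thesis using norm_triangle_ineq[of "g x" "h x"] by (simp add: distrib_right)
  qed
  then show ?case by blast
next
  case (mult g h)
  then obtain C N D M where g: "\<And>x. norm (g x) \<le> C * (1 + norm x) ^ N" and h: "\<And>x. norm (h x) \<le> D * (1 + norm x) ^ M"
    by blast
  have "norm (g x * h x) \<le> (C * D) * (1 + norm x) ^ (N + M)" for x
  proof -
    have "norm (g x * h x) \<le> (C * (1 + norm x) ^ N) * (D * (1 + norm x) ^ M)"
      unfolding norm_mult by (intro mult_mono g h order_trans[OF norm_ge_zero g]) auto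
    then show ?thesis by (simp add: power_add mult_ac)
  qed
  then show ?case by blast
qed

section \<open>Membership in the Schwartz space\<close>

lemma dir_deriv_eq:
  assumes "\<And>x. (f has_derivative (\<lambda>v. D v x)) (at x)"
  shows "dir_deriv v f = D v"
  unfolding dir_deriv_def fun_eq_iff using frechet_derivative_at[OF assms] by metis

lemma partials_simps [simp]: "partials [] f = f" "partials (b # vs) f = dir_deriv b (partials vs f)"
  by (simp_all add: partials_def)

lemma partials_append: "partials (vs @ us) f = partials vs (partials us f)"
  by (simp add: partials_def)

text \<open>Iterated partials are handled by an invariant family instead of formulas: closure under
  basis derivatives keeps every partial of \<open>f\<close> in \<open>F\<close>, where
  differentiability and decay are known.\<close>

lemma schwartzI:
  assumes F: "f \<in> F"
    and step: "\<And>h b. h \<in> F \<Longrightarrow> b \<in> Basis \<Longrightarrow> dir_deriv b h \<in> F"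
    and diff: "\<And>h x. h \<in> F \<Longrightarrow> h differentiable (at x)"
    and bd: "\<And>h N. h \<in> F \<Longrightarrow> \<exists>B. \<forall>x. (1 + norm x) ^ N * norm (h x) \<le> B"
  shows "f \<in> schwartz"
proof -
  have p: "partials vs f \<in> F" if "set vs \<subseteq> Basis" for vs
    using that by (induction vs) (auto intro: F step)
  show ?thesis
    unfolding schwartz_def
  proof (intro CollectI allI impI conjI)
    fix vs :: "'a list" assume vs: "set vs \<subseteq> Basis"
    show "partials vs f differentiable at x" for x using diff p vs by blast
    fix N :: nat
    obtain B where "\<forall>x. (1 + norm x) ^ N * norm (partials vs f x) \<le> B" using bd p vs by blast
    then show "bounded (range (\<lambda>x. (1 + norm x) ^ N *\<^sub>R partials vs f x))"
      unfolding bounded_iff by (auto intro!: exI[of _ B])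
  qed
qed

lemma schwartz_partials:
  assumes "f \<in> schwartz" "set us \<subseteq> Basis"
  shows "partials us f \<in> schwartz"
  unfolding schwartz_def
proof (intro CollectI allI impI)
  fix vs :: "'a list" assume "set vs \<subseteq> Basis"
  then have "set (vs @ us) \<subseteq> Basis" using assms by auto
  then show "(\<forall>x. partials vs (partials us f) differentiable at x) \<and>
    (\<forall>N. bounded (range (\<lambda>x. (1 + norm x) ^ N *\<^sub>R partials vs (partials us f) x)))"
    using assms(1) unfolding schwartz_def partials_append[symmetric] by blast
qed

lemma schwartz_dir_deriv: "f \<in> schwartz \<Longrightarrow> b \<in> Basis \<Longrightarrow> dir_deriv b f \<in> schwartz"
  using schwartz_partials[of f "[b]"] by simp

lemma schwartz_differentiable: "f \<in> schwartz \<Longrightarrow> f differentiable (at x)"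
  unfolding schwartz_def by (auto dest!: spec[of _ "[]"])

lemma schwartz_has_derivative:
  "f \<in> schwartz \<Longrightarrow> (f has_derivative (\<lambda>v. dir_deriv v f x)) (at x)"
  unfolding dir_deriv_def using schwartz_differentiable[of f x] frechet_derivative_works by blast

lemma schwartz_bound:
  assumes "f \<in> schwartz"
  shows "\<exists>B. \<forall>x. (1 + norm x) ^ N * norm (f x) \<le> B"
proof -
  have "bounded (range (\<lambda>x. (1 + norm x) ^ N *\<^sub>R f x))"
    using assms unfolding schwartz_def by (auto dest!: spec[of _ "[]"])
  then show ?thesis unfolding bounded_iff by (auto simp: abs_mult)
qed

lemma schwartz_continuous: "f \<in> schwartz \<Longrightarrow> continuous_on S f"
  by (meson continuous_at_imp_continuous_on differentiable_imp_continuous_within schwartz_differentiable)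

lemma schwartz_measurable: "f \<in> schwartz \<Longrightarrow> f \<in> borel_measurable borel"
  by (intro borel_measurable_continuous_onI schwartz_continuous)

text \<open>By the product rule the derivatives of a slow multiple of f are sums of slow multiples
  of partials of f. This is the invariant family to which \<open>schwartzI\<close> is
  applied.\<close>

inductive_set slow_span :: "('a::euclidean_space \<Rightarrow> complex) \<Rightarrow> ('a \<Rightarrow> complex) set" for f where
  base: "g \<in> slow \<Longrightarrow> set us \<subseteq> Basis \<Longrightarrow> (\<lambda>x. g x * partials us f x) \<in> slow_span f"
| add: "g \<in> slow_span f \<Longrightarrow> h \<in> slow_span f \<Longrightarrow> (\<lambda>x. g x + h x) \<in> slow_span f"

lemma slow_span_has_derivative:
  assumes "f \<in> schwartz" "h \<in> slow_span f"
  shows "\<exists>D. (\<forall>x. (h has_derivative (\<lambda>v. D v x)) (at x)) \<and> (\<forall>b\<in>Basis. D b \<in> slow_span f)"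
  using assms(2)
proof induction
  case (base g us)
  obtain D where D: "\<And>x. (g has_derivative (\<lambda>v. D v x)) (at x)" "\<And>v. D v \<in> slow"
    using slow_has_derivative[OF base(1)] by blast
  have p: "partials us f \<in> schwartz" using assms(1) base(2) by (rule schwartz_partials)
  let ?E = "\<lambda>v x. g x * dir_deriv v (partials us f) x + D v x * partials us f x"
  have "((\<lambda>x. g x * partials us f x) has_derivative (\<lambda>v. ?E v x)) (at x)" for x
    by (rule has_derivative_mult[OF D(1) schwartz_has_derivative[OF p]])
  moreover have "?E b \<in> slow_span f" if "b \<in> Basis" for b
    using slow_span.base[OF base(1), of "b # us" f] slow_span.base[OF D(2) base(2), of b f] base(2) that
    by (auto intro!: slow_span.add)
  ultimately show ?case by (intro exI[of _ ?E]) auto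
next
  case (add g h)
  then obtain D E where "\<forall>x. (g has_derivative (\<lambda>v. D v x)) (at x)" "\<forall>b\<in>Basis. D b \<in> slow_span f"
    "\<forall>x. (h has_derivative (\<lambda>v. E v x)) (at x)" "\<forall>b\<in>Basis. E b \<in> slow_span f" by blast
  then show ?case
    by (intro exI[of _ "\<lambda>v x. D v x + E v x"]) (auto intro: slow_span.add has_derivative_add)
qed

lemma schwartz_slow_mult:
  assumes f: "f \<in> schwartz" and g: "g \<in> slow"
  shows "(\<lambda>x. g x * f x) \<in> schwartz"
proof (rule schwartzI[where F="slow_span f"])
  show "(\<lambda>x. g x * f x) \<in> slow_span f" using slow_span.base[OF g, of "[]" f] by simp
  show "dir_deriv b h \<in> slow_span f" if "h \<in> slow_span f" "b \<in> Basis" for h b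
    using slow_span_has_derivative[OF f that(1)] dir_deriv_eq that(2) by metis
  show "h differentiable at x" if "h \<in> slow_span f" for h x
    using slow_span_has_derivative[OF f that] unfolding differentiable_def by blast
  show "\<exists>B. \<forall>x. (1 + norm x) ^ N * norm (h x) \<le> B" if "h \<in> slow_span f" for h N
    using that
  proof induction
    case (base g us)
    obtain C M where g: "\<And>x. norm (g x) \<le> C * (1 + norm x) ^ M" using slow_growth[OF base(1)] by blast
    obtain B where B: "\<And>x. (1 + norm x) ^ (N + M) * norm (partials us f x) \<le> B"
      using schwartz_bound[OF schwartz_partials[OF f base(2)]] by blast
    have "(1 + norm x) ^ N * norm (g x * partials us f x) \<le> \<bar>C\<bar> * B" for x
    proof -
      have "(1 + norm x) ^ N * norm (g x * partials us f x) \<le> (1 + norm x) ^ N * ((\<bar>C\<bar> * (1 + norm x) ^ M) * norm (partials us f x))"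
        unfolding norm_mult
        by (intro mult_left_mono mult_right_mono order_trans[OF g]) auto
      also have "\<dots> = \<bar>C\<bar> * ((1 + norm x) ^ (N + M) * norm (partials us f x))"
        by (simp add: power_add mult_ac)
      also have "\<dots> \<le> \<bar>C\<bar> * B" by (intro mult_left_mono B) auto
      finally show ?thesis .
    qed
    then show ?case by blast
  next
    case (add g h)
    then obtain A B where AB: "\<And>x. (1 + norm x) ^ N * norm (g x) \<le> A" "\<And>x. (1 + norm x) ^ N * norm (h x) \<le> B" by blast
    have "(1 + norm x) ^ N * norm (g x + h x) \<le> A + B" for x
    proof -
      have "(1 + norm x) ^ N * norm (g x + h x) \<le> (1 + norm x) ^ N * (norm (g x) + norm (h x))"
        by (intro mult_left_mono norm_triangle_ineq) auto
      then show ?thesis using AB[of x] by (simp add: distrib_left)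
    qed
    then show ?case by blast
  qed
qed

text \<open>Derivatives of the exponential are slow multiples of it, and these multiples form the
  invariant family. The real tilt \<open>a\<close> is included because the Fourier transform of a
  tilted Gaussian is a modulated one, which later supplies test functions.\<close>

lemma gaussian_schwartz:
  fixes a b :: "'a::euclidean_space"
  shows "(\<lambda>x. cis (b \<bullet> x) * of_real (exp (a \<bullet> x - (norm x)\<^sup>2 / 2))) \<in> schwartz"
proof -
  define E where "E x = exp (of_real (a \<bullet> x - (x \<bullet> x) / 2) + \<i> * of_real (b \<bullet> x))" for x
  define F where "F = {\<lambda>x. g x * E x | g. g \<in> slow}"
  have E: "E x = cis (b \<bullet> x) * of_real (exp (a \<bullet> x - (norm x)\<^sup>2 / 2))" for x
    by (simp add: E_def exp_add cis_conv_exp power2_norm_eq_inner mult.commute flip: exp_of_real)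
  have nE: "norm (E x) = exp (a \<bullet> x - (norm x)\<^sup>2 / 2)" for x by (simp add: E norm_mult)
  define L where "L v x = of_real (a \<bullet> v) + of_real (-1) * of_real (x \<bullet> v) + \<i> * of_real (b \<bullet> v)" for v x :: 'a
  have L: "L v \<in> slow" for v unfolding L_def by (intro slow.add slow.mult slow.const slow.inner)
  have dE: "(E has_derivative (\<lambda>v. L v x * E x)) (at x)" for x
  proof -
    have "((\<lambda>x. of_real (a \<bullet> x - (x \<bullet> x) / 2) + \<i> * of_real (b \<bullet> x)) has_derivative (\<lambda>v. L v x)) (at x)"
      unfolding L_def by (auto intro!: derivative_eq_intros simp: fun_eq_iff inner_commute)
    from has_derivative_compose[OF this DERIV_exp[unfolded has_field_derivative_def]]
    show ?thesis unfolding E_def by (simp add: mult.commute)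
  qed
  have der: "\<exists>D. (\<forall>x. (h has_derivative (\<lambda>v. D v x)) (at x)) \<and> (\<forall>v. D v \<in> F)" if hF: "h \<in> F" for h
  proof -
    obtain g where g: "g \<in> slow" and h: "h = (\<lambda>x. g x * E x)" using hF unfolding F_def by blast
    obtain D where D: "\<And>x. (g has_derivative (\<lambda>v. D v x)) (at x)" "\<And>v. D v \<in> slow"
      using slow_has_derivative[OF g] by blast
    let ?D = "\<lambda>v x. (g x * L v x + D v x) * E x"
    have "(h has_derivative (\<lambda>v. ?D v x)) (at x)" for x
      unfolding h using has_derivative_mult[OF D(1)[of x] dE[of x]] by (simp add: algebra_simps)
    moreover have "?D v \<in> F" for v unfolding F_def using g L D(2) by (auto intro!: slow.add slow.mult)
    ultimately show ?thesis by (intro exI[of _ ?D]) auto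
  qed
  have "E \<in> schwartz"
  proof (rule schwartzI[where F=F])
    show "E \<in> F" unfolding F_def using slow.const[of 1] by force
    show "dir_deriv v h \<in> F" if "h \<in> F" for h v using der[OF that] dir_deriv_eq by metis
    show "h differentiable at x" if "h \<in> F" for h x using der[OF that] unfolding differentiable_def by blast
    show "\<exists>B. \<forall>x. (1 + norm x) ^ N * norm (h x) \<le> B" if hF: "h \<in> F" for h N
    proof -
      obtain g where g: "g \<in> slow" and h: "h = (\<lambda>x. g x * E x)" using hF unfolding F_def by blast
      obtain C M where C: "\<And>x. norm (g x) \<le> C * (1 + norm x) ^ M" using slow_growth[OF g] by blast
      let ?K = "real (N + M) + norm a"
      have "(1 + norm x) ^ N * norm (h x) \<le> \<bar>C\<bar> * exp (?K\<^sup>2 / 2)" for x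
      proof -
        have "norm (h x) \<le> (\<bar>C\<bar> * (1 + norm x) ^ M) * exp (a \<bullet> x - (norm x)\<^sup>2 / 2)"
          unfolding h norm_mult nE by (intro mult_right_mono order_trans[OF C]) auto
        then have "(1 + norm x) ^ N * norm (h x) \<le> (1 + norm x) ^ N * ((\<bar>C\<bar> * (1 + norm x) ^ M) * exp (a \<bullet> x - (norm x)\<^sup>2 / 2))"
          by (intro mult_left_mono) auto
        also have "\<dots> = \<bar>C\<bar> * ((1 + norm x) ^ (N + M) * exp (a \<bullet> x - (norm x)\<^sup>2 / 2))"
          by (simp add: power_add mult_ac)
        also have "\<dots> \<le> \<bar>C\<bar> * (exp (norm x) ^ (N + M) * exp (norm a * norm x - (norm x)\<^sup>2 / 2))"
          using exp_ge_add_one_self[of "norm x"] Cauchy_Schwarz_ineq2[of a x]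
          by (intro mult_left_mono mult_mono power_mono) auto
        also have "exp (norm x) ^ (N + M) * exp (norm a * norm x - (norm x)\<^sup>2 / 2) = exp (?K * norm x - (norm x)\<^sup>2 / 2)"
          by (simp add: exp_of_nat_mult[symmetric] exp_add[symmetric] algebra_simps)
        \<comment> \<open>The estimate 1 + t <= exp t has turned all polynomial factors into
          exponentials, so completing the square finishes the bound.\<close>
        also have "?K * norm x - (norm x)\<^sup>2 / 2 \<le> ?K\<^sup>2 / 2"
          using zero_le_power2[of "?K - norm x"] by (simp add: power2_eq_square algebra_simps)
        finally show ?thesis by (simp add: mult_left_mono)
      qed
      then show ?thesis by blast
    qed
  qed
  then show ?thesis unfolding E[abs_def, symmetric] by (simp add: fun_eq_iff E[symmetric])
qed

section \<open>Fourier transforms of Schwartz functions\<close>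

lemma has_vector_derivative_quotient_tendsto:
  assumes "(f has_vector_derivative D) (at x)"
  shows "((\<lambda>h. (f (x + h) - f x) /\<^sub>R h) \<longlongrightarrow> D) (at 0)"
proof -
  have "((\<lambda>h. norm (f (x + h) - f x - h *\<^sub>R D) / norm h) \<longlongrightarrow> 0) (at 0)"
    using assms unfolding has_vector_derivative_def has_derivative_at by blast
  moreover have "\<forall>\<^sub>F h in at 0. norm (f (x + h) - f x - h *\<^sub>R D) / norm h = norm ((f (x + h) - f x) /\<^sub>R h - D)"
    unfolding eventually_at
  proof (intro exI[of _ 1] conjI ballI impI)
    fix h :: real assume "h \<noteq> 0 \<and> dist h 0 < 1"
    then have "(f (x + h) - f x) /\<^sub>R h - D = (f (x + h) - f x - h *\<^sub>R D) /\<^sub>R h"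
      by (simp add: scaleR_diff_right)
    then show "norm (f (x + h) - f x - h *\<^sub>R D) / norm h = norm ((f (x + h) - f x) /\<^sub>R h - D)"
      by (simp add: divide_inverse mult.commute)
  qed simp
  ultimately have "((\<lambda>h. norm ((f (x + h) - f x) /\<^sub>R h - D)) \<longlongrightarrow> 0) (at 0)"
    by (rule Lim_transform_eventually)
  then show ?thesis by (rule LIM_zero_cancel[OF tendsto_norm_zero_cancel])
qed

text \<open>A supremum of reals bounds its members only if they are bounded above. Here there are
  finitely many lists of length at most N, and each contributes a bounded function.\<close>

lemma schwartz_seminorm_bound:
  fixes f :: "'a::euclidean_space \<Rightarrow> complex"
  assumes f: "f \<in> schwartz" and vs: "set vs \<subseteq> Basis" "length vs \<le> N"
  shows "(1 + norm x) ^ N * norm (partials vs f x) \<le> schwartz_seminorm N f"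
proof -
  let ?V = "{vs::'a list. set vs \<subseteq> Basis \<and> length vs \<le> N}"
  let ?h = "\<lambda>(vs, x). (1 + norm x) ^ N * norm (partials vs f x)"
  have "finite ?V" by (rule finite_lists_length_le) simp
  have "\<exists>B. \<forall>x. (1 + norm x) ^ N * norm (partials us f x) \<le> B" if "us \<in> ?V" for us
    using that schwartz_bound[OF schwartz_partials[OF f]] by blast
  then obtain B where B: "\<And>us x. us \<in> ?V \<Longrightarrow> (1 + norm x) ^ N * norm (partials us f x) \<le> B us" by metis
  have "bdd_above (?h ` (?V \<times> UNIV))"
  proof (rule bdd_aboveI2)
    fix p assume p: "p \<in> ?V \<times> (UNIV :: 'a set)"
    then have "?h p \<le> B (fst p)" using B by (cases p) auto
    also have "\<dots> \<le> (\<Sum>us\<in>?V. \<bar>B us\<bar>)"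
    proof -
      have "\<bar>B (fst p)\<bar> \<le> (\<Sum>us\<in>?V. \<bar>B us\<bar>)"
        using p by (intro member_le_sum \<open>finite ?V\<close>) auto
      then show ?thesis by linarith
    qed
    finally show "?h p \<le> (\<Sum>us\<in>?V. \<bar>B us\<bar>)" .
  qed
  then have "?h (vs, x) \<le> (SUP p\<in>?V \<times> UNIV. ?h p)"
    by (rule cSUP_upper[rotated]) (use vs in auto)
  then show ?thesis by (simp add: schwartz_seminorm_def case_prod_beta)
qed

text \<open>N > d leaves at least d + 1 powers of 1 + |x| in the seminorm, and the inverse of these
  is integrable. The integral of that weight serves as \<open>K\<close>, the same for all functions
  and all partials.\<close>

lemma integral_partials_bound:
  "\<exists>K\<ge>0. \<forall>f\<in>schwartz. \<forall>vs. set vs \<subseteq> Basis \<longrightarrow> length vs \<le> N \<longrightarrow> DIM('a::euclidean_space) < N \<longrightarrow>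
     integrable lborel (partials vs (f :: 'a \<Rightarrow> complex)) \<and>
     (LINT x|lborel. norm (partials vs f x)) \<le> K * schwartz_seminorm N f"
proof (intro exI conjI ballI allI impI)
  let ?g = "\<lambda>x::'a. (1 + norm x) powr (- real (DIM('a) + 1))"
  have g: "integrable lborel ?g" by (rule integrable_one_plus_norm_powr) simp
  show "0 \<le> (LINT x|lborel. ?g x)" by (intro Bochner_Integration.integral_nonneg) simp
  fix f :: "'a \<Rightarrow> complex" and vs :: "'a list"
  assume f: "f \<in> schwartz" and vs: "set vs \<subseteq> Basis" "length vs \<le> N" and N: "DIM('a) < N"
  have bd: "norm (partials vs f x) \<le> ?g x * schwartz_seminorm N f" for x
  proof -
    have "norm (partials vs f x) = ?g x * ((1 + norm x) ^ (DIM('a) + 1) * norm (partials vs f x))"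
    proof -
      have "0 < 1 + norm x" by (simp add: add_pos_nonneg)
      then have "?g x * (1 + norm x) ^ (DIM('a) + 1) = 1"
        by (subst powr_realpow[symmetric], simp, subst powr_add[symmetric]) simp
      then show ?thesis by (simp add: mult.assoc[symmetric])
    qed
    also have "\<dots> \<le> ?g x * ((1 + norm x) ^ N * norm (partials vs f x))"
      using N by (intro mult_left_mono mult_right_mono power_increasing) auto
    also have "\<dots> \<le> ?g x * schwartz_seminorm N f"
      by (intro mult_left_mono schwartz_seminorm_bound f vs) auto
    finally show ?thesis .
  qed
  have [measurable]: "partials vs f \<in> borel_measurable borel"
    by (rule schwartz_measurable[OF schwartz_partials[OF f vs(1)]])
  have gi: "integrable lborel (\<lambda>x. ?g x * schwartz_seminorm N f)" using g by simp
  show i: "integrable lborel (partials vs f)"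
    by (rule Bochner_Integration.integrable_bound[OF gi]) (auto intro!: AE_I2 order_trans[OF bd])
  have "(LINT x|lborel. norm (partials vs f x)) \<le> (LINT x|lborel. ?g x * schwartz_seminorm N f)"
    using i gi bd by (intro integral_mono) auto
  then show "(LINT x|lborel. norm (partials vs f x)) \<le> (LINT x|lborel. ?g x) * schwartz_seminorm N f" by simp
qed

lemma schwartz_integrable: "f \<in> schwartz \<Longrightarrow> integrable lborel (f :: 'a::euclidean_space \<Rightarrow> complex)"
  using integral_partials_bound[of "DIM('a) + 1"] by (auto dest!: bspec spec[of _ "[]"])

text \<open>Difference quotients in direction b: translating f multiplies its transform by a phase,
  and (cis (t \<xi>_b) - 1) / t tends to i \<xi>_b. On the other side dominated convergence passes
  to the derivative.\<close>

lemma fourier_dir_deriv: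
  fixes f :: "'a::euclidean_space \<Rightarrow> complex"
  assumes f: "f \<in> schwartz" and b: "b \<in> Basis"
  shows "fourier (dir_deriv b f) \<xi> = \<i> * of_real (\<xi> \<bullet> b) * fourier f \<xi>"
proof -
  let ?D = "dir_deriv b f"
  let ?n = "DIM('a) + 1"
  define t where "t n = 1 / real (Suc n)" for n
  have t: "0 < t n" "t n \<le> 1" for n by (auto simp: t_def)
  have t0: "t \<longlonglongrightarrow> 0" unfolding t_def by (rule LIMSEQ_Suc[OF lim_1_over_n])
  have D: "?D \<in> schwartz" using f b by (rule schwartz_dir_deriv)
  have fi: "integrable lborel f" "integrable lborel ?D" using f D by (auto intro: schwartz_integrable)
  have [measurable]: "f \<in> borel_measurable borel" "?D \<in> borel_measurable borel"
    using f D by (auto intro: schwartz_measurable)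
  obtain B where B: "\<And>x. (1 + norm x) ^ ?n * norm (?D x) \<le> B" using schwartz_bound[OF D] by blast
  have B0: "0 \<le> B" using B[of 0] by (auto intro: order_trans[rotated])
  have line: "((\<lambda>s. f (x + s *\<^sub>R b)) has_vector_derivative ?D (x + s *\<^sub>R b)) (at s within S)" for x s S
  proof -
    have "((\<lambda>s. x + s *\<^sub>R b) has_derivative (\<lambda>h. h *\<^sub>R b)) (at s within S)"
      by (auto intro!: derivative_eq_intros)
    from has_derivative_compose[OF this schwartz_has_derivative[OF f]]
    have "((\<lambda>s. f (x + s *\<^sub>R b)) has_derivative (\<lambda>h. dir_deriv (h *\<^sub>R b) f (x + s *\<^sub>R b))) (at s within S)" .
    moreover have "dir_deriv (h *\<^sub>R b) f y = h *\<^sub>R dir_deriv b f y" for h y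
      using has_derivative_linear[OF schwartz_has_derivative[OF f, of y]] by (rule linear_scale)
    ultimately show ?thesis by (simp add: has_vector_derivative_def)
  qed
  define q where "q n x = (f (x + t n *\<^sub>R b) - f x) / of_real (t n)" for n x
  have [measurable]: "q n \<in> borel_measurable borel" for n unfolding q_def by measurable
  have q_lim: "(\<lambda>n. q n x) \<longlonglongrightarrow> ?D x" for x
  proof -
    from has_vector_derivative_quotient_tendsto[OF line[of x 0 UNIV]]
 have "((\<lambda>h. (f (x + h *\<^sub>R b) - f x) /\<^sub>R h) \<longlongrightarrow> ?D x) (at 0)" by simp
    moreover have "filterlim t (at 0) sequentially"
      using t0 t(1) by (auto simp: filterlim_at intro!: eventuallyI) (metis less_irrefl)
    ultimately have "((\<lambda>n. (f (x + t n *\<^sub>R b) - f x) /\<^sub>R t n) \<longlonglongrightarrow> ?D x)"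
      by (rule filterlim_compose)
    then show ?thesis by (simp add: q_def scaleR_conv_of_real divide_inverse mult.commute)
  qed
  have q_bd: "norm (q n x) \<le> B * 2 ^ ?n * (1 + norm x) powr (- real ?n)" for n x
  proof -
    let ?M = "B * 2 ^ ?n * (1 + norm x) powr (- real ?n)"
    have Dy: "norm (?D (x + s *\<^sub>R b)) \<le> ?M" if "s \<in> {0..t n}" for s
    proof -
      let ?y = "x + s *\<^sub>R b"
      have s: "\<bar>s\<bar> \<le> 1" using that t(2)[of n] by auto
      have p: "0 < 1 + norm x" "0 < 1 + norm ?y" by (auto simp: add_pos_nonneg)
      have "norm x \<le> norm ?y + norm (s *\<^sub>R b)" using norm_triangle_ineq4[of ?y "s *\<^sub>R b"] by simp
      \<comment> \<open>The segment has length at most 1, so the weights at its points and at x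
        differ at most by a factor 2. This yields a majorant that does not depend on n.\<close>
      then have "1 + norm x \<le> 2 * (1 + norm ?y)" using s b norm_ge_zero[of ?y] by (simp del: norm_ge_zero)
      then have "(1 + norm x) ^ ?n \<le> (2 * (1 + norm ?y)) ^ ?n" using p by (intro power_mono) auto
      then have "(1 + norm x) ^ ?n * norm (?D ?y) \<le> (2 * (1 + norm ?y)) ^ ?n * norm (?D ?y)"
        by (rule mult_right_mono) simp
      also have "\<dots> = 2 ^ ?n * ((1 + norm ?y) ^ ?n * norm (?D ?y))" by (simp only: power_mult_distrib mult.assoc)
      also have "\<dots> \<le> 2 ^ ?n * B" by (intro mult_left_mono B) auto
      finally have "norm (?D ?y) \<le> 2 ^ ?n * B / (1 + norm x) ^ ?n"
        using p by (simp only: pos_le_divide_eq zero_less_power mult.commute)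
      also have "\<dots> = ?M" using p by (simp only: powr_minus powr_realpow divide_inverse) simp
      finally show ?thesis .
    qed
    have "norm (f (x + t n *\<^sub>R b) - f (x + 0 *\<^sub>R b)) \<le> ?M * norm (t n - 0)"
    proof (rule differentiable_bound[where S="{0..t n}" and f'="\<lambda>s h. h *\<^sub>R ?D (x + s *\<^sub>R b)"])
      show "((\<lambda>s. f (x + s *\<^sub>R b)) has_derivative (\<lambda>h. h *\<^sub>R ?D (x + s *\<^sub>R b))) (at s within {0..t n})" for s
        using line unfolding has_vector_derivative_def .
      show "onorm (\<lambda>h. h *\<^sub>R ?D (x + s *\<^sub>R b)) \<le> ?M" if "s \<in> {0..t n}" for s
        by (rule onorm_bound) (use Dy[OF that] B0 in \<open>auto simp: mult.commute intro!: mult_left_mono\<close>)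
    qed (use t(1)[of n] in auto)
    then have "norm (f (x + t n *\<^sub>R b) - f x) \<le> ?M * t n" using t(1)[of n] by simp
    then show ?thesis using t(1)[of n] unfolding q_def norm_divide norm_of_real
      by (simp only: pos_divide_le_eq abs_of_pos)
  qed
  have "(\<lambda>n. fourier (q n) \<xi>) \<longlonglongrightarrow> fourier ?D \<xi>"
    unfolding fourier_def
  proof (rule integral_dominated_convergence[where w="\<lambda>x. B * 2 ^ ?n * (1 + norm x) powr (- real ?n)"])
    show "integrable lborel (\<lambda>x::'a. B * 2 ^ ?n * (1 + norm x) powr (- real ?n))"
      by (intro integrable_mult_right integrable_one_plus_norm_powr) simp
    show "AE x in lborel. (\<lambda>n. cis (- (\<xi> \<bullet> x)) * q n x) \<longlonglongrightarrow> cis (- (\<xi> \<bullet> x)) * ?D x"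
      by (intro AE_I2 tendsto_mult tendsto_const q_lim)
    show "AE x in lborel. norm (cis (- (\<xi> \<bullet> x)) * q n x) \<le> B * 2 ^ ?n * (1 + norm x) powr (- real ?n)" for n
      using q_bd[of n] by (auto simp only: norm_mult norm_cis mult_1)
  qed auto
  moreover have "fourier (q n) \<xi> = (cis (t n * (\<xi> \<bullet> b)) - 1) / of_real (t n) * fourier f \<xi>" for n
  proof -
    have sh: "integrable lborel (\<lambda>x. f (t n *\<^sub>R b + x))"
      "(LINT x|lborel. cis (- (\<xi> \<bullet> (t n *\<^sub>R b + x))) * f (t n *\<^sub>R b + x)) = fourier f \<xi>"
    proof -
      have [simp]: "distr lborel borel ((+) (t n *\<^sub>R b)) = lborel" by (rule lborel_distr_plus)
      show "integrable lborel (\<lambda>x. f (t n *\<^sub>R b + x))"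
        using integrable_distr[of "(+) (t n *\<^sub>R b)" lborel borel f] fi by simp
      show "(LINT x|lborel. cis (- (\<xi> \<bullet> (t n *\<^sub>R b + x))) * f (t n *\<^sub>R b + x)) = fourier f \<xi>"
        unfolding fourier_def
        using integral_distr[of "(+) (t n *\<^sub>R b)" lborel borel "\<lambda>x. cis (- (\<xi> \<bullet> x)) * f x"] by simp
    qed
    have i1: "integrable lborel (\<lambda>x. cis (- (\<xi> \<bullet> x)) * f (t n *\<^sub>R b + x))"
      and i2: "integrable lborel (\<lambda>x. cis (- (\<xi> \<bullet> x)) * f x)"
      using sh(1) fi(1) by (auto intro!: integrable_cis_mult)
    have "(LINT x|lborel. cis (- (\<xi> \<bullet> x)) * f (t n *\<^sub>R b + x))
      = (LINT x|lborel. cis (t n * (\<xi> \<bullet> b)) * (cis (- (\<xi> \<bullet> (t n *\<^sub>R b + x))) * f (t n *\<^sub>R b + x)))"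
      by (intro Bochner_Integration.integral_cong refl) (simp add: mult.assoc[symmetric] cis_mult inner_add_right)
    also have "\<dots> = cis (t n * (\<xi> \<bullet> b)) * fourier f \<xi>" using sh(2) by simp
    finally have e: "(LINT x|lborel. cis (- (\<xi> \<bullet> x)) * f (t n *\<^sub>R b + x)) = cis (t n * (\<xi> \<bullet> b)) * fourier f \<xi>" .
    have "fourier (q n) \<xi> = (LINT x|lborel. (cis (- (\<xi> \<bullet> x)) * f (t n *\<^sub>R b + x) - cis (- (\<xi> \<bullet> x)) * f x) / of_real (t n))"
      unfolding fourier_def q_def
      by (intro Bochner_Integration.integral_cong refl) (simp add: right_diff_distrib add.commute)
    also have "\<dots> = (cis (t n * (\<xi> \<bullet> b)) * fourier f \<xi> - fourier f \<xi>) / of_real (t n)"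
      unfolding integral_divide_zero Bochner_Integration.integral_diff[OF i1 i2] e by (simp add: fourier_def)
    finally show ?thesis by (simp add: left_diff_distrib)
  qed
  moreover have "(\<lambda>n. (cis (t n * (\<xi> \<bullet> b)) - 1) / of_real (t n) * fourier f \<xi>) \<longlonglongrightarrow> \<i> * of_real (\<xi> \<bullet> b) * fourier f \<xi>"
  proof (intro tendsto_mult tendsto_const)
    have "((\<lambda>s. cis (s * (\<xi> \<bullet> b))) has_vector_derivative \<i> * of_real (\<xi> \<bullet> b)) (at 0)"
    proof -
      have "((\<lambda>z. exp (\<i> * (z * of_real (\<xi> \<bullet> b)))) has_field_derivative (\<i> * of_real (\<xi> \<bullet> b))) (at (of_real 0))"
        by (auto intro!: derivative_eq_intros)
      from has_vector_derivative_real_field[OF this] show ?thesis by (simp add: cis_conv_exp)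
    qed
    from has_vector_derivative_quotient_tendsto[OF this]
    have "((\<lambda>h. (cis (h * (\<xi> \<bullet> b)) - 1) /\<^sub>R h) \<longlongrightarrow> \<i> * of_real (\<xi> \<bullet> b)) (at 0)" by simp
    moreover have "filterlim t (at 0) sequentially"
      using t0 t(1) by (auto simp: filterlim_at intro!: eventuallyI) (metis less_irrefl)
    ultimately have "(\<lambda>n. (cis (t n * (\<xi> \<bullet> b)) - 1) /\<^sub>R t n) \<longlonglongrightarrow> \<i> * of_real (\<xi> \<bullet> b)"
      by (rule filterlim_compose)
    then show "(\<lambda>n. (cis (t n * (\<xi> \<bullet> b)) - 1) / of_real (t n)) \<longlonglongrightarrow> \<i> * of_real (\<xi> \<bullet> b)"
      by (simp add: scaleR_conv_of_real divide_inverse mult.commute)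
  qed
  ultimately show ?thesis using LIMSEQ_unique by (simp only:)
qed

lemma fourier_partials_replicate:
  assumes f: "f \<in> schwartz" and b: "b \<in> Basis"
  shows "fourier (partials (replicate j b) f) \<xi> = (\<i> * of_real (\<xi> \<bullet> b)) ^ j * fourier f \<xi>"
proof (induction j)
  case (Suc j)
  have "partials (replicate j b) f \<in> schwartz" by (rule schwartz_partials[OF f]) (use b in auto)
  then show ?case using Suc by (simp add: fourier_dir_deriv[OF _ b])
qed simp

text \<open>Let m be the largest of 1 and the absolute values of the coordinates. Then 1 + |\<xi>|
  <= (1 + d) m, and m^N occurs among the summands on the right.\<close>

lemma one_plus_norm_power_le:
  fixes \<xi> :: "'a::euclidean_space"
  shows "(1 + norm \<xi>) ^ N \<le> (1 + DIM('a)) ^ N * (1 + (\<Sum>b\<in>Basis. \<bar>\<xi> \<bullet> b\<bar> ^ N))"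
proof -
  define m where "m = Max (insert 1 ((\<lambda>b. \<bar>\<xi> \<bullet> b\<bar>) ` Basis))"
  have m: "1 \<le> m" "\<And>b. b \<in> Basis \<Longrightarrow> \<bar>\<xi> \<bullet> b\<bar> \<le> m" unfolding m_def by (intro Max_ge; simp)+
  have "norm \<xi> \<le> (\<Sum>b\<in>Basis. \<bar>\<xi> \<bullet> b\<bar>)" by (rule norm_le_l1)
  also have "\<dots> \<le> (\<Sum>b\<in>(Basis::'a set). m)" by (intro sum_mono m)
  finally have "1 + norm \<xi> \<le> (1 + DIM('a)) * m" using m(1) by (simp add: algebra_simps)
  then have "(1 + norm \<xi>) ^ N \<le> ((1 + DIM('a)) * m) ^ N" by (intro power_mono) auto
  also have "\<dots> = (1 + DIM('a)) ^ N * m ^ N" by (simp add: power_mult_distrib)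
  also have "m ^ N \<le> 1 + (\<Sum>b\<in>Basis. \<bar>\<xi> \<bullet> b\<bar> ^ N)"
  proof -
    have "m \<in> insert 1 ((\<lambda>b. \<bar>\<xi> \<bullet> b\<bar>) ` Basis)" unfolding m_def by (rule Max_in) auto
    then consider "m = 1" | b where "b \<in> Basis" "m = \<bar>\<xi> \<bullet> b\<bar>" by auto
    then show ?thesis
    proof cases
      case 1 then show ?thesis by (simp add: sum_nonneg)
    next
      case 2
      then have "m ^ N \<le> (\<Sum>b\<in>Basis. \<bar>\<xi> \<bullet> b\<bar> ^ N)"
        using member_le_sum[of b Basis "\<lambda>b. \<bar>\<xi> \<bullet> b\<bar> ^ N"] by auto
      then show ?thesis by simp
    qed
  qed
  finally show ?thesis by (simp add: mult_left_mono)
qed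

text \<open>N derivatives in a basis direction b multiply the transform by |\<xi>_b|^N in modulus,
  and the L^1 norm of the derivative bounds the product. The constant is uniform in f because
  temperedness of a distribution defined through transforms requires a seminorm bound.\<close>

lemma fourier_schwartz_decay:
  assumes N: "DIM('a::euclidean_space) < N"
  shows "\<exists>C\<ge>0. \<forall>f\<in>schwartz. \<forall>\<xi>::'a. norm (fourier f \<xi>) \<le> C * schwartz_seminorm N f * (1 + norm \<xi>) powr (- real N)"
proof -
  obtain K where K: "K \<ge> 0" "\<And>f vs. f \<in> schwartz \<Longrightarrow> set vs \<subseteq> Basis \<Longrightarrow> length vs \<le> N \<Longrightarrow>
     (LINT x|lborel. norm (partials vs f (x::'a))) \<le> K * schwartz_seminorm N f"
    using integral_partials_bound[where N=N and 'a='a] N by blast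
  let ?C = "(1 + DIM('a)) ^ N * (1 + DIM('a)) * K"
  have "norm (fourier f \<xi>) \<le> ?C * schwartz_seminorm N f * (1 + norm \<xi>) powr (- real N)"
    if f: "f \<in> schwartz" for f and \<xi> :: 'a
  proof -
    have 1: "norm (fourier (partials vs f) \<xi>) \<le> K * schwartz_seminorm N f" if "set vs \<subseteq> Basis" "length vs \<le> N" for vs
      by (rule order_trans[OF norm_fourier_le K(2)[OF f that]])
    have 0: "norm (fourier f \<xi>) \<le> K * schwartz_seminorm N f" using 1[of "[]"] by simp
    have b: "\<bar>\<xi> \<bullet> b\<bar> ^ N * norm (fourier f \<xi>) \<le> K * schwartz_seminorm N f" if "b \<in> Basis" for b
      using 1[of "replicate N b"] that fourier_partials_replicate[OF f that, of N \<xi>]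
      by (simp add: norm_mult norm_power set_replicate_conv_if)
    have "(1 + norm \<xi>) ^ N * norm (fourier f \<xi>) \<le> (1 + DIM('a)) ^ N * (1 + (\<Sum>b\<in>Basis. \<bar>\<xi> \<bullet> b\<bar> ^ N)) * norm (fourier f \<xi>)"
      using one_plus_norm_power_le[of \<xi> N] by (intro mult_right_mono) auto
    also have "\<dots> = (1 + DIM('a)) ^ N * (norm (fourier f \<xi>) + (\<Sum>b\<in>Basis. \<bar>\<xi> \<bullet> b\<bar> ^ N * norm (fourier f \<xi>)))"
      by (simp add: distrib_right sum_distrib_right)
    also have "\<dots> \<le> (1 + DIM('a)) ^ N * (K * schwartz_seminorm N f + (\<Sum>b\<in>(Basis::'a set). K * schwartz_seminorm N f))"
      by (intro mult_left_mono add_mono sum_mono 0 b) auto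
    also have "\<dots> = ?C * schwartz_seminorm N f" by (simp add: algebra_simps)
    finally have "norm (fourier f \<xi>) \<le> ?C * schwartz_seminorm N f / (1 + norm \<xi>) ^ N"
      by (simp only: pos_le_divide_eq zero_less_power add_pos_nonneg zero_less_one norm_ge_zero mult.commute)
    also have "\<dots> = ?C * schwartz_seminorm N f * (1 + norm \<xi>) powr (- real N)"
    proof -
      have "0 < 1 + norm \<xi>" by (simp add: add_pos_nonneg)
      then show ?thesis by (simp only: powr_minus powr_realpow divide_inverse)
    qed
    finally show ?thesis .
  qed
  then show ?thesis using K(1) by (intro exI[of _ ?C]) auto
qed

lemma fourier_schwartz_integrable:
  fixes f :: "'a::euclidean_space \<Rightarrow> complex"
  assumes f: "f \<in> schwartz"
  shows "integrable lborel (fourier f)"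
proof -
  obtain C where C: "\<And>\<xi>. norm (fourier f \<xi>) \<le> C * schwartz_seminorm (DIM('a) + 1) f * (1 + norm \<xi>) powr (- real (DIM('a) + 1))"
    using fourier_schwartz_decay[where 'a='a and N="DIM('a) + 1"] f by auto
  have [measurable]: "f \<in> borel_measurable borel" using f by (rule schwartz_measurable)
  show ?thesis
  proof (rule Bochner_Integration.integrable_bound)
    show "integrable lborel (\<lambda>\<xi>::'a. C * schwartz_seminorm (DIM('a) + 1) f * (1 + norm \<xi>) powr (- real (DIM('a) + 1)))"
      by (intro integrable_mult_right integrable_one_plus_norm_powr) simp
    show "AE \<xi> in lborel. norm (fourier f \<xi>) \<le> norm (C * schwartz_seminorm (DIM('a) + 1) f * (1 + norm \<xi>) powr (- real (DIM('a) + 1)))"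
      by (intro AE_I2 order_trans[OF C]) (auto intro: abs_ge_self)
  qed simp
qed

lemma inv_fourier_eq_fourier: "inv_fourier f x = of_real (1 / (2 * pi) ^ DIM('a)) * fourier f (- (x::'a::euclidean_space))"
  by (simp add: inv_fourier_def fourier_def inner_commute)

section \<open>Radial functions in three dimensions\<close>

lemma nn_integral_radial:
  fixes g :: "real \<Rightarrow> ennreal"
  assumes [measurable]: "g \<in> borel_measurable borel"
  shows "(\<integral>\<^sup>+ x. g (norm (x :: real ^ 3)) \<partial>lborel)
    = (\<integral>\<^sup>+ r. ennreal (4 * pi * r\<^sup>2) * indicator {0..} r * g r \<partial>lborel)"
proof -
  have "(\<integral>\<^sup>+ x. g (norm (x :: real ^ 3)) \<partial>lborel) = (\<integral>\<^sup>+ x. (\<lambda>p. g (fst p)) (norm x, axis 1 1 \<bullet> (x :: real ^ 3)) \<partial>lborel)"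
    by simp
  also have "\<dots> = (\<integral>\<^sup>+ p. ennreal (2 * pi * fst p) * indicator {p. \<bar>snd p\<bar> \<le> fst p} p * g (fst p) \<partial>lborel)"
    by (rule nn_integral_spherical) (auto simp: borel_prod[symmetric])
  also have "\<dots> = (\<integral>\<^sup>+ r. (\<integral>\<^sup>+ z. (ennreal (2 * pi * r) * g r) * indicator {-r..r} z \<partial>lborel) \<partial>lborel)"
    by (subst lborel_prod[symmetric], subst lborel.nn_integral_fst[symmetric])
       (auto intro!: nn_integral_cong simp: mult_ac abs_le_iff split: split_indicator)
  also have "\<dots> = (\<integral>\<^sup>+ r. ennreal (4 * pi * r\<^sup>2) * indicator {0..} r * g r \<partial>lborel)"
  proof (rule nn_integral_cong)
    fix r :: real
    show "(\<integral>\<^sup>+ z. (ennreal (2 * pi * r) * g r) * indicator {-r..r} z \<partial>lborel) = ennreal (4 * pi * r\<^sup>2) * indicator {0..} r * g r"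
    proof (cases "0 \<le> r")
      case True
      have "ennreal (2 * pi * r) * ennreal (2 * r) = ennreal (4 * pi * r\<^sup>2)"
        using True by (subst ennreal_mult[symmetric]) (auto simp: power2_eq_square)
      then show ?thesis using True
        by (subst nn_integral_cmult_indicator) (auto simp: mult_ac)
    qed auto
  qed
  finally show ?thesis .
qed

lemma integral_spherical:
  fixes \<Psi> :: "real \<times> real \<Rightarrow> complex" and e :: "real ^ 3"
  assumes [measurable]: "\<Psi> \<in> borel_measurable borel" and e: "norm e = 1"
  shows "(LINT x|lborel. \<Psi> (norm x, e \<bullet> x))
    = (LINT p|lborel. (2 * pi * fst p * indicator {p. \<bar>snd p\<bar> \<le> fst p} p) *\<^sub>R \<Psi> p)"
proof -
  have [measurable]: "\<Psi> \<in> borel_measurable (borel \<Otimes>\<^sub>M borel)" by (simp add: borel_prod)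
  have m: "(\<lambda>p::real\<times>real. 2 * pi * fst p * indicator {p. \<bar>snd p\<bar> \<le> fst p} p) \<in> borel_measurable (borel \<Otimes>\<^sub>M borel)"
    by measurable
  have "(LINT x|lborel. \<Psi> (norm x, e \<bullet> x)) = integral\<^sup>L (distr lborel borel (\<lambda>x. (norm x, e \<bullet> x))) \<Psi>"
    by (subst integral_distr) (auto simp: borel_prod[symmetric])
  also have "distr lborel borel (\<lambda>x. (norm x, e \<bullet> x))
     = density lborel (\<lambda>p. ennreal (2 * pi * fst p * indicator {p. \<bar>snd p\<bar> \<le> fst p} p))"
    unfolding distr_norm_inner[OF e] by (rule arg_cong[where f="density lborel"]) (auto split: split_indicator)
  also have "integral\<^sup>L \<dots> \<Psi> = (LINT p|lborel. (2 * pi * fst p * indicator {p. \<bar>snd p\<bar> \<le> fst p} p) *\<^sub>R \<Psi> p)"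
    by (rule integral_density) (use m in \<open>auto simp: borel_prod split: split_indicator\<close>)
  finally show ?thesis .
qed

text \<open>In the coordinates r and z = e . x, with e along \<xi>, the phase depends on z alone,
  and its integral over [-r, r] is 2 sin (s r) / s, where s = |\<xi>| has to be nonzero.\<close>

lemma
  fixes \<Phi> :: "real \<Rightarrow> complex"
  assumes [measurable]: "\<Phi> \<in> borel_measurable borel"
    and int: "integrable lborel (\<lambda>r. indicator {0..} r *\<^sub>R (of_real (r\<^sup>2) * \<Phi> r))"
  shows integrable_radial: "integrable lborel (\<lambda>x::real^3. \<Phi> (norm x))"
    and fourier_radial: "\<xi> \<noteq> 0 \<Longrightarrow> fourier (\<lambda>x. \<Phi> (norm x)) \<xi>
      = of_real (4 * pi / norm (\<xi> :: real^3)) * (LINT r|lborel. indicator {0..} r *\<^sub>R (of_real (r * sin (norm \<xi> * r)) * \<Phi> r))"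
proof -
  have fin: "(\<integral>\<^sup>+ r. ennreal (4 * pi * r\<^sup>2) * indicator {0..} r * ennreal (norm (\<Phi> r)) \<partial>lborel) < \<infinity>"
  proof -
    have "(\<integral>\<^sup>+ r. ennreal (4 * pi * r\<^sup>2) * indicator {0..} r * ennreal (norm (\<Phi> r)) \<partial>lborel)
      = (\<integral>\<^sup>+ r. ennreal (4 * pi) * ennreal (norm (indicator {0..} r *\<^sub>R (of_real (r\<^sup>2) * \<Phi> r))) \<partial>lborel)"
      by (intro nn_integral_cong) (auto simp: norm_mult norm_power ennreal_mult[symmetric] mult_ac split: split_indicator)
    also have "\<dots> = ennreal (4 * pi) * (\<integral>\<^sup>+ r. ennreal (norm (indicator {0..} r *\<^sub>R (of_real (r\<^sup>2) * \<Phi> r))) \<partial>lborel)"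
      by (rule nn_integral_cmult) simp
    also have "\<dots> < \<infinity>" using int by (auto simp: integrable_iff_bounded ennreal_mult_less_top)
    finally show ?thesis .
  qed
  show i: "integrable lborel (\<lambda>x::real^3. \<Phi> (norm x))"
  proof (rule integrableI_bounded)
    show "(\<integral>\<^sup>+ x. ennreal (norm (\<Phi> (norm (x::real^3)))) \<partial>lborel) < \<infinity>"
      using nn_integral_radial[of "\<lambda>r. ennreal (norm (\<Phi> r))"] fin by simp
  qed simp
  assume \<xi>: "\<xi> \<noteq> 0"
  define s where "s = norm \<xi>"
  have s: "s > 0" using \<xi> by (simp add: s_def)
  define e where "e = \<xi> /\<^sub>R s"
  have e: "norm e = 1" using s by (simp add: e_def s_def)
  have \<xi>e: "\<xi> \<bullet> x = s * (e \<bullet> x)" for x using s by (simp add: e_def)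
  let ?\<Psi> = "\<lambda>p::real\<times>real. cis (- (s * snd p)) * \<Phi> (fst p)"
  have m: "?\<Psi> \<in> borel_measurable (borel \<Otimes>\<^sub>M borel)" by measurable
  have "fourier (\<lambda>x. \<Phi> (norm x)) \<xi> = (LINT x|lborel. ?\<Psi> (norm x, e \<bullet> x))"
    by (simp add: fourier_def \<xi>e)
  also have "\<dots> = (LINT p|lborel. (2 * pi * fst p * indicator {p. \<bar>snd p\<bar> \<le> fst p} p) *\<^sub>R ?\<Psi> p)"
    by (rule integral_spherical[OF _ e]) (use m in \<open>simp add: borel_prod\<close>)
  also have "\<dots> = (LINT r|lborel. (LINT z|lborel. (2 * pi * r * indicator {p. \<bar>snd p\<bar> \<le> fst p} (r, z)) *\<^sub>R ?\<Psi> (r, z)))"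
  proof -
    have "integrable (lborel \<Otimes>\<^sub>M lborel) (\<lambda>(r, z). (2 * pi * r * indicator {p. \<bar>snd p\<bar> \<le> fst p} (r, z)) *\<^sub>R ?\<Psi> (r, z))"
    proof (rule integrable_pairI)
      have "(\<integral>\<^sup>+ r. (\<integral>\<^sup>+ z. ennreal (norm ((2 * pi * r * indicator {p. \<bar>snd p\<bar> \<le> fst p} (r, z)) *\<^sub>R ?\<Psi> (r, z))) \<partial>lborel) \<partial>lborel)
        = (\<integral>\<^sup>+ r. ennreal (4 * pi * r\<^sup>2) * indicator {0..} r * ennreal (norm (\<Phi> r)) \<partial>lborel)"
      proof (rule nn_integral_cong)
        fix r :: real
        have "(\<integral>\<^sup>+ z. ennreal (norm ((2 * pi * r * indicator {p. \<bar>snd p\<bar> \<le> fst p} (r, z)) *\<^sub>R ?\<Psi> (r, z))) \<partial>lborel)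
          = (\<integral>\<^sup>+ z. ennreal (\<bar>2 * pi * r\<bar> * norm (\<Phi> r)) * indicator {-r..r} z \<partial>lborel)"
          by (intro nn_integral_cong) (auto simp: norm_mult abs_mult abs_le_iff split: split_indicator)
        also have "\<dots> = ennreal (4 * pi * r\<^sup>2) * indicator {0..} r * ennreal (norm (\<Phi> r))"
        proof (cases "0 \<le> r")
          case True
          then show ?thesis
            by (subst nn_integral_cmult_indicator)
               (auto simp: ennreal_mult[symmetric] power2_eq_square mult_ac)
        qed auto
        finally show "(\<integral>\<^sup>+ z. ennreal (norm ((2 * pi * r * indicator {p. \<bar>snd p\<bar> \<le> fst p} (r, z)) *\<^sub>R ?\<Psi> (r, z))) \<partial>lborel)
          = ennreal (4 * pi * r\<^sup>2) * indicator {0..} r * ennreal (norm (\<Phi> r))" .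
      qed
      then show "(\<integral>\<^sup>+ r. (\<integral>\<^sup>+ z. ennreal (norm ((2 * pi * r * indicator {p. \<bar>snd p\<bar> \<le> fst p} (r, z)) *\<^sub>R ?\<Psi> (r, z))) \<partial>lborel) \<partial>lborel) < \<infinity>"
        using fin by simp
    qed measurable
    from lborel_pair.integral_fst[OF this] show ?thesis
      by (simp add: lborel_prod split_def)
  qed
  also have "\<dots> = (LINT r|lborel. of_real (4 * pi / s) * (indicator {0..} r *\<^sub>R (of_real (r * sin (s * r)) * \<Phi> r)))"
  proof (rule Bochner_Integration.integral_cong[OF refl])
    fix r :: real
    show "(LINT z|lborel. (2 * pi * r * indicator {p. \<bar>snd p\<bar> \<le> fst p} (r, z)) *\<^sub>R ?\<Psi> (r, z))
      = of_real (4 * pi / s) * (indicator {0..} r *\<^sub>R (of_real (r * sin (s * r)) * \<Phi> r))"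
    proof (cases "0 \<le> r")
      case True
      have F: "((\<lambda>z. (\<i> / of_real s) * cis (- (s * z))) has_vector_derivative cis (- (s * z))) (at z within S)" for z S
      proof -
        have "((\<lambda>w. (\<i> / of_real s) * exp (\<i> * (- (of_real s * w)))) has_field_derivative exp (\<i> * (- (of_real s * of_real z)))) (at (of_real z))"
          using s by (auto intro!: derivative_eq_intros)
        from has_vector_derivative_at_within[OF has_vector_derivative_real_field[OF this]]
        show ?thesis by (simp add: cis_conv_exp)
      qed
      have "has_bochner_integral lborel (\<lambda>z. indicator {-r..r} z *\<^sub>R cis (- (s * z)))
         ((\<i> / of_real s) * cis (- (s * r)) - (\<i> / of_real s) * cis (- (s * (- r))))"
        using True by (intro has_bochner_integral_FTC_Icc F) (auto intro!: continuous_intros simp: cis_conv_exp)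
      moreover have "(\<i> / of_real s) * cis (- (s * r)) - (\<i> / of_real s) * cis (- (s * (- r))) = of_real (2 * sin (s * r) / s)"
        using s by (simp add: complex_eq_iff)
      ultimately have I: "(LINT z|lborel. indicator {-r..r} z *\<^sub>R cis (- (s * z))) = of_real (2 * sin (s * r) / s)"
        by (simp add: has_bochner_integral_iff)
      have "(LINT z|lborel. (2 * pi * r * indicator {p. \<bar>snd p\<bar> \<le> fst p} (r, z)) *\<^sub>R ?\<Psi> (r, z))
        = (LINT z|lborel. (indicator {-r..r} z *\<^sub>R cis (- (s * z))) * (of_real (2 * pi * r) * \<Phi> r))"
        by (intro Bochner_Integration.integral_cong refl)
           (auto simp: scaleR_conv_of_real abs_le_iff split: split_indicator)
      also have "\<dots> = of_real (2 * sin (s * r) / s) * (of_real (2 * pi * r) * \<Phi> r)"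
        by (simp only: integral_mult_left_zero I)
      finally show ?thesis using True by simp
    next
      case False
      then have "indicator {p. \<bar>snd p\<bar> \<le> fst p} (r, z) = (0::real)" for z by auto
      then show ?thesis using False by simp
    qed
  qed
  finally show "fourier (\<lambda>x. \<Phi> (norm x)) \<xi>
      = of_real (4 * pi / norm \<xi>) * (LINT r|lborel. indicator {0..} r *\<^sub>R (of_real (r * sin (norm \<xi> * r)) * \<Phi> r))"
    by (simp only: s_def integral_mult_right_zero)
qed

lemma
  fixes c :: complex
  assumes c: "Re c < 0"
  shows integrable_exp_half_line: "integrable lborel (\<lambda>r::real. indicator {0..} r *\<^sub>R exp (c * of_real r))"
    and integral_exp_half_line: "(LINT r|lborel. indicator {0..} r *\<^sub>R exp (c * of_real r)) = - 1 / c"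
proof -
  have half: "(\<integral>\<^sup>+ r. ennreal (exp (Re c * r)) * indicator {0..} r \<partial>lborel) = ennreal (0 - exp (Re c * 0) / Re c)"
  proof (rule nn_integral_FTC_atLeast)
    have "((\<lambda>r. exp (Re c * r)) \<longlongrightarrow> 0) at_top"
      by (rule filterlim_compose[OF exp_at_bot])
         (use c in \<open>auto intro!: filterlim_tendsto_neg_mult_at_bot[OF tendsto_const] filterlim_ident\<close>)
    from tendsto_divide[OF this tendsto_const, of "Re c"] c
    show "((\<lambda>r. exp (Re c * r) / Re c) \<longlongrightarrow> 0) at_top" by simp
  qed (use c in \<open>auto intro!: derivative_eq_intros\<close>)
  show i: "integrable lborel (\<lambda>r::real. indicator {0..} r *\<^sub>R exp (c * of_real r))"
  proof (rule integrableI_bounded)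
    have "(\<integral>\<^sup>+ r. ennreal (norm (indicator {0..} r *\<^sub>R exp (c * of_real r))) \<partial>lborel) = (\<integral>\<^sup>+ r. ennreal (exp (Re c * r)) * indicator {0..} r \<partial>lborel)"
      by (intro nn_integral_cong) (auto split: split_indicator)
    then show "(\<integral>\<^sup>+ r. ennreal (norm (indicator {0..} r *\<^sub>R exp (c * of_real r))) \<partial>lborel) < \<infinity>" by (simp add: half)
  qed simp
  have F: "((\<lambda>r. exp (c * of_real r) / c) has_vector_derivative exp (c * of_real r)) (at r within S)" for r S
  proof -
    have "((\<lambda>w. exp (c * w) / c) has_field_derivative exp (c * of_real r)) (at (of_real r))"
      using c by (auto intro!: derivative_eq_intros)
    from has_vector_derivative_at_within[OF has_vector_derivative_real_field[OF this]] show ?thesis .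
  qed
  have "(\<lambda>n. LINT r|lborel. indicator {0..real n} r *\<^sub>R exp (c * of_real r)) \<longlonglongrightarrow> (LINT r|lborel. indicator {0..} r *\<^sub>R exp (c * of_real r))"
  proof (rule integral_dominated_convergence[where w="\<lambda>r. norm (indicator {0..} r *\<^sub>R exp (c * of_real r))"])
    show "integrable lborel (\<lambda>r. norm (indicator {0..} r *\<^sub>R exp (c * complex_of_real r)))" using i by (rule integrable_norm)
    show "AE r in lborel. (\<lambda>n. indicator {0..real n} r *\<^sub>R exp (c * of_real r)) \<longlonglongrightarrow> indicator {0..} r *\<^sub>R exp (c * of_real r)"
    proof (rule AE_I2)
      fix r :: real
      have "\<forall>\<^sub>F n in sequentially. r \<le> real n"
        using eventually_ge_at_top[of "nat \<lceil>r\<rceil>"] by eventually_elim linarith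
      then have "\<forall>\<^sub>F n in sequentially. indicator {0..real n} r *\<^sub>R exp (c * of_real r) = indicator {0..} r *\<^sub>R exp (c * of_real r)"
        by eventually_elim (auto split: split_indicator)
      then show "(\<lambda>n. indicator {0..real n} r *\<^sub>R exp (c * of_real r)) \<longlonglongrightarrow> indicator {0..} r *\<^sub>R exp (c * of_real r)"
        by (rule tendsto_eventually)
    qed
  qed (auto split: split_indicator)
  moreover have "(LINT r|lborel. indicator {0..real n} r *\<^sub>R exp (c * of_real r)) = exp (c * of_real (real n)) / c - exp (c * of_real 0) / c" for n
    by (rule has_bochner_integral_integral_eq, rule has_bochner_integral_FTC_Icc[OF _ F]) (auto intro!: continuous_intros)
  moreover have "(\<lambda>n. exp (c * of_real (real n)) / c - exp (c * of_real 0) / c) \<longlonglongrightarrow> 0 / c - exp (c * of_real 0) / c"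
  proof (intro tendsto_intros)
    have "filterlim (\<lambda>n. Re c * real n) at_bot sequentially"
      by (rule filterlim_tendsto_neg_mult_at_bot[OF tendsto_const c filterlim_real_sequentially])
    then have "(\<lambda>n. norm (exp (c * of_real (real n)))) \<longlonglongrightarrow> 0"
      using filterlim_compose[OF exp_at_bot] by (simp add: norm_exp_eq_Re)
    then show "(\<lambda>n. exp (c * of_real (real n))) \<longlonglongrightarrow> 0" by (rule tendsto_norm_zero_cancel)
  qed (use c in auto)
  ultimately show "(LINT r|lborel. indicator {0..} r *\<^sub>R exp (c * of_real r)) = - 1 / c"
    using LIMSEQ_unique by fastforce
qed

section \<open>The outgoing resolvent\<close>

text \<open>The fundamental solution of the Laplacian plus \<kappa>^2, decaying for Im \<kappa> > 0
  and outgoing for \<kappa> = k > 0. Division by zero gives the value 0 at the origin, so the bound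
  by 1 / (4 pi |x|) holds at every point.\<close>

definition helmholtz_kernel :: "complex \<Rightarrow> real ^ 3 \<Rightarrow> complex" where
  "helmholtz_kernel \<kappa> x = - exp (\<i> * \<kappa> * of_real (norm x)) / of_real (4 * pi * norm x)"

lemma borel_measurable_helmholtz_kernel [measurable (raw)]:
  assumes [measurable]: "g \<in> borel_measurable M" "f \<in> borel_measurable M"
  shows "(\<lambda>x. helmholtz_kernel (g x) (f x)) \<in> borel_measurable M"
  unfolding helmholtz_kernel_def by measurable

text \<open>Absorption, Im \<kappa> > 0, makes the kernel integrable. The radial formula turns its
  transform into two exponential integrals over the half-line with rates i (\<kappa> + s) and i
  (\<kappa> - s), which partial fractions combine into 1 / (\<kappa>^2 - s^2).\<close>

lemma
  assumes \<kappa>: "Im \<kappa> > 0"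
  shows integrable_helmholtz_kernel: "integrable lborel (helmholtz_kernel \<kappa>)"
    and fourier_helmholtz_kernel: "\<xi> \<noteq> 0 \<Longrightarrow> fourier (helmholtz_kernel \<kappa>) \<xi> = inverse (\<kappa>\<^sup>2 - of_real ((norm \<xi>)\<^sup>2))"
proof -
  let ?\<Phi> = "\<lambda>r. - exp (\<i> * \<kappa> * of_real r) / of_real (4 * pi * r)"
  have c: "Re (\<i> * (\<kappa> + of_real s)) < 0" for s using \<kappa> by simp
  \<comment> \<open>Half of the exponential decay pays for the factor r that is left over from r^2 /
    (4 pi r).\<close>
  have rexp: "r * exp (- Im \<kappa> * r) \<le> 2 / Im \<kappa> * exp (- (Im \<kappa> / 2) * r)" for r
  proof -
    have "Im \<kappa> / 2 * r \<le> exp (Im \<kappa> / 2 * r)" using exp_ge_add_one_self[of "Im \<kappa> / 2 * r"] by linarith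
    then have "r \<le> 2 / Im \<kappa> * exp (Im \<kappa> / 2 * r)" using \<kappa> by (simp add: field_simps)
    then have "r * exp (- Im \<kappa> * r) \<le> 2 / Im \<kappa> * exp (Im \<kappa> / 2 * r) * exp (- Im \<kappa> * r)" by (rule mult_right_mono) simp
    also have "\<dots> = 2 / Im \<kappa> * exp (- (Im \<kappa> / 2) * r)" by (simp add: mult.assoc exp_add[symmetric])
    finally show ?thesis .
  qed
  have int: "integrable lborel (\<lambda>r. indicator {0..} r *\<^sub>R (of_real (r\<^sup>2) * ?\<Phi> r))"
  proof (rule Bochner_Integration.integrable_bound)
    show "integrable lborel (\<lambda>r. (2 / Im \<kappa>) *\<^sub>R (indicator {0..} r *\<^sub>R exp (of_real (- (Im \<kappa> / 2)) * of_real r :: complex)))"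
      by (intro integrable_scaleR_right integrable_exp_half_line) (use \<kappa> in simp)
    show "AE r in lborel. norm (indicator {0..} r *\<^sub>R (of_real (r\<^sup>2) * ?\<Phi> r))
      \<le> norm ((2 / Im \<kappa>) *\<^sub>R (indicator {0..} r *\<^sub>R exp (of_real (- (Im \<kappa> / 2)) * of_real r :: complex)))"
    proof (rule AE_I2)
      fix r :: real
      show "norm (indicator {0..} r *\<^sub>R (of_real (r\<^sup>2) * ?\<Phi> r))
         \<le> norm ((2 / Im \<kappa>) *\<^sub>R (indicator {0..} r *\<^sub>R exp (of_real (- (Im \<kappa> / 2)) * of_real r :: complex)))"
      proof (cases "0 \<le> r")
        case True
        have "norm (of_real (r\<^sup>2) * ?\<Phi> r) = r * exp (- Im \<kappa> * r) * (1 / (4 * pi))"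
          using True by (simp add: norm_mult norm_divide norm_power power2_eq_square)
        also have "\<dots> \<le> r * exp (- Im \<kappa> * r) * 1"
          using True pi_gt3 by (intro mult_left_mono) (auto simp: field_simps)
        also have "\<dots> \<le> 2 / Im \<kappa> * exp (- (Im \<kappa> / 2) * r)" using rexp[of r] by simp
        finally show ?thesis using True \<kappa> by (simp add: norm_mult)
      qed auto
    qed
  qed measurable
  have eq: "helmholtz_kernel \<kappa> = (\<lambda>x. ?\<Phi> (norm x))" by (simp add: helmholtz_kernel_def fun_eq_iff)
  have m: "?\<Phi> \<in> borel_measurable borel" by measurable
  show "integrable lborel (helmholtz_kernel \<kappa>)" unfolding eq by (rule integrable_radial[OF m int])
  assume \<xi>: "\<xi> \<noteq> 0"
  define s where "s = norm \<xi>"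
  have s: "s > 0" using \<xi> by (simp add: s_def)
  have ne: "\<kappa> + of_real s \<noteq> 0" "\<kappa> - of_real s \<noteq> 0" using \<kappa> by (auto simp: complex_eq_iff)
  have "(LINT r|lborel. indicator {0..} r *\<^sub>R (of_real (r * sin (s * r)) * ?\<Phi> r))
    = (LINT r|lborel. (\<i> / of_real (8 * pi)) * (indicator {0..} r *\<^sub>R exp (\<i> * (\<kappa> + of_real s) * of_real r)
        - indicator {0..} r *\<^sub>R exp (\<i> * (\<kappa> + of_real (- s)) * of_real r)))"
  proof (rule integral_cong_AE)
    have "AE r in lborel. r \<noteq> (0::real)" by (rule AE_lborel_singleton)
    then show "AE r in lborel. indicator {0..} r *\<^sub>R (of_real (r * sin (s * r)) * ?\<Phi> r)
      = (\<i> / of_real (8 * pi)) * (indicator {0..} r *\<^sub>R exp (\<i> * (\<kappa> + of_real s) * of_real r)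
        - indicator {0..} r *\<^sub>R exp (\<i> * (\<kappa> + of_real (- s)) * of_real r))"
    proof eventually_elim
      case (elim r)
      define E where "E = exp (\<i> * of_real (s * r))"
      define E' where "E' = exp (- (\<i> * of_real (s * r)))"
      define P where "P = exp (\<i> * \<kappa> * of_real r)"
      have 1: "complex_of_real (sin (s * r)) = - (\<i> / 2) * (E - E')"
        unfolding E_def E'_def by (simp add: sin_of_real[symmetric] sin_exp_eq field_simps)
      have "exp (\<i> * (\<kappa> + of_real s) * of_real r) = P * E"
        "exp (\<i> * (\<kappa> + of_real (- s)) * of_real r) = P * E'"
        by (auto simp: E_def E'_def P_def exp_add[symmetric] algebra_simps)
      note 2 = this
      have "of_real (r * sin (s * r)) * (- P / of_real (4 * pi * r)) = (\<i> / of_real (8 * pi)) * (P * E - P * E')"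
        using elim unfolding of_real_mult[of r "sin (s * r)"] 1 by (simp add: field_simps)
      then show ?case unfolding 2 P_def[symmetric] by (auto split: split_indicator)
    qed
  qed auto
  also have "\<dots> = (\<i> / of_real (8 * pi)) * (- 1 / (\<i> * (\<kappa> + of_real s)) - - 1 / (\<i> * (\<kappa> + of_real (- s))))"
    unfolding integral_mult_right_zero
    by (subst Bochner_Integration.integral_diff[OF integrable_exp_half_line[OF c] integrable_exp_half_line[OF c]])
       (simp only: integral_exp_half_line[OF c])
  also have "\<dots> = of_real (s / (4 * pi)) * inverse (\<kappa>\<^sup>2 - of_real (s\<^sup>2))"
  proof -
    have "\<kappa>\<^sup>2 - of_real (s\<^sup>2) = (\<kappa> + of_real s) * (\<kappa> - of_real s)" by (simp add: power2_eq_square algebra_simps)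
    note fac = this
    have i: "- 1 / (\<i> * A) = \<i> / A" for A :: complex by (cases "A = 0") (auto simp: field_simps)
    have d: "\<i> / (\<kappa> + of_real s) - \<i> / (\<kappa> - of_real s) = \<i> * (- 2 * of_real s) / ((\<kappa> + of_real s) * (\<kappa> - of_real s))"
      using ne by (simp add: diff_frac_eq) (simp add: algebra_simps)
    have f: "(\<i> / of_real (8 * pi)) * (\<i> * (- 2 * of_real s) / X) = of_real (s / (4 * pi)) * inverse X" for X :: complex
      by (cases "X = 0") (auto simp: field_simps)
    have "- (1 :: complex) / (\<i> * (\<kappa> + of_real s)) - - 1 / (\<i> * (\<kappa> + of_real (- s)))
      = \<i> * (- 2 * of_real s) / ((\<kappa> + of_real s) * (\<kappa> - of_real s))"
      unfolding i d[symmetric] by simp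
    then show ?thesis unfolding fac f[symmetric] by (simp only:)
  qed
  finally show "fourier (helmholtz_kernel \<kappa>) \<xi> = inverse (\<kappa>\<^sup>2 - of_real ((norm \<xi>)\<^sup>2))"
    unfolding eq fourier_radial[OF m int \<xi>] using s by (simp add: s_def)
qed

section \<open>Uniqueness of tempered functions\<close>

lemma integral_translate:
  fixes f :: "'a::euclidean_space \<Rightarrow> complex"
  assumes [measurable]: "f \<in> borel_measurable borel"
  shows "(LINT x|lborel. f (a + x)) = (LINT x|lborel. f x)"
proof -
  have "(LINT x|lborel. f x) = integral\<^sup>L (distr lborel borel ((+) a)) f"
    by (simp add: lborel_distr_plus)
  then show ?thesis by (simp add: integral_distr)
qed

text \<open>Pairing with modulated Gaussians computes the Fourier transform of \<open>d\<close>
  times a Gaussian. As it vanishes, this product is zero almost everywhere, and the Gaussian has no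
  zeros.\<close>

lemma gaussian_tests_AE_zero:
  fixes d :: "'a::euclidean_space \<Rightarrow> complex"
  assumes "integrable lborel (\<lambda>x. d x * of_real (exp (- (norm x)\<^sup>2 / 2)))"
    and "\<And>b. (LINT x|lborel. d x * (cis (- (b \<bullet> x)) * of_real (exp (- (norm x)\<^sup>2 / 2)))) = 0"
  shows "AE x in lborel. d x = 0"
proof -
  have "AE x in lborel. d x * of_real (exp (- (norm x)\<^sup>2 / 2)) = 0"
  proof (rule fourier_zero_imp_AE_zero[OF assms(1)])
    fix \<xi>
    show "fourier (\<lambda>x. d x * of_real (exp (- (norm x)\<^sup>2 / 2))) \<xi> = 0"
      using assms(2)[of \<xi>] unfolding fourier_def by (simp only: mult_ac)
  qed
  then show ?thesis by simp
qed

text \<open>Translation by \<open>a\<close> completes the square and leaves a phase as the only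
  trace of the tilt. The factor \<open>cis (0 \<bullet> \<xi>)\<close> keeps the argument in the
  shape in which \<open>gaussian_schwartz\<close> applies to it.\<close>

lemma fourier_exp_gaussian:
  fixes a :: "'a::euclidean_space"
  shows "fourier (\<lambda>\<xi>. cis (0 \<bullet> \<xi>) * of_real (exp (a \<bullet> \<xi> - (norm \<xi>)\<^sup>2 / 2))) x
    = of_real (exp ((norm a)\<^sup>2 / 2) * sqrt (2 * pi) ^ DIM('a)) * (cis (- (a \<bullet> x)) * of_real (exp (- (norm x)\<^sup>2 / 2)))"
proof -
  let ?g = "\<lambda>\<xi>. cis (- (x \<bullet> \<xi>)) * of_real (exp (a \<bullet> \<xi> - (norm \<xi>)\<^sup>2 / 2))"
  have "fourier (\<lambda>\<xi>. cis (0 \<bullet> \<xi>) * of_real (exp (a \<bullet> \<xi> - (norm \<xi>)\<^sup>2 / 2))) x = (LINT \<xi>|lborel. ?g \<xi>)"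
    by (simp add: fourier_def)
  also have "\<dots> = (LINT \<eta>|lborel. ?g (a + \<eta>))" by (rule integral_translate[symmetric]) measurable
  also have "\<dots> = (LINT \<eta>|lborel. of_real (exp ((norm a)\<^sup>2 / 2)) * cis (- (a \<bullet> x)) * (cis ((- x) \<bullet> \<eta>) * of_real (exp (- (norm (1 *\<^sub>R \<eta>))\<^sup>2 / 2))))"
  proof (rule Bochner_Integration.integral_cong[OF refl])
    fix \<eta>
    have "a \<bullet> (a + \<eta>) - (norm (a + \<eta>))\<^sup>2 / 2 = (norm a)\<^sup>2 / 2 + - (norm \<eta>)\<^sup>2 / 2"
      by (simp add: power2_norm_eq_inner inner_add inner_commute field_simps)
    then have "exp (a \<bullet> (a + \<eta>) - (norm (a + \<eta>))\<^sup>2 / 2) = exp ((norm a)\<^sup>2 / 2) * exp (- (norm \<eta>)\<^sup>2 / 2)"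
      by (simp only: exp_add)
    moreover have "cis (- (x \<bullet> (a + \<eta>))) = cis (- (a \<bullet> x)) * cis ((- x) \<bullet> \<eta>)"
      by (simp add: cis_mult inner_add inner_commute)
    ultimately show "?g (a + \<eta>) = of_real (exp ((norm a)\<^sup>2 / 2)) * cis (- (a \<bullet> x)) * (cis ((- x) \<bullet> \<eta>) * of_real (exp (- (norm (1 *\<^sub>R \<eta>))\<^sup>2 / 2)))"
      by simp
  qed
  also have "\<dots> = of_real (exp ((norm a)\<^sup>2 / 2)) * cis (- (a \<bullet> x)) * of_real ((sqrt (2 * pi) / 1) ^ DIM('a) * exp (- (norm ((- x) /\<^sub>R 1))\<^sup>2 / 2))"
    unfolding integral_mult_right_zero by (subst integral_gaussian) auto
  finally show ?thesis by (simp add: mult_ac)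
qed

text \<open>The hypothesis controls pairings with transforms of Schwartz functions. Tilted Gaussians
  have modulated Gaussians as transforms, up to a nonzero constant, so enough tests are of this
  kind.\<close>

lemma tempered_function_unique:
  fixes u v :: "'a::euclidean_space \<Rightarrow> complex"
  assumes u: "tempered_function u" and v: "tempered_function v"
    and eq: "\<And>\<phi>. \<phi> \<in> schwartz \<Longrightarrow> dist_of u (fourier \<phi>) = dist_of v (fourier \<phi>)"
  shows "AE x in lborel. u x = v x"
proof -
  let ?G = "\<lambda>x::'a. complex_of_real (exp (- (norm x)\<^sup>2 / 2))"
  have g: "(\<lambda>x. cis (b \<bullet> x) * ?G x) \<in> schwartz" for b :: 'a
    using gaussian_schwartz[of b 0] by simp
  have i: "integrable lborel (\<lambda>x. w x * (cis (- (b \<bullet> x)) * ?G x))" if "tempered_function w" for w b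
    using that g[of "- b"] unfolding tempered_function_def by auto
  have "AE x in lborel. u x - v x = 0"
  proof (rule gaussian_tests_AE_zero)
    show "integrable lborel (\<lambda>x. (u x - v x) * ?G x)"
      using Bochner_Integration.integrable_diff[OF i[OF u, of 0] i[OF v, of 0]] by (simp add: left_diff_distrib)
    fix b :: 'a
    let ?c = "complex_of_real (exp ((norm b)\<^sup>2 / 2) * sqrt (2 * pi) ^ DIM('a))"
    have e: "dist_of w (fourier (\<lambda>\<xi>. cis (0 \<bullet> \<xi>) * of_real (exp (b \<bullet> \<xi> - (norm \<xi>)\<^sup>2 / 2))))
      = ?c * (LINT x|lborel. w x * (cis (- (b \<bullet> x)) * ?G x))" for w
      unfolding dist_of_def fourier_exp_gaussian mult.left_commute[of "w _" ?c] by (rule integral_mult_right_zero)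
    have c: "?c \<noteq> 0" by simp
    have "?c * (LINT x|lborel. u x * (cis (- (b \<bullet> x)) * ?G x)) = ?c * (LINT x|lborel. v x * (cis (- (b \<bullet> x)) * ?G x))"
      unfolding e[symmetric] by (rule eq[OF gaussian_schwartz])
    then have "(LINT x|lborel. u x * (cis (- (b \<bullet> x)) * ?G x)) = (LINT x|lborel. v x * (cis (- (b \<bullet> x)) * ?G x))"
      using c by (simp only: mult_cancel_left) simp
    then show "(LINT x|lborel. (u x - v x) * (cis (- (b \<bullet> x)) * ?G x)) = 0"
      using Bochner_Integration.integral_diff[OF i[OF u, of b] i[OF v, of b]] by (simp add: left_diff_distrib)
  qed
  then show ?thesis by simp
qed

text \<open>The integral is split at |x - y| = 1. Near y the bound B meets the integral of 1 / (4 pi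
  |z|) over the unit ball, which is 1 / 2; farther away 4 pi |x - y| >= 1, and the integral of
  |\<psi>| suffices.\<close>

lemma newton_potential_bound:
  fixes \<psi> :: "real ^ 3 \<Rightarrow> complex"
  assumes [measurable]: "\<psi> \<in> borel_measurable borel" and B: "\<And>x. norm (\<psi> x) \<le> B"
  shows "(\<integral>\<^sup>+ x. ennreal (norm (\<psi> x) / (4 * pi * norm (x - y))) \<partial>lborel)
    \<le> ennreal (B / 2) + (\<integral>\<^sup>+ x. ennreal (norm (\<psi> x)) \<partial>lborel)"
proof -
  have B0: "0 \<le> B" using B norm_ge_zero order_trans by blast
  let ?h = "\<lambda>r::real. ennreal (1 / (4 * pi * r)) * indicator {..1} r"
  have h: "(\<integral>\<^sup>+ x. ?h (norm (x - y)) \<partial>lborel) = ennreal (1 / 2)"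
  proof -
    have "(\<integral>\<^sup>+ x. ?h (norm (x - y)) \<partial>lborel) = (\<integral>\<^sup>+ x. ?h (norm x) \<partial>(lborel :: (real^3) measure))"
      using nn_integral_translate[of "\<lambda>x. ?h (norm x)" "- y"] by simp
    also have "\<dots> = (\<integral>\<^sup>+ r. ennreal (4 * pi * r\<^sup>2) * indicator {0..} r * ?h r \<partial>lborel)"
      by (rule nn_integral_radial) measurable
    also have "\<dots> = (\<integral>\<^sup>+ r. ennreal r * indicator {0..1} r \<partial>lborel)"
      by (intro nn_integral_cong)
         (auto simp: ennreal_mult[symmetric] power2_eq_square split: split_indicator)
    also have "\<dots> = ennreal (1\<^sup>2 / 2 - 0\<^sup>2 / 2)"
      by (rule nn_integral_FTC_Icc) (auto intro!: derivative_eq_intros)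
    finally show ?thesis by simp
  qed
  have "(\<integral>\<^sup>+ x. ennreal (norm (\<psi> x) / (4 * pi * norm (x - y))) \<partial>lborel)
    \<le> (\<integral>\<^sup>+ x. ennreal B * ?h (norm (x - y)) + ennreal (norm (\<psi> x)) \<partial>lborel)"
  proof (rule nn_integral_mono)
    fix x
    show "ennreal (norm (\<psi> x) / (4 * pi * norm (x - y))) \<le> ennreal B * ?h (norm (x - y)) + ennreal (norm (\<psi> x))"
    proof (cases "norm (x - y) \<le> 1")
      case True
      have "norm (\<psi> x) / (4 * pi * norm (x - y)) \<le> B * (1 / (4 * pi * norm (x - y)))"
        using B[of x] by (simp add: divide_right_mono)
      then have "ennreal (norm (\<psi> x) / (4 * pi * norm (x - y))) \<le> ennreal B * ?h (norm (x - y))"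
        using True B0 by (simp add: ennreal_mult[symmetric] ennreal_leI)
      then show ?thesis by (rule order_trans) simp
    next
      case False
      have "1 \<le> 4 * pi * norm (x - y)" using False pi_gt3 mult_mono[of 1 "4 * pi" 1 "norm (x - y)"] by simp
      then have "norm (\<psi> x) / (4 * pi * norm (x - y)) \<le> norm (\<psi> x) / 1"
        by (intro divide_left_mono) auto
      then show ?thesis using False by (simp add: ennreal_leI)
    qed
  qed
  also have "\<dots> = ennreal (B / 2) + (\<integral>\<^sup>+ x. ennreal (norm (\<psi> x)) \<partial>lborel)"
  proof -
    have "ennreal B * ennreal (1 / 2) = ennreal (B / 2)" using B0 by (subst ennreal_mult[symmetric]) auto
    then show ?thesis by (subst nn_integral_add, simp, simp, subst nn_integral_cmult, simp) (simp only: h)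
  qed
  finally show ?thesis .
qed

lemma norm_helmholtz_kernel_le:
  assumes "0 \<le> Im \<kappa>"
  shows "norm (helmholtz_kernel \<kappa> x) \<le> 1 / (4 * pi * norm x)"
proof -
  have "exp (- (Im \<kappa> * norm x)) \<le> 1" using assms by simp
  then show ?thesis by (simp add: helmholtz_kernel_def norm_divide norm_mult divide_right_mono)
qed

definition outgoing_potential :: "real \<Rightarrow> (real ^ 3 \<Rightarrow> complex) \<Rightarrow> real ^ 3 \<Rightarrow> complex" where
  "outgoing_potential k f x = (LINT y|lborel. helmholtz_kernel (of_real k) (x - y) * f y)"

section \<open>Pairings of Helmholtz potentials with bounded integrable functions\<close>

context
  fixes f \<psi> :: "real ^ 3 \<Rightarrow> complex" and B :: real
  assumes f: "integrable lborel f" and \<psi>: "integrable lborel \<psi>" and B: "\<And>x. norm (\<psi> x) \<le> B"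
begin

lemma newton_pair_measurable [measurable]: "f \<in> borel_measurable borel" "\<psi> \<in> borel_measurable borel"
  using f \<psi> by auto

text \<open>The Newton kernel dominates every Helmholtz kernel with Im \<kappa> >= 0. Being uniform
  in \<kappa>, the bound gives Fubini for each pairing and also the majorant for the limit in which
  \<kappa> tends to k.\<close>

lemma newton_pair_nn_le:
  "(\<integral>\<^sup>+ y. (\<integral>\<^sup>+ x. ennreal (norm (f y) * (norm (\<psi> x) / (4 * pi * norm (x - y)))) \<partial>lborel) \<partial>lborel)
    \<le> ennreal ((LINT y|lborel. norm (f y)) * (B / 2 + (LINT x|lborel. norm (\<psi> x))))"
proof -
  have B0: "0 \<le> B" using B norm_ge_zero order_trans by blast
  have nf: "(\<integral>\<^sup>+ y. ennreal (norm (f y)) \<partial>lborel) = ennreal (LINT y|lborel. norm (f y))"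
    using f by (intro nn_integral_eq_integral) auto
  have n\<psi>: "(\<integral>\<^sup>+ y. ennreal (norm (\<psi> y)) \<partial>lborel) = ennreal (LINT y|lborel. norm (\<psi> y))"
    using \<psi> by (intro nn_integral_eq_integral) auto
  have "(\<integral>\<^sup>+ y. (\<integral>\<^sup>+ x. ennreal (norm (f y) * (norm (\<psi> x) / (4 * pi * norm (x - y)))) \<partial>lborel) \<partial>lborel)
    = (\<integral>\<^sup>+ y. ennreal (norm (f y)) * (\<integral>\<^sup>+ x. ennreal (norm (\<psi> x) / (4 * pi * norm (x - y))) \<partial>lborel) \<partial>lborel)"
    by (intro nn_integral_cong, subst nn_integral_cmult[symmetric]) (auto intro!: nn_integral_cong simp: ennreal_mult[symmetric])
  also have "\<dots> \<le> (\<integral>\<^sup>+ y. ennreal (norm (f y)) * (ennreal (B / 2) + (\<integral>\<^sup>+ x. ennreal (norm (\<psi> x)) \<partial>lborel)) \<partial>lborel)"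
    by (intro nn_integral_mono mult_left_mono newton_potential_bound B) auto
  also have "\<dots> = (\<integral>\<^sup>+ y. ennreal (norm (f y)) \<partial>lborel) * (ennreal (B / 2) + (\<integral>\<^sup>+ x. ennreal (norm (\<psi> x)) \<partial>lborel))"
    by (rule nn_integral_multc) measurable
  also have "\<dots> = ennreal ((LINT y|lborel. norm (f y)) * (B / 2 + (LINT x|lborel. norm (\<psi> x))))"
    unfolding nf n\<psi> using B0 by (simp add: ennreal_mult)
  finally show ?thesis .
qed

lemma integrable_newton_pair:
  "integrable (lborel \<Otimes>\<^sub>M lborel) (\<lambda>(y, x). norm (f y) * (norm (\<psi> x) / (4 * pi * norm (x - y))))"
proof -
  have "integrable (lborel \<Otimes>\<^sub>M lborel) (\<lambda>(y, x). complex_of_real (norm (f y) * (norm (\<psi> x) / (4 * pi * norm (x - y)))))"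
  proof (rule integrable_pairI)
    have "(\<integral>\<^sup>+ y. (\<integral>\<^sup>+ x. ennreal (norm (complex_of_real (norm (f y) * (norm (\<psi> x) / (4 * pi * norm (x - y)))))) \<partial>lborel) \<partial>lborel)
     = (\<integral>\<^sup>+ y. (\<integral>\<^sup>+ x. ennreal (norm (f y) * (norm (\<psi> x) / (4 * pi * norm (x - y)))) \<partial>lborel) \<partial>lborel)"
      by (simp only: norm_of_real abs_of_nonneg mult_nonneg_nonneg divide_nonneg_nonneg norm_ge_zero pi_ge_zero zero_le_numeral)
    also have "\<dots> < \<infinity>" by (rule le_less_trans[OF newton_pair_nn_le]) simp
    finally show "(\<integral>\<^sup>+ y. (\<integral>\<^sup>+ x. ennreal (norm (complex_of_real (norm (f y) * (norm (\<psi> x) / (4 * pi * norm (x - y)))))) \<partial>lborel) \<partial>lborel) < \<infinity>" .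
  qed measurable
  from integrable_Re[OF this] show ?thesis by (simp add: split_def)
qed

lemma helmholtz_pair_le:
  assumes "0 \<le> Im \<kappa>"
  shows "norm (helmholtz_kernel \<kappa> (x - y) * (f y * \<psi> x)) \<le> norm (f y) * (norm (\<psi> x) / (4 * pi * norm (x - y)))"
proof -
  have "norm (helmholtz_kernel \<kappa> (x - y) * (f y * \<psi> x)) \<le> 1 / (4 * pi * norm (x - y)) * (norm (f y) * norm (\<psi> x))"
    unfolding norm_mult by (intro mult_right_mono norm_helmholtz_kernel_le assms) auto
  then show ?thesis by simp
qed

lemma integrable_helmholtz_pair:
  assumes "0 \<le> Im \<kappa>"
  shows "integrable (lborel \<Otimes>\<^sub>M lborel) (\<lambda>(y, x). helmholtz_kernel \<kappa> (x - y) * (f y * \<psi> x))"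
proof (rule Bochner_Integration.integrable_bound[OF integrable_newton_pair])
  show "AE p in lborel \<Otimes>\<^sub>M lborel. norm (case p of (y, x) \<Rightarrow> helmholtz_kernel \<kappa> (x - y) * (f y * \<psi> x))
    \<le> norm (case p of (y, x) \<Rightarrow> norm (f y) * (norm (\<psi> x) / (4 * pi * norm (x - y))))"
  proof (rule AE_I2)
    fix p :: "(real^3) \<times> (real^3)"
    obtain y x where p: "p = (y, x)" by force
    show "norm (case p of (y, x) \<Rightarrow> helmholtz_kernel \<kappa> (x - y) * (f y * \<psi> x))
    \<le> norm (case p of (y, x) \<Rightarrow> norm (f y) * (norm (\<psi> x) / (4 * pi * norm (x - y))))"
      using helmholtz_pair_le[OF assms, of x y] unfolding p by simp
  qed
qed measurable

lemma outgoing_potential_pairing: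
  shows "integrable lborel (\<lambda>x. outgoing_potential k f x * \<psi> x)"
    and "(LINT x|lborel. outgoing_potential k f x * \<psi> x)
      = integral\<^sup>L (lborel \<Otimes>\<^sub>M lborel) (\<lambda>(y, x). helmholtz_kernel (of_real k) (x - y) * (f y * \<psi> x))"
    and "norm (LINT x|lborel. outgoing_potential k f x * \<psi> x)
      \<le> (LINT y|lborel. norm (f y)) * (B / 2 + (LINT x|lborel. norm (\<psi> x)))"
proof -
  have B0: "0 \<le> B" using B norm_ge_zero order_trans by blast
  have i: "integrable (lborel \<Otimes>\<^sub>M lborel) (\<lambda>(y, x). helmholtz_kernel (of_real k) (x - y) * (f y * \<psi> x))"
    by (rule integrable_helmholtz_pair) simp
  have e: "(\<lambda>x. outgoing_potential k f x * \<psi> x) = (\<lambda>x. LINT y|lborel. helmholtz_kernel (of_real k) (x - y) * (f y * \<psi> x))"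
    by (simp add: outgoing_potential_def mult.assoc[symmetric])
  show "integrable lborel (\<lambda>x. outgoing_potential k f x * \<psi> x)"
    unfolding e by (rule lborel_pair.integrable_snd[OF i])
  show 2: "(LINT x|lborel. outgoing_potential k f x * \<psi> x)
      = integral\<^sup>L (lborel \<Otimes>\<^sub>M lborel) (\<lambda>(y, x). helmholtz_kernel (of_real k) (x - y) * (f y * \<psi> x))"
    unfolding e by (rule lborel_pair.integral_snd[OF i])
  let ?D = "\<lambda>(y, x). norm (f y) * (norm (\<psi> x) / (4 * pi * norm (x - y)))"
  have "norm (LINT x|lborel. outgoing_potential k f x * \<psi> x) \<le> integral\<^sup>L (lborel \<Otimes>\<^sub>M lborel) ?D"
    unfolding 2
  proof (rule order_trans[OF integral_norm_bound integral_mono[OF integrable_norm[OF i] integrable_newton_pair]])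
    fix p :: "(real^3) \<times> (real^3)"
    show "norm (case p of (y, x) \<Rightarrow> helmholtz_kernel (of_real k) (x - y) * (f y * \<psi> x)) \<le> ?D p"
      using helmholtz_pair_le[of "of_real k" "snd p" "fst p"] by (simp add: split_def)
  qed
  also have "\<dots> \<le> (LINT y|lborel. norm (f y)) * (B / 2 + (LINT x|lborel. norm (\<psi> x)))"
  proof (rule integral_real_bounded)
    have "(\<integral>\<^sup>+ p. ennreal (?D p) \<partial>(lborel \<Otimes>\<^sub>M lborel))
       = (\<integral>\<^sup>+ y. (\<integral>\<^sup>+ x. ennreal (norm (f y) * (norm (\<psi> x) / (4 * pi * norm (x - y)))) \<partial>lborel) \<partial>lborel)"
      by (subst lborel.nn_integral_fst[symmetric]) auto
    then show "(\<integral>\<^sup>+ p. ennreal (?D p) \<partial>(lborel \<Otimes>\<^sub>M lborel)) \<le> ennreal ((LINT y|lborel. norm (f y)) * (B / 2 + (LINT x|lborel. norm (\<psi> x))))"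
      using newton_pair_nn_le by simp
  qed (use B0 in \<open>auto intro!: mult_nonneg_nonneg add_nonneg_nonneg Bochner_Integration.integral_nonneg\<close>)
  finally show "norm (LINT x|lborel. outgoing_potential k f x * \<psi> x)
      \<le> (LINT y|lborel. norm (f y)) * (B / 2 + (LINT x|lborel. norm (\<psi> x)))" .
qed

end

lemma temperedI:
  assumes "\<And>f g. f \<in> schwartz \<Longrightarrow> g \<in> schwartz \<Longrightarrow> T (\<lambda>x. f x + g x) = T f + T g"
    and "\<And>c f. f \<in> schwartz \<Longrightarrow> T (\<lambda>x. c * f x) = c * T f"
    and "\<And>f. f \<in> schwartz \<Longrightarrow> norm (T f) \<le> C * schwartz_seminorm N f"
  shows "tempered T"
  using assms unfolding tempered_def by blast

lemma schwartz_le_seminorm: "f \<in> schwartz \<Longrightarrow> norm (f x) \<le> schwartz_seminorm N f"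
proof -
  assume f: "f \<in> schwartz"
  have "norm (f x) \<le> (1 + norm x) ^ N * norm (f x)" by (simp add: mult_le_cancel_right1 one_le_power)
  also have "\<dots> \<le> schwartz_seminorm N f" using schwartz_seminorm_bound[OF f, of "[]" N x] by simp
  finally show ?thesis .
qed

text \<open>The pairing with \<phi> is bounded through the supremum and the integral of |\<phi>|.
  The seminorm of order 4 controls both, since 4 exceeds the dimension.\<close>

lemma tempered_function_outgoing_potential:
  assumes f: "integrable lborel f"
  shows "tempered_function (outgoing_potential k f)"
  unfolding tempered_function_def
proof (intro conjI ballI)
  have [measurable]: "f \<in> borel_measurable borel" using f by auto
  show "outgoing_potential k f \<in> borel_measurable borel"
    unfolding outgoing_potential_def by measurable
  have i: "integrable lborel (\<lambda>x. outgoing_potential k f x * \<phi> x)" if "\<phi> \<in> schwartz" for \<phi>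
    using outgoing_potential_pairing(1)[OF f schwartz_integrable[OF that] schwartz_le_seminorm[OF that]] .
  show "integrable lborel (\<lambda>x. outgoing_potential k f x * \<phi> x)" if "\<phi> \<in> schwartz" for \<phi> by (rule i[OF that])
  obtain K where K: "\<And>\<phi>. \<phi> \<in> schwartz \<Longrightarrow> (LINT x|lborel. norm (\<phi> (x::real^3))) \<le> K * schwartz_seminorm 4 \<phi>"
  proof -
    have "\<exists>K\<ge>0. \<forall>f\<in>schwartz. \<forall>vs. set vs \<subseteq> Basis \<longrightarrow> length vs \<le> 4 \<longrightarrow> DIM(real^3) < 4 \<longrightarrow>
     integrable lborel (partials vs (f :: real^3 \<Rightarrow> complex)) \<and>
     (LINT x|lborel. norm (partials vs f x)) \<le> K * schwartz_seminorm 4 f" by (rule integral_partials_bound)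
    then show ?thesis using that by (fastforce dest: bspec spec[of _ "[]"])
  qed
  show "tempered (dist_of (outgoing_potential k f))"
  proof (rule temperedI)
    show "dist_of (outgoing_potential k f) (\<lambda>x. g x + h x) = dist_of (outgoing_potential k f) g + dist_of (outgoing_potential k f) h"
      if "g \<in> schwartz" "h \<in> schwartz" for g h
      unfolding dist_of_def distrib_left by (rule Bochner_Integration.integral_add[OF i[OF that(1)] i[OF that(2)]])
    show "dist_of (outgoing_potential k f) (\<lambda>x. c * g x) = c * dist_of (outgoing_potential k f) g" for c g
      unfolding dist_of_def mult.left_commute[of _ c] by (rule integral_mult_right_zero)
    fix \<phi> :: "real^3 \<Rightarrow> complex" assume \<phi>: "\<phi> \<in> schwartz"
    have "norm (dist_of (outgoing_potential k f) \<phi>) \<le> (LINT y|lborel. norm (f y)) * (schwartz_seminorm 4 \<phi> / 2 + (LINT x|lborel. norm (\<phi> x)))"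
      unfolding dist_of_def
      by (rule outgoing_potential_pairing(3)[OF f schwartz_integrable[OF \<phi>] schwartz_le_seminorm[OF \<phi>]])
    also have "\<dots> \<le> (LINT y|lborel. norm (f y)) * (schwartz_seminorm 4 \<phi> / 2 + K * schwartz_seminorm 4 \<phi>)"
      by (intro mult_left_mono add_left_mono K \<phi>) (auto intro: Bochner_Integration.integral_nonneg)
    also have "\<dots> = (LINT y|lborel. norm (f y)) * (1 / 2 + K) * schwartz_seminorm 4 \<phi>" by (simp add: algebra_simps)
    finally show "norm (dist_of (outgoing_potential k f) \<phi>) \<le> (LINT y|lborel. norm (f y)) * (1 / 2 + K) * schwartz_seminorm 4 \<phi>" .
  qed
qed

text \<open>The multiplier is the transform of the Helmholtz kernel away from the origin, hence
  almost everywhere. Inserting this and exchanging the integrals leaves an average of translates of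
  the transform of \<phi>.\<close>

lemma fourier_resolvent_multiplier:
  assumes \<kappa>: "0 < Im \<kappa>" and \<phi>: "\<phi> \<in> schwartz"
  shows "fourier (\<lambda>\<xi>. inverse (\<kappa>\<^sup>2 - of_real ((norm \<xi>)\<^sup>2)) * \<phi> \<xi>) y = (LINT x|lborel. helmholtz_kernel \<kappa> (x - y) * fourier \<phi> x)"
proof -
  let ?h = "helmholtz_kernel \<kappa>"
  have h: "integrable lborel ?h" using \<kappa> by (rule integrable_helmholtz_kernel)
  have p: "integrable lborel \<phi>" using \<phi> by (rule schwartz_integrable)
  have [measurable]: "\<phi> \<in> borel_measurable borel" using \<phi> by (rule schwartz_measurable)
  have "fourier (\<lambda>\<xi>. inverse (\<kappa>\<^sup>2 - of_real ((norm \<xi>)\<^sup>2)) * \<phi> \<xi>) y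
    = (LINT \<xi>|lborel. cis (- (y \<bullet> \<xi>)) * (fourier ?h \<xi> * \<phi> \<xi>))"
    unfolding fourier_def[of "\<lambda>\<xi>. inverse (\<kappa>\<^sup>2 - of_real ((norm \<xi>)\<^sup>2)) * \<phi> \<xi>"]
  proof (rule integral_cong_AE)
    show "AE \<xi> in lborel. cis (- (y \<bullet> \<xi>)) * (inverse (\<kappa>\<^sup>2 - of_real ((norm \<xi>)\<^sup>2)) * \<phi> \<xi>) = cis (- (y \<bullet> \<xi>)) * (fourier ?h \<xi> * \<phi> \<xi>)"
      using AE_lborel_singleton[of 0] by eventually_elim (simp add: fourier_helmholtz_kernel[OF \<kappa>])
  qed measurable
  also have "\<dots> = (LINT \<xi>|lborel. (LINT z|lborel. cis (- ((y + z) \<bullet> \<xi>)) * (\<phi> \<xi> * ?h z)))"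
  proof (rule Bochner_Integration.integral_cong[OF refl])
    fix \<xi>
    have "cis (- (y \<bullet> \<xi>)) * (fourier ?h \<xi> * \<phi> \<xi>) = (LINT z|lborel. (cis (- (y \<bullet> \<xi>)) * \<phi> \<xi>) * (cis (- (\<xi> \<bullet> z)) * ?h z))"
      unfolding integral_mult_right_zero fourier_def by (simp only: mult_ac)
    also have "\<dots> = (LINT z|lborel. cis (- ((y + z) \<bullet> \<xi>)) * (\<phi> \<xi> * ?h z))"
    proof (rule Bochner_Integration.integral_cong[OF refl])
      fix z
      have "cis (- ((y + z) \<bullet> \<xi>)) = cis (- (y \<bullet> \<xi>)) * cis (- (\<xi> \<bullet> z))"
        by (simp add: cis_mult inner_add_left inner_commute[of \<xi> z])
      then show "(cis (- (y \<bullet> \<xi>)) * \<phi> \<xi>) * (cis (- (\<xi> \<bullet> z)) * ?h z) = cis (- ((y + z) \<bullet> \<xi>)) * (\<phi> \<xi> * ?h z)"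
        by (simp only: mult_ac)
    qed
    finally show "cis (- (y \<bullet> \<xi>)) * (fourier ?h \<xi> * \<phi> \<xi>) = (LINT z|lborel. cis (- ((y + z) \<bullet> \<xi>)) * (\<phi> \<xi> * ?h z))" .
  qed
  also have "\<dots> = (LINT z|lborel. (LINT \<xi>|lborel. cis (- ((y + z) \<bullet> \<xi>)) * (\<phi> \<xi> * ?h z)))"
    by (rule integral_swap, rule integrable_pair_kernel[OF p h, where B=1]) auto
  also have "\<dots> = (LINT z|lborel. ?h z * fourier \<phi> (y + z))"
    unfolding fourier_def integral_mult_right_zero[symmetric] by (simp only: mult_ac)
  also have "\<dots> = (LINT z|lborel. ?h (y + z - y) * fourier \<phi> (y + z))" by simp
  also have "\<dots> = (LINT x|lborel. ?h (x - y) * fourier \<phi> x)"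
    by (rule integral_translate[where f="\<lambda>x. ?h (x - y) * fourier \<phi> x"]) measurable
  finally show ?thesis .
qed

text \<open>This is limiting absorption. If \<kappa> is a square root of k^2 + i \<epsilon>, the
  regularized multiplier is 1 / (\<kappa>^2 - |\<xi>|^2), so its action is a pairing with the kernel
  for \<kappa>. As \<epsilon> decreases to 0 these kernels converge to the one for k under the
  Newton majorant.\<close>

theorem outgoing_potential_is_resolvent:
  assumes k: "0 < k" and f: "integrable lborel f"
  shows "is_outgoing_resolvent k f (outgoing_potential k f)"
  unfolding is_outgoing_resolvent_def
proof (intro conjI ballI)
  show "tempered_function (outgoing_potential k f)" using f by (rule tempered_function_outgoing_potential)
  have [measurable]: "f \<in> borel_measurable borel" using f by auto
  fix \<phi> :: "real^3 \<Rightarrow> complex" assume \<phi>: "\<phi> \<in> schwartz"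
  have [measurable]: "\<phi> \<in> borel_measurable borel" using \<phi> by (rule schwartz_measurable)
  define \<psi> where "\<psi> = fourier \<phi>"
  have \<psi>: "integrable lborel \<psi>" unfolding \<psi>_def using \<phi> by (rule fourier_schwartz_integrable)
  have [measurable]: "\<psi> \<in> borel_measurable borel" unfolding \<psi>_def by measurable
  have B: "norm (\<psi> x) \<le> (LINT x|lborel. norm (\<phi> x))" for x unfolding \<psi>_def by (rule norm_fourier_le)
  let ?P = "\<lambda>\<kappa>. integral\<^sup>L (lborel \<Otimes>\<^sub>M lborel) (\<lambda>(y, x). helmholtz_kernel \<kappa> (x - y) * (f y * \<psi> x))"
  define \<kappa> where "\<kappa> \<epsilon> = csqrt (Complex (k\<^sup>2) \<epsilon>)" for \<epsilon>
  \<comment> \<open>The principal root has nonnegative real part, and 2 Re \<kappa> Im \<kappa> =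
    \<epsilon> > 0, so it lies in the upper half-plane. Its limit is k and not -k, which selects the
    outgoing wave.\<close>
  have \<kappa>: "0 < Im (\<kappa> \<epsilon>)" "(\<kappa> \<epsilon>)\<^sup>2 = Complex (k\<^sup>2) \<epsilon>" if "0 < \<epsilon>" for \<epsilon>
  proof -
    show sq: "(\<kappa> \<epsilon>)\<^sup>2 = Complex (k\<^sup>2) \<epsilon>" by (simp add: \<kappa>_def)
    have "0 \<le> Re (\<kappa> \<epsilon>)" unfolding \<kappa>_def by (rule Re_csqrt)
    moreover have "2 * Re (\<kappa> \<epsilon>) * Im (\<kappa> \<epsilon>) = \<epsilon>" using arg_cong[OF sq, of Im] by (simp add: power2_eq_square mult_ac)
    ultimately show "0 < Im (\<kappa> \<epsilon>)" using that mult_nonneg_nonpos[of "2 * Re (\<kappa> \<epsilon>)" "Im (\<kappa> \<epsilon>)"] by linarith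
  qed
  have lhs: "mult_dist (\<lambda>\<xi>. inverse (Complex (- (norm \<xi>)\<^sup>2 + k\<^sup>2) \<epsilon>)) (fourier_dist (dist_of f)) \<phi> = ?P (\<kappa> \<epsilon>)"
    if \<epsilon>: "0 < \<epsilon>" for \<epsilon>
  proof -
    have "Complex (- (norm \<xi>)\<^sup>2 + k\<^sup>2) \<epsilon> = (\<kappa> \<epsilon>)\<^sup>2 - of_real ((norm \<xi>)\<^sup>2)" for \<xi> :: "real^3"
      unfolding \<kappa>(2)[OF \<epsilon>] by (simp add: complex_eq_iff)
    then have "mult_dist (\<lambda>\<xi>. inverse (Complex (- (norm \<xi>)\<^sup>2 + k\<^sup>2) \<epsilon>)) (fourier_dist (dist_of f)) \<phi>
      = (LINT y|lborel. f y * (LINT x|lborel. helmholtz_kernel (\<kappa> \<epsilon>) (x - y) * \<psi> x))"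
      unfolding mult_dist_def fourier_dist_def dist_of_def \<psi>_def
      by (simp only: fourier_resolvent_multiplier[OF \<kappa>(1)[OF \<epsilon>] \<phi>])
    also have "\<dots> = (LINT y|lborel. (LINT x|lborel. helmholtz_kernel (\<kappa> \<epsilon>) (x - y) * (f y * \<psi> x)))"
      unfolding integral_mult_right_zero[symmetric] by (simp only: mult_ac)
    also have "\<dots> = ?P (\<kappa> \<epsilon>)"
      by (rule lborel_pair.integral_fst, rule integrable_helmholtz_pair[OF f \<psi> B]) (use \<kappa>[OF \<epsilon>] in auto)
    finally show ?thesis .
  qed
  have rhs: "fourier_dist (dist_of (outgoing_potential k f)) \<phi> = ?P (of_real k)"
    unfolding fourier_dist_def dist_of_def \<psi>_def[symmetric] by (rule outgoing_potential_pairing(2)[OF f \<psi> B])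
  show "((\<lambda>\<epsilon>. mult_dist (\<lambda>\<xi>. inverse (Complex (- (norm \<xi>)\<^sup>2 + k\<^sup>2) \<epsilon>)) (fourier_dist (dist_of f)) \<phi>)
          \<longlongrightarrow> fourier_dist (dist_of (outgoing_potential k f)) \<phi>) (at_right 0)"
    unfolding rhs
  proof (rule tendsto_at_right_sequentially[of 0 1])
    fix S :: "nat \<Rightarrow> real" assume S: "\<And>n. 0 < S n" "S \<longlonglongrightarrow> 0"
    have \<kappa>_lim: "(\<lambda>n. \<kappa> (S n)) \<longlonglongrightarrow> of_real k"
    proof -
      have "(\<lambda>n. of_real (k\<^sup>2) + \<i> * of_real (S n)) \<longlonglongrightarrow> of_real (k\<^sup>2) + \<i> * of_real 0"
        by (intro tendsto_intros S)
      then have "(\<lambda>n. Complex (k\<^sup>2) (S n)) \<longlonglongrightarrow> of_real (k\<^sup>2)" by (simp add: Complex_eq)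
      moreover have "isCont csqrt (of_real (k\<^sup>2))" using k by (intro continuous_at_csqrt) (auto simp: complex_nonpos_Reals_iff)
      ultimately have "(\<lambda>n. csqrt (Complex (k\<^sup>2) (S n))) \<longlonglongrightarrow> csqrt (of_real (k\<^sup>2))"
        by (rule isCont_tendsto_compose[rotated])
      then show ?thesis using k by (simp add: \<kappa>_def csqrt_of_real_nonneg)
    qed
    have "(\<lambda>n. ?P (\<kappa> (S n))) \<longlonglongrightarrow> ?P (of_real k)"
    proof (rule integral_dominated_convergence[OF _ _ integrable_newton_pair[OF f \<psi> B]])
      show "AE p in lborel \<Otimes>\<^sub>M lborel. (\<lambda>n. case p of (y, x) \<Rightarrow> helmholtz_kernel (\<kappa> (S n)) (x - y) * (f y * \<psi> x))
         \<longlonglongrightarrow> (case p of (y, x) \<Rightarrow> helmholtz_kernel (of_real k) (x - y) * (f y * \<psi> x))"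
      proof (rule AE_I2)
        fix p :: "(real^3) \<times> (real^3)"
        obtain y x where p: "p = (y, x)" by force
        have "(\<lambda>n. helmholtz_kernel (\<kappa> (S n)) (x - y)) \<longlonglongrightarrow> helmholtz_kernel (of_real k) (x - y)"
          unfolding helmholtz_kernel_def divide_inverse by (intro tendsto_intros \<kappa>_lim)
        then show "(\<lambda>n. case p of (y, x) \<Rightarrow> helmholtz_kernel (\<kappa> (S n)) (x - y) * (f y * \<psi> x))
         \<longlonglongrightarrow> (case p of (y, x) \<Rightarrow> helmholtz_kernel (of_real k) (x - y) * (f y * \<psi> x))"
          unfolding p by (simp only: prod.case) (intro tendsto_mult tendsto_const)
      qed
      show "AE p in lborel \<Otimes>\<^sub>M lborel. norm (case p of (y, x) \<Rightarrow> helmholtz_kernel (\<kappa> (S n)) (x - y) * (f y * \<psi> x))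
         \<le> (case p of (y, x) \<Rightarrow> norm (f y) * (norm (\<psi> x) / (4 * pi * norm (x - y))))" for n
        by (rule AE_I2) (use helmholtz_pair_le[OF f \<psi> B less_imp_le[OF \<kappa>(1)[OF S(1)[of n]]]] in auto)
    qed measurable
    then show "(\<lambda>n. mult_dist (\<lambda>\<xi>. inverse (Complex (- (norm \<xi>)\<^sup>2 + k\<^sup>2) (S n))) (fourier_dist (dist_of f)) \<phi>) \<longlonglongrightarrow> ?P (of_real k)"
      by (simp only: lhs[OF S(1)])
  qed simp
qed

text \<open>The choice in \<open>resolvent\<close> is determined almost everywhere: limits are
  unique, and tempered functions with equal pairings coincide off a null set. Measurability of the
  chosen representative is part of \<open>tempered_function\<close>.\<close>

lemma resolvent_AE_eq:
  fixes f :: "real ^ 3 \<Rightarrow> complex"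
  assumes k: "0 < k" and f: "integrable lborel f"
  shows "AE x in lborel. resolvent k f x = outgoing_potential k f x"
    and "resolvent k f \<in> borel_measurable borel"
proof -
  have o: "is_outgoing_resolvent k f (outgoing_potential k f)" using k f by (rule outgoing_potential_is_resolvent)
  then have r: "is_outgoing_resolvent k f (resolvent k f)" unfolding resolvent_def by (rule someI[where P="is_outgoing_resolvent k f"])
  show "resolvent k f \<in> borel_measurable borel"
    using r unfolding is_outgoing_resolvent_def tempered_function_def by blast
  show "AE x in lborel. resolvent k f x = outgoing_potential k f x"
  proof (rule tempered_function_unique)
    show "tempered_function (resolvent k f)" "tempered_function (outgoing_potential k f)"
      using r o unfolding is_outgoing_resolvent_def by blast+
    fix \<phi> :: "real^3 \<Rightarrow> complex" assume "\<phi> \<in> schwartz"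
    then have "fourier_dist (dist_of (resolvent k f)) \<phi> = fourier_dist (dist_of (outgoing_potential k f)) \<phi>"
      using r o unfolding is_outgoing_resolvent_def by (intro tendsto_unique[OF trivial_limit_at_right_real]) blast+
    then show "dist_of (resolvent k f) (fourier \<phi>) = dist_of (outgoing_potential k f) (fourier \<phi>)"
      by (simp add: fourier_dist_def)
  qed
qed

text \<open>Two bounds are added: the modulus of the integral is at most the length L, and |a| times
  it is at most 2 by the explicit antiderivative.\<close>

lemma norm_integral_cis_le:
  assumes L: "0 \<le> L"
  shows "norm (LINT r|lborel. indicator {0..L} r *\<^sub>R cis (a * r)) \<le> (L + 2) / (1 + \<bar>a\<bar>)"
proof -
  let ?E = "LINT r|lborel. indicator {0..L} r *\<^sub>R cis (a * r)"
  have 1: "norm ?E \<le> L"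
  proof -
    have "norm ?E \<le> (LINT r|lborel. norm (indicator {0..L} r *\<^sub>R cis (a * r)))" by (rule integral_norm_bound)
    also have "\<dots> = (LINT r|lborel. indicator {0..L} r)"
      by (intro Bochner_Integration.integral_cong refl) (auto split: split_indicator)
    finally show ?thesis using L by simp
  qed
  have 2: "\<bar>a\<bar> * norm ?E \<le> 2"
  proof (cases "a = 0")
    case False
    have F: "((\<lambda>r. cis (a * r) / (\<i> * of_real a)) has_vector_derivative cis (a * r)) (at r within S)" for r S
    proof -
      have "((\<lambda>w. exp (\<i> * (of_real a * w)) / (\<i> * of_real a)) has_field_derivative exp (\<i> * (of_real a * of_real r))) (at (of_real r))"
        using False by (auto intro!: derivative_eq_intros simp: field_simps)
      from has_vector_derivative_at_within[OF has_vector_derivative_real_field[OF this]] show ?thesis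
        by (simp add: cis_conv_exp)
    qed
    have "?E = cis (a * L) / (\<i> * of_real a) - cis (a * 0) / (\<i> * of_real a)"
      by (rule has_bochner_integral_integral_eq, rule has_bochner_integral_FTC_Icc[OF L F])
         (auto intro!: continuous_intros simp: cis_conv_exp)
    also have "\<dots> = (cis (a * L) - 1) / (\<i> * of_real a)" by (simp add: diff_divide_distrib)
    finally have "\<bar>a\<bar> * norm ?E = norm (cis (a * L) - 1)" using False by (simp add: norm_divide norm_mult)
    also have "\<dots> \<le> 2" using norm_triangle_ineq4[of "cis (a * L)" 1] by simp
    finally show ?thesis .
  qed simp
  have "norm ?E * (1 + \<bar>a\<bar>) \<le> L + 2" using 1 2 by (simp add: algebra_simps)
  then show ?thesis by (simp add: pos_le_divide_eq add_pos_nonneg)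
qed

section \<open>The truncated kernel\<close>

text \<open>Two points of a ball of radius R are at most 2 R apart, hence the later choice L = 2 R.
  A sharp cut suffices, since the oscillating integrals over [0, L] that it produces still decay
  like the inverse of the distance to the shell.\<close>

definition truncated_kernel :: "real \<Rightarrow> real \<Rightarrow> real ^ 3 \<Rightarrow> complex" where
  "truncated_kernel L k x = indicator {x. norm x \<le> L} x * helmholtz_kernel (of_real k) x"

lemma borel_measurable_truncated_kernel [measurable (raw)]:
  assumes [measurable]: "g \<in> borel_measurable M" "f \<in> borel_measurable M"
  shows "(\<lambda>x. truncated_kernel L (g x) (f x)) \<in> borel_measurable M"
  unfolding truncated_kernel_def by measurable

lemma
  assumes L: "0 \<le> L"
  shows integrable_truncated_kernel: "integrable lborel (truncated_kernel L k)"
    and fourier_truncated_kernel: "p \<noteq> 0 \<Longrightarrow> fourier (truncated_kernel L k) p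
      = - of_real (1 / norm p) * (LINT r|lborel. indicator {0..L} r *\<^sub>R (cis (k * r) * of_real (sin (norm p * r))))"
proof -
  let ?\<Phi> = "\<lambda>r. indicator {..L} r * (- exp (\<i> * of_real k * of_real r) / of_real (4 * pi * r))"
  have eq: "truncated_kernel L k = (\<lambda>x. ?\<Phi> (norm x))"
    by (auto simp: truncated_kernel_def helmholtz_kernel_def fun_eq_iff split: split_indicator)
  have m: "?\<Phi> \<in> borel_measurable borel" by measurable
  have int: "integrable lborel (\<lambda>r. indicator {0..} r *\<^sub>R (of_real (r\<^sup>2) * ?\<Phi> r))"
  proof (rule Bochner_Integration.integrable_bound)
    show "integrable lborel (\<lambda>r. L * indicator {0..L} r :: real)" using L by simp
    show "AE r in lborel. norm (indicator {0..} r *\<^sub>R (of_real (r\<^sup>2) * ?\<Phi> r)) \<le> norm (L * indicator {0..L} r :: real)"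
    proof (rule AE_I2)
      fix r :: real
      show "norm (indicator {0..} r *\<^sub>R (of_real (r\<^sup>2) * ?\<Phi> r)) \<le> norm (L * indicator {0..L} r :: real)"
      proof (cases "0 \<le> r \<and> r \<le> L")
        case True
        have "norm (of_real (r\<^sup>2) * ?\<Phi> r) = r * (1 / (4 * pi))"
          using True by (simp add: norm_mult norm_divide norm_power power2_eq_square)
        also have "\<dots> \<le> r * 1" using True pi_gt3 by (intro mult_left_mono) (auto simp: field_simps)
        also have "\<dots> \<le> L" using True by simp
        finally show ?thesis using True by simp
      qed (auto split: split_indicator)
    qed
  qed measurable
  show "integrable lborel (truncated_kernel L k)" unfolding eq by (rule integrable_radial[OF m int])
  assume p: "p \<noteq> 0"
  have "(LINT r|lborel. indicator {0..} r *\<^sub>R (of_real (r * sin (norm p * r)) * ?\<Phi> r))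
    = (LINT r|lborel. of_real (- 1 / (4 * pi)) * (indicator {0..L} r *\<^sub>R (cis (k * r) * of_real (sin (norm p * r)))))"
  proof (rule integral_cong_AE)
    have "AE r in lborel. r \<noteq> (0::real)" by (rule AE_lborel_singleton)
    then show "AE r in lborel. indicator {0..} r *\<^sub>R (of_real (r * sin (norm p * r)) * ?\<Phi> r)
      = of_real (- 1 / (4 * pi)) * (indicator {0..L} r *\<^sub>R (cis (k * r) * of_real (sin (norm p * r))))"
      by eventually_elim (auto simp: cis_conv_exp field_simps split: split_indicator)
  qed (auto simp: cis_conv_exp)
  then show "fourier (truncated_kernel L k) p
      = - of_real (1 / norm p) * (LINT r|lborel. indicator {0..L} r *\<^sub>R (cis (k * r) * of_real (sin (norm p * r))))"
    unfolding eq fourier_radial[OF m int p] integral_mult_right_zero using p by simp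
qed

text \<open>For |p| >= 1 the sine is split into exponentials with rates k + |p| and k - |p|; the
  second oscillates more slowly and gives the shell factor. For |p| < 1 the division by |p| has to
  be compensated: integrating by parts against cis (k r) gains 1 / k, and every remaining term
  carries a factor |p|.\<close>

lemma norm_fourier_truncated_kernel_le:
  assumes L: "0 \<le> L" and k: "1 \<le> k" and p: "p \<noteq> 0"
  shows "norm (fourier (truncated_kernel L k) p) \<le> 8 * (L + 2) * shell_weight k p"
proof -
  define s where "s = norm p"
  have s: "0 < s" using p by (simp add: s_def)
  define A where "A = (LINT r|lborel. indicator {0..L} r *\<^sub>R (cis (k * r) * of_real (sin (s * r))))"
  have nm: "norm (fourier (truncated_kernel L k) p) = norm A / s"
    unfolding fourier_truncated_kernel[OF L p] A_def s_def using p by (simp add: norm_mult norm_divide)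
  have W: "shell_weight k p = 1 / ((1 + s) * (1 + \<bar>s - k\<bar>))" by (simp add: shell_weight_def s_def)
  have icis: "integrable lborel (\<lambda>r. indicator {0..L} r *\<^sub>R cis (a * r))" for a :: real
    by (rule borel_integrable_compact[unfolded set_integrable_def]) (auto intro!: continuous_intros simp: cis_conv_exp)
  show ?thesis
  proof (cases "1 \<le> s")
    case True
    have "A = (LINT r|lborel. (- (\<i> / 2)) * (indicator {0..L} r *\<^sub>R cis ((k + s) * r) - indicator {0..L} r *\<^sub>R cis ((k - s) * r)))"
      unfolding A_def
    proof (rule Bochner_Integration.integral_cong[OF refl])
      fix r :: real
      have "cis (k * r) * of_real (sin (s * r)) = (- (\<i> / 2)) * (cis ((k + s) * r) - cis ((k - s) * r))"
        unfolding distrib_right left_diff_distrib by (simp add: complex_eq_iff cos_add cos_diff sin_add sin_diff field_simps)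
      then show "indicator {0..L} r *\<^sub>R (cis (k * r) * of_real (sin (s * r)))
        = (- (\<i> / 2)) * (indicator {0..L} r *\<^sub>R cis ((k + s) * r) - indicator {0..L} r *\<^sub>R cis ((k - s) * r))"
        by (auto split: split_indicator)
    qed
    also have "\<dots> = (- (\<i> / 2)) * ((LINT r|lborel. indicator {0..L} r *\<^sub>R cis ((k + s) * r)) - (LINT r|lborel. indicator {0..L} r *\<^sub>R cis ((k - s) * r)))"
      unfolding integral_mult_right_zero by (subst Bochner_Integration.integral_diff[OF icis icis]) simp
    finally have "norm A = 1 / 2 * norm ((LINT r|lborel. indicator {0..L} r *\<^sub>R cis ((k + s) * r)) - (LINT r|lborel. indicator {0..L} r *\<^sub>R cis ((k - s) * r)))"
      by (simp add: norm_mult norm_divide)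
    also have "\<dots> \<le> 1 / 2 * ((L + 2) / (1 + \<bar>k + s\<bar>) + (L + 2) / (1 + \<bar>k - s\<bar>))"
      by (intro mult_left_mono order_trans[OF norm_triangle_ineq4] add_mono norm_integral_cis_le L) auto
    also have "(L + 2) / (1 + \<bar>k + s\<bar>) \<le> (L + 2) / (1 + \<bar>k - s\<bar>)"
      using L k s by (intro divide_left_mono) auto
    finally have "norm A \<le> 1 / 2 * ((L + 2) / (1 + \<bar>k - s\<bar>) + (L + 2) / (1 + \<bar>k - s\<bar>))" by simp
    moreover have "1 / 2 * (X + X) = X" for X :: real by simp
    ultimately have A: "norm A \<le> (L + 2) / (1 + \<bar>s - k\<bar>)" by (simp only: abs_minus_commute)
    have "norm A / s \<le> ((L + 2) / (1 + \<bar>s - k\<bar>)) * (2 / (1 + s))"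
    proof -
      have "norm A * (1 / s) \<le> ((L + 2) / (1 + \<bar>s - k\<bar>)) * (2 / (1 + s))"
        using A L True by (intro mult_mono) (auto simp: field_simps)
      then show ?thesis by simp
    qed
    also have "\<dots> = 2 * (L + 2) * shell_weight k p" unfolding W by (simp add: mult_ac)
    also have "\<dots> \<le> 8 * (L + 2) * shell_weight k p"
      using L shell_weight_pos[of k p] by (intro mult_right_mono) auto
    finally show ?thesis unfolding nm .
  next
    case False
    have ik: "\<i> * complex_of_real k \<noteq> 0" using k by simp
    let ?F = "\<lambda>r. cis (k * r) * of_real (sin (s * r)) / (\<i> * of_real k)"
    let ?f = "\<lambda>r. cis (k * r) * of_real (sin (s * r)) + of_real s / (\<i> * of_real k) * (cis (k * r) * of_real (cos (s * r)))"
    have F: "(?F has_vector_derivative ?f r) (at r within S)" for r S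
    proof -
      have "((\<lambda>w. exp (\<i> * (of_real k * w)) * sin (of_real s * w) / (\<i> * of_real k)) has_field_derivative
        (exp (\<i> * (of_real k * of_real r)) * sin (of_real s * of_real r)
          + of_real s / (\<i> * of_real k) * (exp (\<i> * (of_real k * of_real r)) * cos (of_real s * of_real r)))) (at (of_real r))"
        using ik by (auto intro!: derivative_eq_intros simp: field_simps)
      from has_vector_derivative_at_within[OF has_vector_derivative_real_field[OF this]] show ?thesis
        by (simp add: cis_conv_exp sin_of_real cos_of_real flip: of_real_mult)
    qed
    have i1: "integrable lborel (\<lambda>r. indicator {0..L} r *\<^sub>R (cis (k * r) * of_real (sin (s * r))))"
      by (rule borel_integrable_compact[unfolded set_integrable_def]) (auto intro!: continuous_intros simp: cis_conv_exp)
    have i2: "integrable lborel (\<lambda>r. indicator {0..L} r *\<^sub>R (cis (k * r) * of_real (cos (s * r))))"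
      by (rule borel_integrable_compact[unfolded set_integrable_def]) (auto intro!: continuous_intros simp: cis_conv_exp)
    define B where "B = (LINT r|lborel. indicator {0..L} r *\<^sub>R (cis (k * r) * of_real (cos (s * r))))"
    have "(LINT r|lborel. indicator {0..L} r *\<^sub>R ?f r) = ?F L - ?F 0"
      by (rule has_bochner_integral_integral_eq, rule has_bochner_integral_FTC_Icc[OF L F])
         (use k in \<open>auto intro!: continuous_intros simp: cis_conv_exp\<close>)
    moreover have "(LINT r|lborel. indicator {0..L} r *\<^sub>R ?f r) = A + of_real s / (\<i> * of_real k) * B"
    proof -
      have "(\<lambda>r. indicator {0..L} r *\<^sub>R ?f r) = (\<lambda>r. indicator {0..L} r *\<^sub>R (cis (k * r) * of_real (sin (s * r)))
         + of_real s / (\<i> * of_real k) * (indicator {0..L} r *\<^sub>R (cis (k * r) * of_real (cos (s * r)))))"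
        by (auto split: split_indicator)
      then show ?thesis unfolding A_def B_def
        by (simp only: Bochner_Integration.integral_add[OF i1 integrable_mult_right[OF i2]] integral_mult_right_zero)
    qed
    ultimately have "A = ?F L - of_real s / (\<i> * of_real k) * B" by (simp add: algebra_simps)
    then have "norm A \<le> norm (?F L) + norm (of_real s / (\<i> * of_real k) * B)"
      using norm_triangle_ineq4 by metis
    also have "norm (?F L) \<le> s * L / k"
    proof -
      have "\<bar>sin (s * L)\<bar> \<le> s * L" using abs_sin_x_le_abs_x[of "s * L"] s L by simp
      then show ?thesis using k by (simp add: norm_mult norm_divide divide_right_mono)
    qed
    also have "norm (of_real s / (\<i> * of_real k) * B) \<le> s / k * L"
    proof -
      have "norm B \<le> (LINT r|lborel. norm (indicator {0..L} r *\<^sub>R (cis (k * r) * of_real (cos (s * r)))))"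
        unfolding B_def by (rule integral_norm_bound)
      also have "\<dots> \<le> (LINT r|lborel. indicator {0..L} r)"
      proof (rule integral_mono[OF integrable_norm[OF i2]])
        show "integrable lborel (indicator {0..L} :: real \<Rightarrow> real)" by (intro integrable_real_indicator) (use L in auto)
      qed (auto simp: norm_mult split: split_indicator)
      finally have "norm B \<le> L" using L by simp
      then show ?thesis using s k by (simp add: norm_mult norm_divide mult_left_mono divide_right_mono)
    qed
    finally have "norm A \<le> s * L / k + s / k * L" by simp
    then have "norm A / s \<le> (s * L / k + s / k * L) / s" by (rule divide_right_mono) (use s in simp)
    also have "\<dots> = 2 * L * (1 / k)" using s by (simp add: field_simps)
    also have "\<dots> \<le> 2 * L * (4 * shell_weight k p)"
    proof -
      have "(1 + s) * (1 + \<bar>s - k\<bar>) \<le> 2 * (1 + k)" using False s k by (intro mult_mono) auto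
      also have "\<dots> \<le> 4 * k" using k by simp
      finally have "1 / (4 * k) \<le> shell_weight k p"
        unfolding W using s k by (intro divide_left_mono mult_pos_pos) (auto intro: add_pos_nonneg)
      then have "1 / k \<le> 4 * shell_weight k p" using k by (simp add: field_simps)
      then show ?thesis using L by (intro mult_left_mono) auto
    qed
    also have "\<dots> \<le> 8 * (L + 2) * shell_weight k p"
      using L shell_weight_pos[of k p] by (simp add: mult_right_mono)
    finally show ?thesis unfolding nm .
  qed
qed

text \<open>From 1 + s <= (1 + k) (1 + |s - k|) the weight is at most (1 + k) / (1 + s)^2, whose
  square decays with exponent 4 > 3. The bound grows with k; it serves to make the momentum
  integrals converge, not to estimate them.\<close>

lemma nn_integral_shell_weight_sq_finite:
  assumes k: "0 \<le> k"
  shows "(\<integral>\<^sup>+ p. (ennreal (shell_weight k (p :: real ^ 3)))\<^sup>2 \<partial>lborel) < \<infinity>"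
proof -
  have le: "(shell_weight k p)\<^sup>2 \<le> (1 + k)\<^sup>2 * (1 + norm p) powr (- 4)" for p :: "real^3"
  proof -
    define s where "s = norm p"
    have s: "0 \<le> s" by (simp add: s_def)
    have "1 + s \<le> (1 + \<bar>s - k\<bar>) + k" by linarith
    also have "\<dots> \<le> (1 + k) * (1 + \<bar>s - k\<bar>)" using k by (simp add: algebra_simps)
    finally have 1: "1 + s \<le> (1 + k) * (1 + \<bar>s - k\<bar>)" .
    have "shell_weight k p \<le> (1 + k) / (1 + s)\<^sup>2"
    proof -
      have "(1 + s)\<^sup>2 \<le> (1 + s) * ((1 + k) * (1 + \<bar>s - k\<bar>))"
        unfolding power2_eq_square using s by (intro mult_left_mono 1) auto
      then show ?thesis unfolding shell_weight_def s_def[symmetric] using s k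
        by (simp add: divide_simps add_pos_nonneg) (simp add: mult_ac add_pos_nonneg zero_less_mult_iff)
    qed
    then have "(shell_weight k p)\<^sup>2 \<le> ((1 + k) / (1 + s)\<^sup>2)\<^sup>2"
      using shell_weight_pos[of k p] by (intro power_mono) auto
    also have "\<dots> = (1 + k)\<^sup>2 * (1 + s) powr (- real 4)"
      using s by (subst powr_minus, subst powr_realpow) (auto simp: divide_inverse power_mult_distrib power_inverse simp flip: power_mult)
    finally show ?thesis by (simp add: s_def)
  qed
  have i: "integrable lborel (\<lambda>p::real^3. (1 + k)\<^sup>2 * (1 + norm p) powr (- 4))"
    by (intro integrable_mult_right integrable_one_plus_norm_powr) simp
  have "(\<integral>\<^sup>+ p. (ennreal (shell_weight k (p :: real ^ 3)))\<^sup>2 \<partial>lborel) \<le> (\<integral>\<^sup>+ p. ennreal ((1 + k)\<^sup>2 * (1 + norm (p :: real^3)) powr (- 4)) \<partial>lborel)"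
    by (intro nn_integral_mono) (auto simp: ennreal_power less_imp_le[OF shell_weight_pos] intro!: ennreal_leI le)
  also have "\<dots> < \<infinity>" using i by (subst nn_integral_eq_integral) auto
  finally show ?thesis .
qed

section \<open>Convolutions and one step of the Born iteration\<close>

lemma norm_integral_le_nn_integral:
  fixes h :: "'a \<Rightarrow> complex"
  shows "ennreal (norm (integral\<^sup>L M h)) \<le> (\<integral>\<^sup>+ x. ennreal (norm (h x)) \<partial>M)"
proof (cases "integrable M h")
  case True
  have "ennreal (norm (integral\<^sup>L M h)) \<le> ennreal (LINT x|M. norm (h x))"
    by (intro ennreal_leI integral_norm_bound)
  also have "\<dots> = (\<integral>\<^sup>+ x. ennreal (norm (h x)) \<partial>M)"
    using True by (intro nn_integral_eq_integral[symmetric]) auto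
  finally show ?thesis .
qed (simp add: not_integrable_integral_eq)

lemma
  fixes f G :: "'a::euclidean_space \<Rightarrow> complex"
  assumes f: "integrable lborel f" and G: "integrable lborel G"
  shows integrable_convolution: "integrable lborel (\<lambda>x. LINT y|lborel. G (x - y) * f y)"
    and fourier_convolution: "fourier (\<lambda>x. LINT y|lborel. G (x - y) * f y) p = fourier G p * fourier f p"
proof -
  have [measurable]: "f \<in> borel_measurable borel" "G \<in> borel_measurable borel" using f G by auto
  have fin: "(\<integral>\<^sup>+ y. (\<integral>\<^sup>+ x. ennreal (norm (c x * (G (x - y) * f y))) \<partial>lborel) \<partial>lborel) < \<infinity>"
    if c: "\<And>x. norm (c x) = 1" for c :: "'a \<Rightarrow> complex"
  proof -
    have "(\<integral>\<^sup>+ y. (\<integral>\<^sup>+ x. ennreal (norm (c x * (G (x - y) * f y))) \<partial>lborel) \<partial>lborel)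
      = (\<integral>\<^sup>+ y. (\<integral>\<^sup>+ x. ennreal (norm (G x)) \<partial>lborel) * ennreal (norm (f y)) \<partial>lborel)"
    proof (rule nn_integral_cong)
      fix y
      have "(\<integral>\<^sup>+ x. ennreal (norm (c x * (G (x - y) * f y))) \<partial>lborel) = (\<integral>\<^sup>+ x. ennreal (norm (G (- y + x))) * ennreal (norm (f y)) \<partial>lborel)"
        by (intro nn_integral_cong) (simp add: norm_mult c ennreal_mult)
      also have "\<dots> = (\<integral>\<^sup>+ x. ennreal (norm (G (- y + x))) \<partial>lborel) * ennreal (norm (f y))"
        by (rule nn_integral_multc) measurable
      also have "(\<integral>\<^sup>+ x. ennreal (norm (G (- y + x))) \<partial>lborel) = (\<integral>\<^sup>+ x. ennreal (norm (G x)) \<partial>lborel)"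
        by (rule nn_integral_translate) measurable
      finally show "(\<integral>\<^sup>+ x. ennreal (norm (c x * (G (x - y) * f y))) \<partial>lborel) = (\<integral>\<^sup>+ x. ennreal (norm (G x)) \<partial>lborel) * ennreal (norm (f y))" .
    qed
    also have "\<dots> = (\<integral>\<^sup>+ x. ennreal (norm (G x)) \<partial>lborel) * (\<integral>\<^sup>+ y. ennreal (norm (f y)) \<partial>lborel)"
      by (rule nn_integral_cmult) measurable
    also have "\<dots> < \<infinity>" using f G by (auto simp: integrable_iff_bounded ennreal_mult_less_top)
    finally show ?thesis .
  qed
  have i: "integrable (lborel \<Otimes>\<^sub>M lborel) (\<lambda>(y, x). c x * (G (x - y) * f y))"
    if [measurable]: "c \<in> borel_measurable borel" and c: "\<And>x. norm (c x) = 1" for c :: "'a \<Rightarrow> complex"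
    by (rule integrable_pairI) (use fin[OF c] in measurable)
  show "integrable lborel (\<lambda>x. LINT y|lborel. G (x - y) * f y)"
    using lborel_pair.integrable_snd[OF i[of "\<lambda>_. 1"]] by simp
  have "fourier (\<lambda>x. LINT y|lborel. G (x - y) * f y) p
    = (LINT x|lborel. (LINT y|lborel. cis (- (p \<bullet> x)) * (G (x - y) * f y)))"
    by (simp add: fourier_def)
  also have "\<dots> = (LINT y|lborel. (LINT x|lborel. cis (- (p \<bullet> x)) * (G (x - y) * f y)))"
    by (rule integral_swap[symmetric], rule i) auto
  also have "\<dots> = (LINT y|lborel. fourier G p * (cis (- (p \<bullet> y)) * f y))"
  proof (rule Bochner_Integration.integral_cong[OF refl])
    fix y
    have "(LINT x|lborel. cis (- (p \<bullet> x)) * (G (x - y) * f y)) = (LINT x|lborel. cis (- (p \<bullet> (y + x))) * (G (y + x - y) * f y))"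
      by (rule integral_translate[symmetric]) measurable
    also have "\<dots> = (LINT x|lborel. (cis (- (p \<bullet> x)) * G x) * (cis (- (p \<bullet> y)) * f y))"
    proof (rule Bochner_Integration.integral_cong[OF refl])
      fix x
      have "cis (- (p \<bullet> (y + x))) = cis (- (p \<bullet> y)) * cis (- (p \<bullet> x))" by (simp add: cis_mult inner_add_right)
      then show "cis (- (p \<bullet> (y + x))) * (G (y + x - y) * f y) = (cis (- (p \<bullet> x)) * G x) * (cis (- (p \<bullet> y)) * f y)"
        by simp
    qed
    also have "\<dots> = fourier G p * (cis (- (p \<bullet> y)) * f y)"
      unfolding integral_mult_left_zero fourier_def ..
    finally show "(LINT x|lborel. cis (- (p \<bullet> x)) * (G (x - y) * f y)) = fourier G p * (cis (- (p \<bullet> y)) * f y)" .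
  qed
  also have "\<dots> = fourier G p * fourier f p" unfolding integral_mult_right_zero by (simp add: fourier_def)
  finally show "fourier (\<lambda>x. LINT y|lborel. G (x - y) * f y) p = fourier G p * fourier f p" .
qed

lemma outgoing_potential_eq_truncated:
  assumes supp: "AE y in lborel. R < norm y \<longrightarrow> f y = 0" and [measurable]: "f \<in> borel_measurable borel"
    and x: "norm x \<le> R"
  shows "outgoing_potential k f x = (LINT y|lborel. truncated_kernel (2 * R) k (x - y) * f y)"
  unfolding outgoing_potential_def
proof (rule integral_cong_AE)
  show "AE y in lborel. helmholtz_kernel (of_real k) (x - y) * f y = truncated_kernel (2 * R) k (x - y) * f y"
    using supp
  proof eventually_elim
    case (elim y)
    show ?case
    proof (cases "R < norm y")
      case False
      then have "norm (x - y) \<le> 2 * R" using norm_triangle_ineq4[of x y] x by linarith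
      then show ?thesis by (simp add: truncated_kernel_def)
    qed (use elim in simp)
  qed
qed measurable

text \<open>On the ball that carries q the resolvent agrees with the convolution with the truncated
  kernel, whose transform is a product. Assumption \<open>int\<close> makes this product integrable,
  so inversion writes the convolution as an absolutely convergent superposition of plane waves, and
  multiplying q by a plane wave translates its transform.\<close>

lemma born_step:
  fixes f q :: "real ^ 3 \<Rightarrow> complex"
  assumes k: "0 < k" and R: "0 \<le> R"
    and q: "integrable lborel q" "AE x in lborel. R < norm x \<longrightarrow> q x = 0"
    and f: "integrable lborel f" "AE x in lborel. R < norm x \<longrightarrow> f x = 0"
    and int: "integrable lborel (\<lambda>p. fourier (truncated_kernel (2 * R) k) p * fourier f p)"
  shows "integrable lborel (\<lambda>x. q x * resolvent k f x)"
    and "AE x in lborel. R < norm x \<longrightarrow> q x * resolvent k f x = 0"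
    and "fourier (\<lambda>x. q x * resolvent k f x) p
      = of_real (1 / (2 * pi) ^ 3) * (LINT p'|lborel. fourier q (p - p') * (fourier (truncated_kernel (2 * R) k) p' * fourier f p'))"
proof -
  let ?m = "fourier (truncated_kernel (2 * R) k)"
  let ?h = "\<lambda>p. ?m p * fourier f p"
  have [measurable]: "q \<in> borel_measurable borel" "f \<in> borel_measurable borel" using q f by auto
  have [measurable]: "resolvent k f \<in> borel_measurable borel" by (rule resolvent_AE_eq(2)[OF k f(1)])
  let ?v = "\<lambda>x. LINT y|lborel. truncated_kernel (2 * R) k (x - y) * f y"
  have G: "integrable lborel (truncated_kernel (2 * R) k)" using R by (intro integrable_truncated_kernel) simp
  have vi: "integrable lborel ?v" by (rule integrable_convolution[OF f(1) G])
  have vf: "fourier ?v = ?h" by (rule ext) (rule fourier_convolution[OF f(1) G])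
  have v: "AE x in lborel. ?v x = inv_fourier ?h x"
    using fourier_inversion[OF vi] int unfolding vf by simp
  define w where "w x = (LINT p|lborel. cis (x \<bullet> p) * ?h p)" for x
  have [measurable]: "w \<in> borel_measurable borel" unfolding w_def by measurable
  \<comment> \<open>Outside the ball both sides vanish with q, whatever the potential without
    truncation does there.\<close>
  have eq: "AE x in lborel. q x * resolvent k f x = of_real (1 / (2 * pi) ^ 3) * (q x * w x)"
    using q(2) v resolvent_AE_eq(1)[OF k f(1)]
  proof eventually_elim
    case (elim x)
    show ?case
    proof (cases "R < norm x")
      case False
      then have "resolvent k f x = inv_fourier ?h x"
        using elim outgoing_potential_eq_truncated[OF f(2), of x k] by simp
      then show ?thesis by (simp add: inv_fourier_def w_def inner_commute)
    qed (use elim in simp)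
  qed
  have qw: "integrable lborel (\<lambda>x. q x * w x)"
  proof (rule Bochner_Integration.integrable_bound)
    show "integrable lborel (\<lambda>x. of_real (LINT p|lborel. norm (?h p)) * q x)" using q(1) by (rule integrable_mult_right)
    show "AE x in lborel. norm (q x * w x) \<le> norm (of_real (LINT p|lborel. norm (?h p)) * q x)"
    proof (rule AE_I2)
      fix x
      have "norm (w x) \<le> (LINT p|lborel. norm (cis (x \<bullet> p) * ?h p))" unfolding w_def by (rule integral_norm_bound)
      also have "\<dots> = (LINT p|lborel. norm (?h p))" by (simp add: norm_mult)
      also have "\<dots> \<le> \<bar>LINT p|lborel. norm (?h p)\<bar>" by simp
      finally show "norm (q x * w x) \<le> norm (of_real (LINT p|lborel. norm (?h p)) * q x)"
        unfolding norm_mult norm_of_real mult.commute[of "norm (q x)"] by (rule mult_right_mono) simp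
    qed
  qed measurable
  show "integrable lborel (\<lambda>x. q x * resolvent k f x)"
    by (subst integrable_cong_AE[OF _ _ eq], measurable) (rule integrable_mult_right[OF qw])
  show "AE x in lborel. R < norm x \<longrightarrow> q x * resolvent k f x = 0"
    using q(2) by eventually_elim auto
  have "fourier (\<lambda>x. q x * resolvent k f x) p = (LINT x|lborel. of_real (1 / (2 * pi) ^ 3) * (cis (- (p \<bullet> x)) * (q x * w x)))"
    unfolding fourier_def
    by (rule integral_cong_AE) (use eq in \<open>auto elim: eventually_mono\<close>)
  also have "\<dots> = of_real (1 / (2 * pi) ^ 3) * (LINT x|lborel. (LINT p'|lborel. cis (- ((p - p') \<bullet> x)) * (q x * ?h p')))"
    unfolding integral_mult_right_zero
  proof (intro arg_cong2[where f=times] refl Bochner_Integration.integral_cong)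
    fix x
    have "cis (- (p \<bullet> x)) * (q x * w x) = (LINT p'|lborel. (cis (- (p \<bullet> x)) * q x) * (cis (x \<bullet> p') * ?h p'))"
      unfolding integral_mult_right_zero w_def by (simp only: mult_ac)
    also have "\<dots> = (LINT p'|lborel. cis (- ((p - p') \<bullet> x)) * (q x * ?h p'))"
    proof (rule Bochner_Integration.integral_cong[OF refl])
      fix p'
      have "cis (- ((p - p') \<bullet> x)) = cis (- (p \<bullet> x)) * cis (x \<bullet> p')"
        by (simp add: cis_mult inner_diff_left inner_commute[of x p'])
      then show "(cis (- (p \<bullet> x)) * q x) * (cis (x \<bullet> p') * ?h p') = cis (- ((p - p') \<bullet> x)) * (q x * ?h p')"
        by (simp only: mult_ac)
    qed
    finally show "cis (- (p \<bullet> x)) * (q x * w x) = (LINT p'|lborel. cis (- ((p - p') \<bullet> x)) * (q x * ?h p'))" .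
  qed
  also have "(LINT x|lborel. (LINT p'|lborel. cis (- ((p - p') \<bullet> x)) * (q x * ?h p')))
    = (LINT p'|lborel. (LINT x|lborel. cis (- ((p - p') \<bullet> x)) * (q x * ?h p')))"
    by (rule integral_swap, rule integrable_pair_kernel[OF q(1) int, where B=1]) auto
  also have "\<dots> = (LINT p'|lborel. fourier q (p - p') * ?h p')"
    unfolding fourier_def[of q] integral_mult_left_zero[symmetric] by (simp only: mult_ac)
  finally show "fourier (\<lambda>x. q x * resolvent k f x) p
      = of_real (1 / (2 * pi) ^ 3) * (LINT p'|lborel. fourier q (p - p') * (?m p' * fourier f p'))" .
qed

section \<open>The Born terms as momentum integrals\<close>

text \<open>The weight and \<open>a\<close> are both square integrable, so integrating over p first
  gives a bound uniform in p', and the integrability of \<open>g\<close> does the rest.\<close>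

lemma nn_integral_shell_weight_convolution_finite:
  fixes a g :: "real ^ 3 \<Rightarrow> ennreal"
  assumes [measurable]: "a \<in> borel_measurable borel" "g \<in> borel_measurable borel"
    and k: "0 \<le> k" and a: "(\<integral>\<^sup>+ p. (a p)\<^sup>2 \<partial>lborel) < \<infinity>" and g: "(\<integral>\<^sup>+ p. g p \<partial>lborel) < \<infinity>"
  shows "(\<integral>\<^sup>+ p. ennreal (shell_weight k p) * (\<integral>\<^sup>+ p'. a (p - p') * g p' \<partial>lborel) \<partial>lborel) < \<infinity>"
proof -
  define D where "D = (\<integral>\<^sup>+ p. (ennreal (shell_weight k (p :: real ^ 3)))\<^sup>2 \<partial>lborel) * (\<integral>\<^sup>+ p. (a p)\<^sup>2 \<partial>lborel)"
  have D: "D < \<infinity>" unfolding D_def using nn_integral_shell_weight_sq_finite[OF k] a by (simp add: ennreal_mult_less_top)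
  \<comment> \<open>The crude bound D + 1, in place of the square root of D, follows by comparing
    squares: D <= (D + 1)^2.\<close>
  have bd: "(\<integral>\<^sup>+ p. ennreal (shell_weight k p) * a (p - p') \<partial>lborel) \<le> D + 1" for p'
  proof -
    have "(\<integral>\<^sup>+ p. ennreal (shell_weight k p) * a (p - p') \<partial>lborel)\<^sup>2
      \<le> (\<integral>\<^sup>+ p. (ennreal (shell_weight k (p :: real ^ 3)))\<^sup>2 \<partial>lborel) * (\<integral>\<^sup>+ p. (a (p - p'))\<^sup>2 \<partial>lborel)"
      by (rule Cauchy_Schwarz_nn_integral) measurable
    also have "\<dots> = D"
      using nn_integral_translate[of "\<lambda>p. (a p)\<^sup>2" "- p'"] by (simp add: D_def)
    also have "D \<le> D + (D + 1)" by simp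
    also have "\<dots> \<le> D * D + (D + (D + 1))" by simp
    also have "\<dots> = (D + 1)\<^sup>2" by (simp add: power2_eq_square distrib_left distrib_right add_ac)
    finally show ?thesis by (rule ennreal_le_of_power2_le)
  qed
  have "(\<integral>\<^sup>+ p. ennreal (shell_weight k p) * (\<integral>\<^sup>+ p'. a (p - p') * g p' \<partial>lborel) \<partial>lborel)
    = (\<integral>\<^sup>+ p. (\<integral>\<^sup>+ p'. ennreal (shell_weight k p) * a (p - p') * g p' \<partial>lborel) \<partial>lborel)"
    by (intro nn_integral_cong, subst nn_integral_cmult[symmetric]) (auto simp: mult.assoc)
  also have "\<dots> = (\<integral>\<^sup>+ p'. (\<integral>\<^sup>+ p. ennreal (shell_weight k p) * a (p - p') * g p' \<partial>lborel) \<partial>lborel)"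
    by (rule nn_integral_swap) measurable
  also have "\<dots> = (\<integral>\<^sup>+ p'. (\<integral>\<^sup>+ p. ennreal (shell_weight k p) * a (p - p') \<partial>lborel) * g p' \<partial>lborel)"
    by (intro nn_integral_cong nn_integral_multc) measurable
  also have "\<dots> \<le> (\<integral>\<^sup>+ p'. (D + 1) * g p' \<partial>lborel)"
    by (intro nn_integral_mono mult_right_mono bd) auto
  also have "\<dots> = (D + 1) * (\<integral>\<^sup>+ p'. g p' \<partial>lborel)" by (rule nn_integral_cmult) measurable
  also have "\<dots> < \<infinity>" using D g by (simp add: ennreal_mult_less_top)
  finally show ?thesis .
qed

section \<open>The iteration for a fixed potential\<close>

context
  fixes q :: "real ^ 3 \<Rightarrow> complex" and R :: real
  assumes q: "integrable lborel q" "AE x in lborel. R < norm x \<longrightarrow> q x = 0" and R: "0 \<le> R"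
    and q2: "(\<integral>\<^sup>+ p. (ennreal (norm (fourier q p)))\<^sup>2 \<partial>lborel) < \<infinity>"
begin

lemma potential_measurable [measurable]: "q \<in> borel_measurable borel"
  using q by auto

text \<open>The third condition makes the symbol of the truncated kernel times the transform of f
  integrable, as inversion in the next step requires. It reproduces itself because the weight and
  the transform of q are square integrable.\<close>

definition born_admissible :: "real \<Rightarrow> (real ^ 3 \<Rightarrow> complex) \<Rightarrow> bool" where
  "born_admissible k f \<longleftrightarrow> integrable lborel f \<and> (AE x in lborel. R < norm x \<longrightarrow> f x = 0) \<and>
     (\<integral>\<^sup>+ p. ennreal (shell_weight k p) * ennreal (norm (fourier f p)) \<partial>lborel) < \<infinity>"

lemma symbol_norm_le:
  assumes "1 \<le> k" "p \<noteq> 0"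
  shows "norm (fourier (truncated_kernel (2 * R) k) p) \<le> 16 * (R + 1) * shell_weight k p"
  using norm_fourier_truncated_kernel_le[of "2 * R" k p] R assms by (simp add: algebra_simps)

lemma born_admissible_step:
  assumes k: "1 \<le> k" and f: "born_admissible k f"
  shows "born_admissible k (\<lambda>x. q x * resolvent k f x)"
    and "fourier (\<lambda>x. q x * resolvent k f x) p
      = of_real (1 / (2 * pi) ^ 3) * (LINT p'|lborel. fourier q (p - p') * (fourier (truncated_kernel (2 * R) k) p' * fourier f p'))"
    and "ennreal (norm (fourier (\<lambda>x. q x * resolvent k f x) p))
      \<le> ennreal (16 * (R + 1)) * (\<integral>\<^sup>+ p'. ennreal (norm (fourier q (p - p'))) * (ennreal (shell_weight k p') * ennreal (norm (fourier f p'))) \<partial>lborel)"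
proof -
  let ?m = "fourier (truncated_kernel (2 * R) k)"
  let ?g = "\<lambda>x. q x * resolvent k f x"
  have f1: "integrable lborel f" "AE x in lborel. R < norm x \<longrightarrow> f x = 0"
    "(\<integral>\<^sup>+ p. ennreal (shell_weight k p) * ennreal (norm (fourier f p)) \<partial>lborel) < \<infinity>"
    using f by (auto simp: born_admissible_def)
  have [measurable]: "f \<in> borel_measurable borel" using f1 by auto
  have [measurable]: "?m \<in> borel_measurable borel"
    by (rule borel_measurable_fourier) measurable
  have mle: "AE p in lborel. ennreal (norm (?m p * fourier f p)) \<le> ennreal (16 * (R + 1)) * (ennreal (shell_weight k p) * ennreal (norm (fourier f p)))"
    using AE_lborel_singleton[of 0]
  proof eventually_elim
    case (elim p)
    have "norm (?m p * fourier f p) \<le> 16 * (R + 1) * shell_weight k p * norm (fourier f p)"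
      unfolding norm_mult by (intro mult_right_mono symbol_norm_le k elim) auto
    then have "ennreal (norm (?m p * fourier f p)) \<le> ennreal (16 * (R + 1) * shell_weight k p * norm (fourier f p))"
      by (rule ennreal_leI)
    also have "\<dots> = ennreal (16 * (R + 1)) * (ennreal (shell_weight k p) * ennreal (norm (fourier f p)))"
      using R less_imp_le[OF shell_weight_pos[of k p]] by (simp add: ennreal_mult mult.assoc)
    finally show ?case .
  qed
  have int: "integrable lborel (\<lambda>p. ?m p * fourier f p)"
  proof (rule integrableI_bounded)
    have "(\<integral>\<^sup>+ p. ennreal (norm (?m p * fourier f p)) \<partial>lborel) \<le> (\<integral>\<^sup>+ p. ennreal (16 * (R + 1)) * (ennreal (shell_weight k p) * ennreal (norm (fourier f p))) \<partial>lborel)"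
      by (rule nn_integral_mono_AE[OF mle])
    also have "\<dots> = ennreal (16 * (R + 1)) * (\<integral>\<^sup>+ p. ennreal (shell_weight k p) * ennreal (norm (fourier f p)) \<partial>lborel)"
      by (rule nn_integral_cmult) measurable
    also have "\<dots> < \<infinity>" using f1(3) by (simp add: ennreal_mult_less_top)
    finally show "(\<integral>\<^sup>+ p. ennreal (norm (?m p * fourier f p)) \<partial>lborel) < \<infinity>" .
  qed measurable
  have k0: "0 < k" using k by simp
  note step = born_step[OF k0 R q f1(1,2) int]
  show F: "fourier ?g p = of_real (1 / (2 * pi) ^ 3) * (LINT p'|lborel. fourier q (p - p') * (?m p' * fourier f p'))" for p
    by (rule step(3))
  show le: "ennreal (norm (fourier ?g p))
      \<le> ennreal (16 * (R + 1)) * (\<integral>\<^sup>+ p'. ennreal (norm (fourier q (p - p'))) * (ennreal (shell_weight k p') * ennreal (norm (fourier f p'))) \<partial>lborel)" for p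
  proof -
    have c: "norm (complex_of_real (1 / (2 * pi) ^ 3)) \<le> 1"
    proof -
      have "1 \<le> (2 * pi) ^ 3" using pi_gt3 by (intro one_le_power) simp
      then show ?thesis by (simp add: norm_divide norm_power)
    qed
    have "norm (fourier ?g p) \<le> 1 * norm (LINT p'|lborel. fourier q (p - p') * (?m p' * fourier f p'))"
      unfolding F norm_mult by (intro mult_right_mono c) auto
    then have "ennreal (norm (fourier ?g p)) \<le> ennreal (norm (LINT p'|lborel. fourier q (p - p') * (?m p' * fourier f p')))"
      by (simp add: ennreal_leI)
    also have "\<dots> \<le> (\<integral>\<^sup>+ p'. ennreal (norm (fourier q (p - p') * (?m p' * fourier f p'))) \<partial>lborel)"
      by (rule norm_integral_le_nn_integral)
    also have "\<dots> \<le> (\<integral>\<^sup>+ p'. ennreal (16 * (R + 1)) * (ennreal (norm (fourier q (p - p'))) * (ennreal (shell_weight k p') * ennreal (norm (fourier f p')))) \<partial>lborel)"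
    proof (rule nn_integral_mono_AE, use mle in eventually_elim)
      case (elim p')
      have "ennreal (norm (fourier q (p - p') * (?m p' * fourier f p'))) = ennreal (norm (fourier q (p - p'))) * ennreal (norm (?m p' * fourier f p'))"
        by (simp only: norm_mult[of "fourier q (p - p')"] ennreal_mult norm_ge_zero)
      also have "\<dots> \<le> ennreal (norm (fourier q (p - p'))) * (ennreal (16 * (R + 1)) * (ennreal (shell_weight k p') * ennreal (norm (fourier f p'))))"
        by (intro mult_left_mono elim) auto
      finally show ?case by (simp only: mult_ac)
    qed
    also have "\<dots> = ennreal (16 * (R + 1)) * (\<integral>\<^sup>+ p'. ennreal (norm (fourier q (p - p'))) * (ennreal (shell_weight k p') * ennreal (norm (fourier f p'))) \<partial>lborel)"
      by (rule nn_integral_cmult) measurable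
    finally show ?thesis .
  qed
  show "born_admissible k ?g"
    unfolding born_admissible_def
  proof (intro conjI step(1) step(2))
    have "(\<integral>\<^sup>+ p. ennreal (shell_weight k p) * ennreal (norm (fourier ?g p)) \<partial>lborel)
      \<le> (\<integral>\<^sup>+ p. ennreal (16 * (R + 1)) * (ennreal (shell_weight k p) * (\<integral>\<^sup>+ p'. ennreal (norm (fourier q (p - p'))) * (ennreal (shell_weight k p') * ennreal (norm (fourier f p'))) \<partial>lborel)) \<partial>lborel)"
      using mult_left_mono[OF le, of "ennreal (shell_weight k _)"] by (intro nn_integral_mono) (simp add: mult_ac)
    also have "\<dots> = ennreal (16 * (R + 1)) * (\<integral>\<^sup>+ p. ennreal (shell_weight k p) * (\<integral>\<^sup>+ p'. ennreal (norm (fourier q (p - p'))) * (ennreal (shell_weight k p') * ennreal (norm (fourier f p'))) \<partial>lborel) \<partial>lborel)"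
      by (rule nn_integral_cmult) measurable
    also have "\<dots> < \<infinity>"
    proof -
      have "(\<integral>\<^sup>+ p. ennreal (shell_weight k p) * (\<integral>\<^sup>+ p'. ennreal (norm (fourier q (p - p'))) * (ennreal (shell_weight k p') * ennreal (norm (fourier f p'))) \<partial>lborel) \<partial>lborel) < \<infinity>"
        by (rule nn_integral_shell_weight_convolution_finite) (use k q2 f1(3) in auto)
      then show ?thesis by (simp add: ennreal_mult_less_top)
    qed
    finally show "(\<integral>\<^sup>+ p. ennreal (shell_weight k p) * ennreal (norm (fourier ?g p)) \<partial>lborel) < \<infinity>" .
  qed
qed

lemma fourier_modulated: "fourier (\<lambda>x. q x * cis (\<eta> \<bullet> x)) p = fourier q (p - \<eta>)"
proof -
  have "cis (- (p \<bullet> x)) * (q x * cis (\<eta> \<bullet> x)) = cis (- ((p - \<eta>) \<bullet> x)) * q x" for x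
  proof -
    have "cis (- ((p - \<eta>) \<bullet> x)) = cis (- (p \<bullet> x)) * cis (\<eta> \<bullet> x)" by (simp add: cis_mult inner_diff_left)
    then show ?thesis by (simp only: mult_ac)
  qed
  then show ?thesis unfolding fourier_def by (simp only:)
qed

lemma born_admissible_modulated:
  assumes k: "1 \<le> k"
  shows "born_admissible k (\<lambda>x. q x * cis (\<eta> \<bullet> x))"
  unfolding born_admissible_def
proof (intro conjI)
  show "integrable lborel (\<lambda>x. q x * cis (\<eta> \<bullet> x))"
    using integrable_cis_mult[OF q(1), of "\<lambda>x. \<eta> \<bullet> x"] by (simp add: mult.commute)
  show "AE x in lborel. R < norm x \<longrightarrow> q x * cis (\<eta> \<bullet> x) = 0" using q(2) by eventually_elim auto
  have "(\<integral>\<^sup>+ p. ennreal (shell_weight k p) * ennreal (norm (fourier q (p - \<eta>))) \<partial>lborel)\<^sup>2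
    \<le> (\<integral>\<^sup>+ p. (ennreal (shell_weight k (p :: real ^ 3)))\<^sup>2 \<partial>lborel) * (\<integral>\<^sup>+ p. (ennreal (norm (fourier q (p - \<eta>))))\<^sup>2 \<partial>lborel)"
    by (rule Cauchy_Schwarz_nn_integral) measurable
  also have "(\<integral>\<^sup>+ p. (ennreal (norm (fourier q (p - \<eta>))))\<^sup>2 \<partial>lborel) = (\<integral>\<^sup>+ p. (ennreal (norm (fourier q p)))\<^sup>2 \<partial>lborel)"
    using nn_integral_translate[of "\<lambda>p. (ennreal (norm (fourier q p)))\<^sup>2" "- \<eta>"] by simp
  also have "(\<integral>\<^sup>+ p. (ennreal (shell_weight k (p :: real ^ 3)))\<^sup>2 \<partial>lborel) * (\<integral>\<^sup>+ p. (ennreal (norm (fourier q p)))\<^sup>2 \<partial>lborel) < \<infinity>"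
    using nn_integral_shell_weight_sq_finite[of k] k q2 by (simp add: ennreal_mult_less_top)
  finally show "(\<integral>\<^sup>+ p. ennreal (shell_weight k p) * ennreal (norm (fourier (\<lambda>x. q x * cis (\<eta> \<bullet> x)) p)) \<partial>lborel) < \<infinity>"
    unfolding fourier_modulated by (simp add: power_less_top_ennreal)
qed

text \<open>Unlike \<^const>\<open>Q_hat\<close>, whose resolvents are chosen by \<open>SOME\<close> separately for each \<open>\<xi>\<close>, this is visibly measurable in \<open>\<xi>\<close>.\<close>

definition born_symbol :: "real \<Rightarrow> real ^ 3 \<Rightarrow> complex" where
  "born_symbol k p = fourier (truncated_kernel (2 * R) k) p"

fun born_integral :: "nat \<Rightarrow> real ^ 3 \<Rightarrow> real ^ 3 \<Rightarrow> complex" where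
  "born_integral 0 \<xi> p = fourier q (p + \<xi> /\<^sub>R 2)"
| "born_integral (Suc n) \<xi> p = of_real (1 / (2 * pi) ^ 3) *
     (LINT p'|lborel. fourier q (p - p') * (born_symbol (norm \<xi> / 2) p' * born_integral n \<xi> p'))"

lemma borel_measurable_born_integral:
  "(\<lambda>(\<xi>, p). born_integral n \<xi> p) \<in> borel_measurable (borel \<Otimes>\<^sub>M borel)"
proof (induction n)
  case (Suc n)
  have [measurable]: "(\<lambda>x. born_integral n (f x) (g x)) \<in> borel_measurable M"
    if [measurable]: "f \<in> borel_measurable M" "g \<in> borel_measurable M" for M :: "'c measure" and f g
    using measurable_compose[OF measurable_Pair[OF that] Suc] by simp
  have [measurable]: "(\<lambda>x. born_symbol (f x) (g x)) \<in> borel_measurable M"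
    if [measurable]: "f \<in> borel_measurable M" "g \<in> borel_measurable M" for M :: "'c measure" and f g
    unfolding born_symbol_def fourier_def by measurable
  show ?case unfolding born_integral.simps by measurable
qed simp

text \<open>A change on a null set does not affect a Fourier transform, so the iterates built from
  chosen resolvents can be compared with the explicit integrals at every p. The bound 2 <= |\<xi>|
  means k >= 1.\<close>

lemma born_iterate:
  fixes n :: nat
  assumes \<xi>: "2 \<le> norm \<xi>"
  defines "F \<equiv> ((\<lambda>g x. q x * resolvent (norm \<xi> / 2) g x) ^^ n) (\<lambda>x. q x * cis (- (\<xi> /\<^sub>R 2) \<bullet> x))"
  shows "born_admissible (norm \<xi> / 2) F" and "fourier F p = born_integral n \<xi> p"
proof -
  have k: "1 \<le> norm \<xi> / 2" using \<xi> by simp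
  have "born_admissible (norm \<xi> / 2) F \<and> (\<forall>p. fourier F p = born_integral n \<xi> p)"
    unfolding F_def
  proof (induction n)
    case 0
    show ?case by (simp add: born_admissible_modulated[OF k] fourier_modulated del: inner_minus_left)
  next
    case (Suc n)
    then show ?case using born_admissible_step(1,2)[OF k] by (simp add: born_symbol_def)
  qed
  then show "born_admissible (norm \<xi> / 2) F" "fourier F p = born_integral n \<xi> p" by auto
qed

text \<open>Since k \<theta> = - \<xi> / 2, the incoming wave shifts the argument of the innermost
  transform of q by \<xi> / 2, and the outer integral is a Fourier transform evaluated at \<xi> / 2.
  The chain thus runs from \<xi> / 2 to - \<xi> / 2, at distance |\<xi>| = 2 k. The term of order
  \<open>Suc n\<close> contains n resolvents.\<close>

lemma Q_hat_eq_born_integral: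
  assumes \<xi>: "2 \<le> norm \<xi>"
  shows "Q_hat (Suc n) q \<xi> = born_integral n \<xi> (\<xi> /\<^sub>R 2)"
proof -
  have ph: "norm \<xi> / 2 * (- (\<xi> /\<^sub>R norm \<xi>) \<bullet> x) = - (\<xi> /\<^sub>R 2) \<bullet> x" for x
    using \<xi> by (auto simp: field_simps)
  show ?thesis
    unfolding Q_hat_def Let_def ph born_iterate(2)[OF \<xi>, symmetric] fourier_def by simp
qed

lemma norm_born_integral_Suc_le:
  assumes \<xi>: "2 \<le> norm \<xi>"
  shows "ennreal (norm (born_integral (Suc n) \<xi> p)) \<le> ennreal (16 * (R + 1)) *
    (\<integral>\<^sup>+ p'. ennreal (norm (fourier q (p - p'))) *
       (ennreal (shell_weight (norm \<xi> / 2) p') * ennreal (norm (born_integral n \<xi> p'))) \<partial>lborel)"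
proof -
  have k: "1 \<le> norm \<xi> / 2" using \<xi> by simp
  note Suc = born_iterate(2)[OF \<xi>, of "Suc n" p, unfolded funpow.simps o_apply]
  show ?thesis
    using born_admissible_step(3)[OF k born_iterate(1)[OF \<xi>, of n], of p]
    unfolding Suc born_iterate(2)[OF \<xi>] .
qed

text \<open>The one-step bound is iterated from the inside. Naming the inner integrals
  \<open>I1\<close> and \<open>I2\<close> lets the constants \<open>?c\<close> move out one at a
  time.\<close>

lemma norm_born_integral_three_le:
  assumes \<xi>: "2 \<le> norm \<xi>"
  defines "a \<equiv> (\<lambda>p. ennreal (norm (fourier q p)))"
  shows "ennreal (norm (born_integral 3 \<xi> p))
    \<le> ennreal (16 * (R + 1)) ^ 3 * quartic_chain (norm \<xi> / 2) a a a a p (- (\<xi> /\<^sub>R 2))"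
proof -
  let ?W = "\<lambda>p. ennreal (shell_weight (norm \<xi> / 2) p)"
  let ?c = "ennreal (16 * (R + 1))"
  have [measurable]: "a \<in> borel_measurable borel" unfolding a_def by measurable
  have a: "ennreal (norm (fourier q z)) = a z" for z by (simp add: a_def)
  note le = norm_born_integral_Suc_le[OF \<xi>, unfolded a]
  have 0: "ennreal (norm (born_integral 0 \<xi> p)) = a (p - - (\<xi> /\<^sub>R 2))" for p by (simp add: a_def)
  define I1 where "I1 p\<^sub>2 = (\<integral>\<^sup>+ p\<^sub>3. a (p\<^sub>2 - p\<^sub>3) * (?W p\<^sub>3 * a (p\<^sub>3 - - (\<xi> /\<^sub>R 2))) \<partial>lborel)" for p\<^sub>2
  define I2 where "I2 p\<^sub>1 = (\<integral>\<^sup>+ p\<^sub>2. a (p\<^sub>1 - p\<^sub>2) * (?W p\<^sub>2 * I1 p\<^sub>2) \<partial>lborel)" for p\<^sub>1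
  have [measurable]: "I1 \<in> borel_measurable borel" unfolding I1_def by measurable
  have [measurable]: "I2 \<in> borel_measurable borel" unfolding I2_def by measurable
  have 1: "ennreal (norm (born_integral (Suc 0) \<xi> p)) \<le> ?c * I1 p" for p
    using le[of 0 p] unfolding 0 I1_def .
  have 2: "ennreal (norm (born_integral (Suc (Suc 0)) \<xi> p)) \<le> ?c * (?c * I2 p)" for p
  proof -
    have "ennreal (norm (born_integral (Suc (Suc 0)) \<xi> p)) \<le> ?c * (\<integral>\<^sup>+ p'. a (p - p') * (?W p' * (?c * I1 p')) \<partial>lborel)"
      by (rule order_trans[OF le]) (intro mult_left_mono nn_integral_mono 1 zero_le)
    also have "(\<integral>\<^sup>+ p'. a (p - p') * (?W p' * (?c * I1 p')) \<partial>lborel) = (\<integral>\<^sup>+ p'. ?c * (a (p - p') * (?W p' * I1 p')) \<partial>lborel)"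
      by (simp only: mult_ac)
    also have "\<dots> = ?c * I2 p" unfolding I2_def by (rule nn_integral_cmult) measurable
    finally show ?thesis .
  qed
  have "ennreal (norm (born_integral (Suc (Suc (Suc 0))) \<xi> p)) \<le> ?c * (\<integral>\<^sup>+ p'. a (p - p') * (?W p' * (?c * (?c * I2 p'))) \<partial>lborel)"
    by (rule order_trans[OF le]) (intro mult_left_mono nn_integral_mono 2 zero_le)
  also have "(\<integral>\<^sup>+ p'. a (p - p') * (?W p' * (?c * (?c * I2 p'))) \<partial>lborel) = (\<integral>\<^sup>+ p'. (?c * ?c) * (a (p - p') * (?W p' * I2 p')) \<partial>lborel)"
    by (simp only: mult_ac)
  also have "\<dots> = (?c * ?c) * (\<integral>\<^sup>+ p'. a (p - p') * (?W p' * I2 p') \<partial>lborel)"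
    by (rule nn_integral_cmult) measurable
  also have "(\<integral>\<^sup>+ p'. a (p - p') * (?W p' * I2 p') \<partial>lborel) = quartic_chain (norm \<xi> / 2) a a a a p (- (\<xi> /\<^sub>R 2))"
    unfolding quartic_chain_def I2_def I1_def
    by (subst nn_integral_cmult[symmetric], measurable)+
       (intro nn_integral_cong, simp add: mult_ac)
  finally show ?thesis by (simp add: numeral_3_eq_3 mult.assoc)
qed

end

lemma fourier_multiplication_formula:
  fixes f g :: "'a::euclidean_space \<Rightarrow> complex"
  assumes f: "integrable lborel f" and g: "integrable lborel g"
  shows "(LINT x|lborel. f x * fourier g x) = (LINT \<xi>|lborel. fourier f \<xi> * g \<xi>)"
proof -
  have "(LINT x|lborel. f x * fourier g x) = (LINT x|lborel. (LINT \<xi>|lborel. cis (- (x \<bullet> \<xi>)) * (f x * g \<xi>)))"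
    unfolding fourier_def integral_mult_right_zero[symmetric] by (simp only: mult_ac)
  also have "\<dots> = (LINT \<xi>|lborel. (LINT x|lborel. cis (- (x \<bullet> \<xi>)) * (f x * g \<xi>)))"
    by (rule integral_swap, rule integrable_pair_kernel[OF f g, where B=1]) auto
  also have "\<dots> = (LINT \<xi>|lborel. fourier f \<xi> * g \<xi>)"
    unfolding fourier_def integral_mult_left_zero[symmetric] by (simp only: mult_ac inner_commute)
  finally show ?thesis .
qed

section \<open>Regularity of the quartic term\<close>

lemma compactly_supported_bounded:
  fixes q :: "'a::euclidean_space \<Rightarrow> complex"
  assumes "compactly_supported q"
  shows "\<exists>R\<ge>0. AE x in lborel. R < norm x \<longrightarrow> q x = 0"
proof -
  obtain K where K: "compact K" "AE x in lborel. x \<notin> K \<longrightarrow> q x = 0"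
    using assms unfolding compactly_supported_def by blast
  obtain R where R: "\<And>x. x \<in> K \<Longrightarrow> norm x \<le> R"
    using compact_imp_bounded[OF K(1)] unfolding bounded_iff by blast
  have "AE x in lborel. \<bar>R\<bar> < norm x \<longrightarrow> q x = 0"
    using K(2) by eventually_elim (use R in force)
  then show ?thesis by (intro exI[of _ "\<bar>R\<bar>"]) auto
qed

text \<open>A tempered function is integrable against a Gaussian, and on the ball of radius R the
  Gaussian is at least exp (- R^2 / 2).\<close>

lemma compactly_supported_integrable:
  fixes q :: "'a::euclidean_space \<Rightarrow> complex"
  assumes t: "tempered_function q" and s: "AE x in lborel. R < norm x \<longrightarrow> q x = 0"
  shows "integrable lborel q"
proof -
  let ?G = "\<lambda>x::'a. complex_of_real (exp (- (norm x)\<^sup>2 / 2))"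
  have [measurable]: "q \<in> borel_measurable borel" using t by (simp add: tempered_function_def)
  have "?G \<in> schwartz" using gaussian_schwartz[of 0 "0::'a"] by simp
  then have i: "integrable lborel (\<lambda>x. q x * ?G x)" using t by (simp add: tempered_function_def)
  show ?thesis
  proof (rule Bochner_Integration.integrable_bound[OF integrable_mult_right[OF i, of "of_real (exp (R\<^sup>2 / 2))"]])
    show "AE x in lborel. norm (q x) \<le> norm (of_real (exp (R\<^sup>2 / 2)) * (q x * ?G x))"
      using s
    proof eventually_elim
      case (elim x)
      show ?case
      proof (cases "R < norm x")
        case False
        then have "(norm x)\<^sup>2 \<le> R\<^sup>2" by (intro power_mono) auto
        then have "1 \<le> exp (R\<^sup>2 / 2 + - (norm x)\<^sup>2 / 2)" by simp
        then have "norm (q x) * 1 \<le> norm (q x) * (exp (R\<^sup>2 / 2) * exp (- (norm x)\<^sup>2 / 2))"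
          unfolding exp_add by (rule mult_left_mono) simp
        then show ?thesis by (simp add: norm_mult mult_ac)
      qed (use elim in simp)
    qed
  qed simp
qed

lemma integrable_gaussian_sq: "integrable lborel (\<lambda>x::'a::euclidean_space. (exp (- (norm x)\<^sup>2 / 2))\<^sup>2)"
proof -
  have "integrable lborel (\<lambda>x::'a. exp (- (norm (sqrt 2 *\<^sub>R x))\<^sup>2 / 2))"
    using integrable_Re[OF integrable_gaussian[of "sqrt 2" "0::'a"]] by simp
  moreover have "exp (- (norm (sqrt 2 *\<^sub>R x))\<^sup>2 / 2) = (exp (- (norm x)\<^sup>2 / 2))\<^sup>2" for x :: 'a
    by (simp add: power_mult_distrib exp_double[symmetric])
  ultimately show ?thesis by (simp only:)
qed

lemma L2_function_mult_gaussian_integrable: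
  fixes h :: "'a::euclidean_space \<Rightarrow> complex"
  assumes h: "L2_function h"
  shows "integrable lborel (\<lambda>x. h x * of_real (exp (- (norm x)\<^sup>2 / 2)))"
proof (rule Bochner_Integration.integrable_bound)
  have [measurable]: "h \<in> borel_measurable borel" using h by (simp add: L2_function_def)
  show "integrable lborel (\<lambda>x. (norm (h x))\<^sup>2 + (exp (- (norm x)\<^sup>2 / 2))\<^sup>2)"
    using h by (intro Bochner_Integration.integrable_add integrable_gaussian_sq) (auto simp: L2_function_def)
  show "AE x in lborel. norm (h x * of_real (exp (- (norm x)\<^sup>2 / 2))) \<le> norm ((norm (h x))\<^sup>2 + (exp (- (norm x)\<^sup>2 / 2))\<^sup>2)"
  proof (rule AE_I2)
    fix x
    have "0 \<le> (norm (h x) - exp (- (norm x)\<^sup>2 / 2))\<^sup>2 + (norm (h x))\<^sup>2 + (exp (- (norm x)\<^sup>2 / 2))\<^sup>2" by simp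
    then have "norm (h x) * exp (- (norm x)\<^sup>2 / 2) \<le> (norm (h x))\<^sup>2 + (exp (- (norm x)\<^sup>2 / 2))\<^sup>2"
      by (simp only: power2_diff)
    then show "norm (h x * of_real (exp (- (norm x)\<^sup>2 / 2))) \<le> norm ((norm (h x))\<^sup>2 + (exp (- (norm x)\<^sup>2 / 2))\<^sup>2)"
      by (simp add: norm_mult)
  qed
  show "(\<lambda>x. h x * of_real (exp (- (norm x)\<^sup>2 / 2))) \<in> borel_measurable lborel" by measurable
qed

text \<open>Sobolev membership yields a square integrable \<open>h\<close> only through pairings
  with Schwartz functions. Modulated Gaussians identify it almost everywhere with the transform of q
  times the Bessel weight: the weight preserves Schwartz functions, and the multiplication formula
  moves the transform from the test function onto q.\<close>

lemma sobolev_fourier_L2: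
  fixes q :: "'a::euclidean_space \<Rightarrow> complex"
  assumes q: "integrable lborel q" and s: "dist_of q \<in> sobolev \<alpha>"
  shows "(\<integral>\<^sup>+ \<xi>. ennreal ((norm (fourier q \<xi>))\<^sup>2 * (1 + (norm \<xi>)\<^sup>2) powr \<alpha>) \<partial>lborel) < \<infinity>"
proof -
  let ?w = "\<lambda>\<xi>::'a. complex_of_real ((1 + (norm \<xi>)\<^sup>2) powr (\<alpha> / 2))"
  let ?G = "\<lambda>x::'a. complex_of_real (exp (- (norm x)\<^sup>2 / 2))"
  have [measurable]: "q \<in> borel_measurable borel" using q by auto
  obtain h where h: "represented_L2 (bessel_fourier \<alpha> (dist_of q)) h" using s by (auto simp: sobolev_def)
  have hL: "L2_function h" using h by (simp add: represented_L2_def)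
  have [measurable]: "h \<in> borel_measurable borel" using hL by (simp add: L2_function_def)
  define d where "d \<xi> = fourier q \<xi> * ?w \<xi> - h \<xi>" for \<xi>
  have g: "(\<lambda>x. cis (- (b \<bullet> x)) * ?G x) \<in> schwartz" for b :: 'a using gaussian_schwartz[of "- b" "0::'a"] by simp
  have wg: "(\<lambda>x. ?w x * (cis (- (b \<bullet> x)) * ?G x)) \<in> schwartz" for b
    by (rule schwartz_slow_mult[OF g slow.powr])
  have i1: "integrable lborel (\<lambda>x. fourier q x * (?w x * (cis (- (b \<bullet> x)) * ?G x)))" for b
  proof (rule Bochner_Integration.integrable_bound)
    show "integrable lborel (\<lambda>x. of_real (LINT x|lborel. norm (q x)) * (?w x * (cis (- (b \<bullet> x)) * ?G x)))"
      by (rule integrable_mult_right[OF schwartz_integrable[OF wg]])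
    show "AE x in lborel. norm (fourier q x * (?w x * (cis (- (b \<bullet> x)) * ?G x))) \<le> norm (of_real (LINT x|lborel. norm (q x)) * (?w x * (cis (- (b \<bullet> x)) * ?G x)))"
      unfolding norm_mult[of "fourier q _"] norm_mult[of "of_real _"] norm_of_real
      by (intro AE_I2 mult_right_mono order_trans[OF norm_fourier_le abs_ge_self]) auto
  qed measurable
  have i2: "integrable lborel (\<lambda>x. h x * (cis (- (b \<bullet> x)) * ?G x))" for b
    using integrable_cis_mult[OF L2_function_mult_gaussian_integrable[OF hL], of "\<lambda>x. - (b \<bullet> x)"] by (simp add: mult_ac)
  have dd: "d x * (cis (- (b \<bullet> x)) * ?G x) = fourier q x * (?w x * (cis (- (b \<bullet> x)) * ?G x)) - h x * (cis (- (b \<bullet> x)) * ?G x)" for x b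
    by (simp add: d_def left_diff_distrib mult.assoc)
  have "AE \<xi> in lborel. d \<xi> = 0"
  proof (rule gaussian_tests_AE_zero)
    show "integrable lborel (\<lambda>x. d x * ?G x)"
      using Bochner_Integration.integrable_diff[OF i1[of 0] i2[of 0]] unfolding dd[symmetric] by simp
    fix b :: 'a
    have "(LINT x|lborel. fourier q x * (?w x * (cis (- (b \<bullet> x)) * ?G x))) = (LINT x|lborel. q x * fourier (\<lambda>x. ?w x * (cis (- (b \<bullet> x)) * ?G x)) x)"
      by (rule fourier_multiplication_formula[OF q schwartz_integrable[OF wg], symmetric])
    also have "\<dots> = bessel_fourier \<alpha> (dist_of q) (\<lambda>x. cis (- (b \<bullet> x)) * ?G x)"
      by (simp add: bessel_fourier_def mult_dist_def fourier_dist_def dist_of_def)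
    also have "\<dots> = dist_of h (\<lambda>x. cis (- (b \<bullet> x)) * ?G x)" using h g unfolding represented_L2_def by blast
    finally have "(LINT x|lborel. fourier q x * (?w x * (cis (- (b \<bullet> x)) * ?G x))) = (LINT x|lborel. h x * (cis (- (b \<bullet> x)) * ?G x))"
      by (simp add: dist_of_def)
    then show "(LINT x|lborel. d x * (cis (- (b \<bullet> x)) * ?G x)) = 0"
      unfolding dd Bochner_Integration.integral_diff[OF i1 i2] by simp
  qed
  then have "AE \<xi> in lborel. ennreal ((norm (fourier q \<xi>))\<^sup>2 * (1 + (norm \<xi>)\<^sup>2) powr \<alpha>) = ennreal ((norm (h \<xi>))\<^sup>2)"
  proof eventually_elim
    case (elim \<xi>)
    have "((1 + (norm \<xi>)\<^sup>2) powr (\<alpha> / 2))\<^sup>2 = (1 + (norm \<xi>)\<^sup>2) powr \<alpha>"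
      by (simp add: power2_eq_square powr_add[symmetric])
    moreover have "h \<xi> = fourier q \<xi> * ?w \<xi>" using elim by (simp add: d_def)
    ultimately show ?case by (simp add: norm_mult power_mult_distrib)
  qed
  then have "(\<integral>\<^sup>+ \<xi>. ennreal ((norm (fourier q \<xi>))\<^sup>2 * (1 + (norm \<xi>)\<^sup>2) powr \<alpha>) \<partial>lborel) = (\<integral>\<^sup>+ \<xi>. ennreal ((norm (h \<xi>))\<^sup>2) \<partial>lborel)"
    by (rule nn_integral_cong_AE)
  also have "\<dots> < \<infinity>" using hL by (auto simp: L2_function_def integrable_iff_bounded)
  finally show ?thesis .
qed

lemma high_frequency_cutoff_facts:
  assumes "high_frequency_cutoff C\<^sub>0 \<kappa>"
  shows "\<kappa> \<in> borel_measurable borel" and "\<exists>B\<ge>0. \<forall>t. \<bar>\<kappa> t\<bar> \<le> B" and "t < C\<^sub>0 \<Longrightarrow> \<kappa> t = 0"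
proof -
  have "\<kappa> differentiable (at t)" for t
    using assms unfolding high_frequency_cutoff_def smooth_real_def by (auto dest!: spec[of _ "0::nat"])
  then have c: "continuous_on S \<kappa>" for S
    by (meson continuous_at_imp_continuous_on differentiable_imp_continuous_within)
  show "\<kappa> \<in> borel_measurable borel" by (rule borel_measurable_continuous_onI[OF c])
  show "t < C\<^sub>0 \<Longrightarrow> \<kappa> t = 0" using assms unfolding high_frequency_cutoff_def by blast
  have "bounded (\<kappa> ` {C\<^sub>0..2 * C\<^sub>0})" by (rule compact_imp_bounded[OF compact_continuous_image[OF c]]) simp
  then obtain B where "\<forall>x\<in>\<kappa> ` {C\<^sub>0..2 * C\<^sub>0}. norm x \<le> B" unfolding bounded_iff by blast
  then have B: "\<bar>\<kappa> t\<bar> \<le> B" if "C\<^sub>0 \<le> t" "t \<le> 2 * C\<^sub>0" for t using that by auto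
  have "\<bar>\<kappa> t\<bar> \<le> \<bar>B\<bar> + 1" for t
  proof -
    consider "t < C\<^sub>0" | "C\<^sub>0 \<le> t" "t \<le> 2 * C\<^sub>0" | "2 * C\<^sub>0 \<le> t" by linarith
    then show ?thesis
    proof cases
      case 2 then show ?thesis using B[of t] by linarith
    qed (use assms in \<open>auto simp: high_frequency_cutoff_def\<close>)
  qed
  then show "\<exists>B\<ge>0. \<forall>t. \<bar>\<kappa> t\<bar> \<le> B" by (intro exI[of _ "\<bar>B\<bar> + 1"]) auto
qed

text \<open>Testing on f pairs \<open>V\<close> with the inverse transform of the transform of the
  weighted f, and inversion returns the weighted f itself. Temperedness follows from the boundedness
  of \<open>V\<close> and the uniform decay of transforms of Schwartz functions.\<close>

lemma inv_fourier_dist_in_sobolev: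
  fixes V :: "'a::euclidean_space \<Rightarrow> complex"
  assumes [measurable]: "V \<in> borel_measurable borel" and B: "\<And>\<xi>. norm (V \<xi>) \<le> B"
    and L2: "integrable lborel (\<lambda>\<xi>. (norm (V \<xi>))\<^sup>2 * (1 + (norm \<xi>)\<^sup>2) powr \<beta>)"
  shows "inv_fourier_dist (dist_of V) \<in> sobolev \<beta>"
proof -
  let ?T = "inv_fourier_dist (dist_of V)"
  let ?N = "DIM('a) + 1"
  let ?c = "complex_of_real (1 / (2 * pi) ^ DIM('a))"
  have T: "?T f = (LINT \<xi>|lborel. V \<xi> * inv_fourier f \<xi>)" for f by (simp add: inv_fourier_dist_def dist_of_def)
  have B0: "0 \<le> B" using B norm_ge_zero order_trans by blast
  obtain C where C: "C \<ge> 0" "\<And>f \<xi>. f \<in> schwartz \<Longrightarrow> norm (fourier f (\<xi>::'a)) \<le> C * schwartz_seminorm ?N f * (1 + norm \<xi>) powr (- real ?N)"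
    using fourier_schwartz_decay[where 'a='a and N="?N"] by auto
  let ?p = "\<lambda>\<xi>::'a. (1 + norm \<xi>) powr (- real ?N)"
  have p: "integrable lborel ?p" by (rule integrable_one_plus_norm_powr) simp
  have Vf: "norm (V \<xi> * inv_fourier f \<xi>) \<le> (B * (norm ?c * (C * schwartz_seminorm ?N f))) * ?p \<xi>" if "f \<in> schwartz" for f \<xi>
  proof -
    have "norm (V \<xi> * inv_fourier f \<xi>) \<le> B * (norm ?c * (C * schwartz_seminorm ?N f * (1 + norm (- \<xi>)) powr (- real ?N)))"
      unfolding norm_mult inv_fourier_eq_fourier by (intro mult_mono B mult_left_mono C(2) that) (use B0 in auto)
    then show ?thesis by (simp add: mult_ac)
  qed
  have meas: "inv_fourier f \<in> borel_measurable borel" if "f \<in> schwartz" for f :: "'a \<Rightarrow> complex"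
  proof -
    have [measurable]: "f \<in> borel_measurable borel" using that by (rule schwartz_measurable)
    show ?thesis unfolding inv_fourier_def by measurable
  qed
  have int: "integrable lborel (\<lambda>\<xi>. V \<xi> * inv_fourier f \<xi>)" if f: "f \<in> schwartz" for f
  proof (rule Bochner_Integration.integrable_bound[OF integrable_mult_right[OF p]])
    show "AE \<xi> in lborel. norm (V \<xi> * inv_fourier f \<xi>) \<le> norm ((B * (norm ?c * (C * schwartz_seminorm ?N f))) * ?p \<xi>)"
      by (intro AE_I2 order_trans[OF Vf[OF f]]) simp
    note meas[OF f, measurable]
    show "(\<lambda>\<xi>. V \<xi> * inv_fourier f \<xi>) \<in> borel_measurable lborel" by measurable
  qed
  have inv_i: "integrable lborel (\<lambda>\<xi>. cis (\<xi> \<bullet> x) * f \<xi>)" if "f \<in> schwartz" for f and x :: 'a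
    by (rule integrable_cis_mult[OF schwartz_integrable[OF that]]) measurable
  have "tempered ?T"
  proof (rule temperedI)
    show "?T (\<lambda>x. f x + g x) = ?T f + ?T g" if f: "f \<in> schwartz" and g: "g \<in> schwartz" for f g
    proof -
      have "inv_fourier (\<lambda>x. f x + g x) \<xi> = inv_fourier f \<xi> + inv_fourier g \<xi>" for \<xi>
        unfolding inv_fourier_def distrib_left[of "cis _"] Bochner_Integration.integral_add[OF inv_i[OF f] inv_i[OF g]]
        by (rule distrib_left)
      then show ?thesis unfolding T
        by (simp only: distrib_left Bochner_Integration.integral_add[OF int[OF f] int[OF g]])
    qed
    show "?T (\<lambda>x. c * f x) = c * ?T f" for c f
    proof -
      have "inv_fourier (\<lambda>x. c * f x) \<xi> = c * inv_fourier f \<xi>" for \<xi>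
        unfolding inv_fourier_def mult.left_commute[of "cis _" c] integral_mult_right_zero by (rule mult.left_commute)
      then show ?thesis unfolding T by (simp only: mult.left_commute[of "V _" c] integral_mult_right_zero)
    qed
    fix f :: "'a \<Rightarrow> complex" assume f: "f \<in> schwartz"
    have "norm (?T f) \<le> (LINT \<xi>|lborel. norm (V \<xi> * inv_fourier f \<xi>))" unfolding T by (rule integral_norm_bound)
    also have "\<dots> \<le> (LINT \<xi>|lborel. (B * (norm ?c * (C * schwartz_seminorm ?N f))) * ?p \<xi>)"
      by (intro integral_mono integrable_norm int f integrable_mult_right p Vf)
    also have "\<dots> = (B * norm ?c * C * (LINT \<xi>|lborel. ?p \<xi>)) * schwartz_seminorm ?N f" by simp
    finally show "norm (?T f) \<le> (B * norm ?c * C * (LINT \<xi>|lborel. ?p \<xi>)) * schwartz_seminorm ?N f" .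
  qed
  moreover have "represented_L2 (bessel_fourier \<beta> ?T) (\<lambda>\<xi>. V \<xi> * of_real ((1 + (norm \<xi>)\<^sup>2) powr (\<beta> / 2)))"
    unfolding represented_L2_def
  proof (intro conjI ballI)
    let ?w = "\<lambda>\<xi>::'a. complex_of_real ((1 + (norm \<xi>)\<^sup>2) powr (\<beta> / 2))"
    have sq: "(norm (V \<xi> * ?w \<xi>))\<^sup>2 = (norm (V \<xi>))\<^sup>2 * (1 + (norm \<xi>)\<^sup>2) powr \<beta>" for \<xi>
      by (simp add: norm_mult power_mult_distrib) (simp add: power2_eq_square powr_add[symmetric])
    show "L2_function (\<lambda>\<xi>. V \<xi> * ?w \<xi>)"
      unfolding L2_function_def sq using L2 by (intro conjI) measurable
    fix f :: "'a \<Rightarrow> complex" assume f: "f \<in> schwartz"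
    have [measurable]: "f \<in> borel_measurable borel" using f by (rule schwartz_measurable)
    have wf: "(\<lambda>\<xi>. ?w \<xi> * f \<xi>) \<in> schwartz" by (rule schwartz_slow_mult[OF f slow.powr])
    have inv: "AE \<xi> in lborel. ?w \<xi> * f \<xi> = inv_fourier (fourier (\<lambda>\<xi>. ?w \<xi> * f \<xi>)) \<xi>"
      by (rule fourier_inversion[OF schwartz_integrable[OF wf] fourier_schwartz_integrable[OF wf]])
    have "bessel_fourier \<beta> ?T f = (LINT \<xi>|lborel. V \<xi> * inv_fourier (fourier (\<lambda>\<xi>. ?w \<xi> * f \<xi>)) \<xi>)"
      by (simp add: bessel_fourier_def mult_dist_def fourier_dist_def T)
    also have "\<dots> = (LINT \<xi>|lborel. V \<xi> * (?w \<xi> * f \<xi>))"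
    proof (rule integral_cong_AE)
      show "(\<lambda>\<xi>. V \<xi> * inv_fourier (fourier (\<lambda>\<xi>. ?w \<xi> * f \<xi>)) \<xi>) \<in> borel_measurable lborel"
        unfolding inv_fourier_def by measurable
      show "AE \<xi> in lborel. V \<xi> * inv_fourier (fourier (\<lambda>\<xi>. ?w \<xi> * f \<xi>)) \<xi> = V \<xi> * (?w \<xi> * f \<xi>)"
        using inv by eventually_elim simp
    qed measurable
    finally show "bessel_fourier \<beta> ?T f = dist_of (\<lambda>\<xi>. V \<xi> * ?w \<xi>) f"
      by (simp add: dist_of_def mult.assoc)
  qed
  ultimately show ?thesis unfolding sobolev_def by blast
qed

text \<open>The Sobolev integral bounds all L^2 masses in the chain. For frequencies of length at
  least k / 2 the mass is smaller by 4 powr \<alpha> * k powr (- 2 \<alpha>), because 1 + |p|^2 >=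
  k^2 / 4 there. Adding - 2 \<alpha> to the exponent 4 \<delta> - 4 of the squared chain and taking
  the root gives - (2 + \<alpha> - 2 \<delta>).\<close>

lemma quartic_term_decay:
  fixes q :: "real ^ 3 \<Rightarrow> complex"
  assumes q: "integrable lborel q" "AE x in lborel. R < norm x \<longrightarrow> q x = 0" and R: "0 \<le> R"
    and \<alpha>: "0 \<le> \<alpha>" and S: "(\<integral>\<^sup>+ \<xi>. ennreal ((norm (fourier q \<xi>))\<^sup>2 * (1 + (norm \<xi>)\<^sup>2) powr \<alpha>) \<partial>lborel) < \<infinity>"
    and \<delta>: "0 < \<delta>" "\<delta> < 1 / 2"
  shows "\<exists>C\<ge>0. \<forall>\<xi>. 2 \<le> norm \<xi> \<longrightarrow> norm (Q_hat 4 q \<xi>) \<le> C * (1 + norm \<xi>) powr (- (2 + \<alpha> - 2 * \<delta>))"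
proof -
  have [measurable]: "q \<in> borel_measurable borel" using q by auto
  define a where "a = (\<lambda>p. ennreal (norm (fourier q p)))"
  have [measurable]: "a \<in> borel_measurable borel" unfolding a_def by measurable
  define S' where "S' = (\<integral>\<^sup>+ \<xi>. ennreal ((norm (fourier q \<xi>))\<^sup>2 * (1 + (norm \<xi>)\<^sup>2) powr \<alpha>) \<partial>lborel)"
  obtain s where s: "S' = ennreal s" "0 \<le> s" using S unfolding S'_def by (cases S') (auto simp: S'_def)
  have a2: "(a p)\<^sup>2 = ennreal ((norm (fourier q p))\<^sup>2)" for p by (simp add: a_def ennreal_power)
  have A: "(\<integral>\<^sup>+ p. (a p)\<^sup>2 \<partial>lborel) \<le> S'"
    unfolding S'_def a2
  proof (intro nn_integral_mono ennreal_leI)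
    fix p :: "real^3"
    have "1 \<le> (1 + (norm p)\<^sup>2) powr \<alpha>" using \<alpha> by (intro ge_one_powr_ge_zero) auto
    then show "(norm (fourier q p))\<^sup>2 \<le> (norm (fourier q p))\<^sup>2 * (1 + (norm p)\<^sup>2) powr \<alpha>"
      using mult_left_mono[of 1 "(1 + (norm p)\<^sup>2) powr \<alpha>" "(norm (fourier q p))\<^sup>2"] by simp
  qed
  then have q2: "(\<integral>\<^sup>+ p. (ennreal (norm (fourier q p)))\<^sup>2 \<partial>lborel) < \<infinity>"
    using S unfolding S'_def a_def by (rule le_less_trans)
  define c where "c = 16 * (4096 * pi / \<delta>\<^sup>2)\<^sup>2 * (s ^ 3 * (s * 4 powr \<alpha>))"
  have c0: "0 \<le> c" using s by (simp add: c_def)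
  \<comment> \<open>The cube comes from the three truncated kernels, the power of 4 from (1 +
    |\<xi>|) / 4 <= k for |\<xi>| >= 2.\<close>
  define D where "D = (16 * (R + 1)) ^ 3 * sqrt c * 4 powr (2 + \<alpha> - 2 * \<delta>)"
  have "norm (Q_hat 4 q \<xi>) \<le> D * (1 + norm \<xi>) powr (- (2 + \<alpha> - 2 * \<delta>))" if \<xi>: "2 \<le> norm \<xi>" for \<xi>
  proof -
    define k where "k = norm \<xi> / 2"
    have k: "1 \<le> k" using \<xi> by (simp add: k_def)
    have B: "(\<integral>\<^sup>+ p. (a p)\<^sup>2 * indicator {p. k / 2 \<le> norm p} p \<partial>lborel) \<le> ennreal (4 powr \<alpha> * k powr (- 2 * \<alpha>)) * S'"
    proof -
      have "(\<integral>\<^sup>+ p. (a p)\<^sup>2 * indicator {p. k / 2 \<le> norm p} p \<partial>lborel)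
        \<le> (\<integral>\<^sup>+ p. ennreal (4 powr \<alpha> * k powr (- 2 * \<alpha>)) * ennreal ((norm (fourier q p))\<^sup>2 * (1 + (norm p)\<^sup>2) powr \<alpha>) \<partial>lborel)"
      proof (intro nn_integral_mono)
        fix p :: "real^3"
        show "(a p)\<^sup>2 * indicator {p. k / 2 \<le> norm p} p
          \<le> ennreal (4 powr \<alpha> * k powr (- 2 * \<alpha>)) * ennreal ((norm (fourier q p))\<^sup>2 * (1 + (norm p)\<^sup>2) powr \<alpha>)"
        proof (cases "k / 2 \<le> norm p")
          case True
          have "k\<^sup>2 / 4 \<le> 1 + (norm p)\<^sup>2" using power_mono[OF True, of 2] k by (simp add: power_divide)
          then have "(k\<^sup>2 / 4) powr \<alpha> \<le> (1 + (norm p)\<^sup>2) powr \<alpha>" using \<alpha> k by (intro powr_mono2) auto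
          then have le: "4 powr \<alpha> * k powr (- 2 * \<alpha>) * (k\<^sup>2 / 4) powr \<alpha> \<le> 4 powr \<alpha> * k powr (- 2 * \<alpha>) * (1 + (norm p)\<^sup>2) powr \<alpha>"
            by (intro mult_left_mono) auto
          have one: "4 powr \<alpha> * k powr (- 2 * \<alpha>) * (k\<^sup>2 / 4) powr \<alpha> = 1"
          proof -
            have "(k\<^sup>2) powr \<alpha> = k powr (2 * \<alpha>)" using k by (simp add: powr_powr flip: powr_numeral)
            then show ?thesis using k by (simp add: powr_divide powr_minus field_simps)
          qed
          from mult_left_mono[OF le[unfolded one], of "(norm (fourier q p))\<^sup>2"]
          have "(norm (fourier q p))\<^sup>2 \<le> 4 powr \<alpha> * k powr (- 2 * \<alpha>) * ((norm (fourier q p))\<^sup>2 * (1 + (norm p)\<^sup>2) powr \<alpha>)"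
            by (simp add: mult_ac)
          then show ?thesis using True by (simp add: a2 ennreal_mult[symmetric] ennreal_leI)
        qed simp
      qed
      also have "\<dots> = ennreal (4 powr \<alpha> * k powr (- 2 * \<alpha>)) * S'" unfolding S'_def by (rule nn_integral_cmult) measurable
      finally show ?thesis .
    qed
    have xy: "norm (\<xi> /\<^sub>R 2 - - (\<xi> /\<^sub>R 2)) = 2 * k"
    proof -
      have "\<xi> /\<^sub>R 2 - - (\<xi> /\<^sub>R 2) = \<xi>" using scaleR_add_left[of "1/2" "1/2" \<xi>] by (simp add: inverse_eq_divide)
      then show ?thesis by (simp add: k_def)
    qed
    let ?chain = "quartic_chain k a a a a (\<xi> /\<^sub>R 2) (- (\<xi> /\<^sub>R 2))"
    have "?chain\<^sup>2 \<le> ennreal (16 * (4096 * pi / \<delta>\<^sup>2)\<^sup>2 * k powr (4 * \<delta> - 4)) *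
       ((\<integral>\<^sup>+ p. (a p)\<^sup>2 \<partial>lborel) ^ 3 * (\<integral>\<^sup>+ p. (a p)\<^sup>2 * indicator {p. k / 2 \<le> norm p} p \<partial>lborel))"
      by (rule quartic_chain_decay[OF _ xy k \<delta>]) measurable
    also have "\<dots> \<le> ennreal (16 * (4096 * pi / \<delta>\<^sup>2)\<^sup>2 * k powr (4 * \<delta> - 4)) * (S' ^ 3 * (ennreal (4 powr \<alpha> * k powr (- 2 * \<alpha>)) * S'))"
      by (intro mult_left_mono mult_mono power_mono A B) auto
    also have "\<dots> = ennreal (16 * (4096 * pi / \<delta>\<^sup>2)\<^sup>2 * k powr (4 * \<delta> - 4) * (s ^ 3 * (4 powr \<alpha> * k powr (- 2 * \<alpha>) * s)))"
      using s by (simp add: ennreal_mult ennreal_power)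
    also have "16 * (4096 * pi / \<delta>\<^sup>2)\<^sup>2 * k powr (4 * \<delta> - 4) * (s ^ 3 * (4 powr \<alpha> * k powr (- 2 * \<alpha>) * s)) = (sqrt c * k powr (- (2 + \<alpha> - 2 * \<delta>)))\<^sup>2"
    proof -
      have "(k powr (- (2 + \<alpha> - 2 * \<delta>)))\<^sup>2 = k powr (4 * \<delta> - 4) * k powr (- 2 * \<alpha>)"
        by (simp add: power2_eq_square powr_add[symmetric] algebra_simps)
      then show ?thesis using c0 by (simp add: power_mult_distrib) (simp add: c_def mult_ac)
    qed
    also have "ennreal ((sqrt c * k powr (- (2 + \<alpha> - 2 * \<delta>)))\<^sup>2) = (ennreal (sqrt c * k powr (- (2 + \<alpha> - 2 * \<delta>))))\<^sup>2"
      using c0 by (subst ennreal_power) auto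
    finally have chain: "?chain \<le> ennreal (sqrt c * k powr (- (2 + \<alpha> - 2 * \<delta>)))"
      by (rule ennreal_le_of_power2_le)
    have "Q_hat 4 q \<xi> = born_integral q R 3 \<xi> (\<xi> /\<^sub>R 2)"
      using Q_hat_eq_born_integral[OF q R q2 \<xi>, of 3] by simp
    then have "ennreal (norm (Q_hat 4 q \<xi>)) \<le> ennreal (16 * (R + 1)) ^ 3 * ?chain"
      using norm_born_integral_three_le[OF q R q2 \<xi>, of "\<xi> /\<^sub>R 2"] by (simp only: a_def k_def)
    also have "\<dots> \<le> ennreal (16 * (R + 1)) ^ 3 * ennreal (sqrt c * k powr (- (2 + \<alpha> - 2 * \<delta>)))"
      by (rule mult_left_mono[OF chain]) simp
    also have "\<dots> = ennreal ((16 * (R + 1)) ^ 3 * (sqrt c * k powr (- (2 + \<alpha> - 2 * \<delta>))))"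
      using R c0 by (subst ennreal_power) (auto simp: ennreal_mult)
    finally have "norm (Q_hat 4 q \<xi>) \<le> (16 * (R + 1)) ^ 3 * (sqrt c * k powr (- (2 + \<alpha> - 2 * \<delta>)))"
      using R c0 by (subst (asm) ennreal_le_iff) auto
    also have "\<dots> \<le> (16 * (R + 1)) ^ 3 * (sqrt c * ((1 + norm \<xi>) / 4) powr (- (2 + \<alpha> - 2 * \<delta>)))"
    proof (intro mult_left_mono powr_mono2')
      show "(1 + norm \<xi>) / 4 \<le> k" using \<xi> by (simp add: k_def)
    qed (use \<alpha> \<delta> R c0 in \<open>auto simp: add_pos_nonneg\<close>)
    also have "((1 + norm \<xi>) / 4) powr (- (2 + \<alpha> - 2 * \<delta>)) = 4 powr (2 + \<alpha> - 2 * \<delta>) * (1 + norm \<xi>) powr (- (2 + \<alpha> - 2 * \<delta>))"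
      by (simp only: powr_divide powr_minus) (simp add: divide_inverse mult.commute)
    finally show ?thesis by (simp only: D_def mult_ac)
  qed
  moreover have "0 \<le> D" using R c0 by (simp add: D_def)
  ultimately show ?thesis by blast
qed

theorem theorem4:
  fixes \<alpha> \<beta> C\<^sub>0 :: real
    and q :: "real ^ 3 \<Rightarrow> complex"
    and \<kappa> :: "real \<Rightarrow> real"
  assumes "0 \<le> \<alpha>" and "\<alpha> < 3 / 2"
    and "tempered_function q"
    and "dist_of q \<in> sobolev \<alpha>"
    and "compactly_supported q"
    and "C\<^sub>0 > max ((2 * sobolev_norm \<alpha> (dist_of q)) ^ 4) 1"
    and "high_frequency_cutoff C\<^sub>0 \<kappa>"
    and "0 \<le> \<beta>" and "\<beta> < \<alpha> + 1 / 2"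
  shows "Q_high \<kappa> 4 q \<in> sobolev \<beta>"
proof -
  obtain R where R: "0 \<le> R" "AE x in lborel. R < norm x \<longrightarrow> q x = 0"
    using compactly_supported_bounded[OF assms(5)] by blast
  have q: "integrable lborel q" by (rule compactly_supported_integrable[OF assms(3) R(2)])
  note S = sobolev_fourier_L2[OF q assms(4)]
  have q2: "(\<integral>\<^sup>+ p. (ennreal (norm (fourier q p)))\<^sup>2 \<partial>lborel) < \<infinity>"
  proof (rule le_less_trans[OF nn_integral_mono S])
    fix p :: "real^3"
    have "1 \<le> (1 + (norm p)\<^sup>2) powr \<alpha>" using assms(1) by (intro ge_one_powr_ge_zero) auto
    then show "(ennreal (norm (fourier q p)))\<^sup>2 \<le> ennreal ((norm (fourier q p))\<^sup>2 * (1 + (norm p)\<^sup>2) powr \<alpha>)"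
      using mult_left_mono[of 1 "(1 + (norm p)\<^sup>2) powr \<alpha>" "(norm (fourier q p))\<^sup>2"] by (simp add: ennreal_power ennreal_leI)
  qed
  \<comment> \<open>A quarter of the slack: then 2 e - 2 \<beta> = 7 / 2 + \<alpha> - \<beta>, which
    exceeds the dimension 3 precisely when \<beta> < \<alpha> + 1 / 2. From \<alpha> < 3 / 2 and
    \<beta> >= 0 this \<delta> is below 1 / 2.\<close>
  define \<delta> where "\<delta> = (\<alpha> + 1 / 2 - \<beta>) / 4"
  have \<delta>: "0 < \<delta>" "\<delta> < 1 / 2" using assms by (auto simp: \<delta>_def)
  define e where "e = 2 + \<alpha> - 2 * \<delta>"
  have \<delta>4: "4 * \<delta> = \<alpha> + 1 / 2 - \<beta>" by (simp add: \<delta>_def)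
  have e0: "0 < e" unfolding e_def using assms(1) \<delta>(2) by linarith
  have e3: "3 < 2 * e - 2 * \<beta>"
  proof -
    have "2 * (2 + \<alpha> - 2 * \<delta>) - 2 * \<beta> = 7 / 2 + \<alpha> - \<beta>" using \<delta>4 by (simp add: algebra_simps)
    then show ?thesis unfolding e_def using assms(9) by simp
  qed
  obtain C where C: "0 \<le> C" "\<And>\<xi>. 2 \<le> norm \<xi> \<Longrightarrow> norm (Q_hat 4 q \<xi>) \<le> C * (1 + norm \<xi>) powr (- e)"
    using quartic_term_decay[OF q R(2,1) assms(1) S \<delta>] unfolding e_def by blast
  note \<kappa> = high_frequency_cutoff_facts[OF assms(7)]
  note \<kappa>(1)[measurable]
  obtain B where B: "0 \<le> B" "\<And>t. \<bar>\<kappa> t\<bar> \<le> B" using \<kappa>(2) by blast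
  define V where "V \<xi> = of_real (\<kappa> (norm \<xi> / 2)) * Q_hat 4 q \<xi>" for \<xi>
  \<comment> \<open>Since \<open>C\<^sub>0\<close> exceeds 1, the cutoff removes all frequencies
    with k < 1, which the decay estimate does not reach.\<close>
  have small: "\<kappa> (norm \<xi> / 2) = 0" if "norm \<xi> < 2" for \<xi> :: "real^3"
    using \<kappa>(3)[of "norm \<xi> / 2"] assms(6) that by simp
  have V_bd: "norm (V \<xi>) \<le> B * C * (1 + norm \<xi>) powr (- e)" for \<xi>
  proof (cases "norm \<xi> < 2")
    case True
    then show ?thesis using small B C by (simp add: V_def)
  next
    case False
    then have "norm (V \<xi>) \<le> B * (C * (1 + norm \<xi>) powr (- e))"
      unfolding V_def norm_mult norm_of_real by (intro mult_mono B C) auto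
    then show ?thesis by (simp add: mult.assoc)
  qed
  \<comment> \<open>\<open>Q_hat\<close> may be replaced by \<open>born_integral\<close>, because
    the cutoff vanishes wherever the two might differ.\<close>
  have [measurable]: "V \<in> borel_measurable borel"
  proof -
    have m: "(\<lambda>\<xi>. born_integral q R 3 \<xi> (\<xi> /\<^sub>R 2)) \<in> borel_measurable borel"
      using measurable_compose[OF measurable_Pair borel_measurable_born_integral[OF q R(2,1) q2, of 3], of "\<lambda>\<xi>. \<xi>" borel "\<lambda>\<xi>. \<xi> /\<^sub>R 2"]
      by simp
    have "V = (\<lambda>\<xi>. of_real (\<kappa> (norm \<xi> / 2)) * born_integral q R 3 \<xi> (\<xi> /\<^sub>R 2))"
    proof (rule ext)
      fix \<xi>
      show "V \<xi> = of_real (\<kappa> (norm \<xi> / 2)) * born_integral q R 3 \<xi> (\<xi> /\<^sub>R 2)"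
        using small[of \<xi>] Q_hat_eq_born_integral[OF q R(2,1) q2, of \<xi> 3] by (cases "norm \<xi> < 2") (auto simp: V_def)
    qed
    then show ?thesis using m by simp
  qed
  have "inv_fourier_dist (dist_of V) \<in> sobolev \<beta>"
  proof (rule inv_fourier_dist_in_sobolev)
    fix \<xi> :: "real^3"
    have "(1 + norm \<xi>) powr (- e) \<le> (1 + norm \<xi>) powr 0" using e0 by (intro powr_mono) auto
    also have "\<dots> \<le> 1" by simp
    finally have "B * C * (1 + norm \<xi>) powr (- e) \<le> B * C * 1" using B C by (intro mult_left_mono) auto
    then show "norm (V \<xi>) \<le> B * C" using V_bd[of \<xi>] by linarith
  next
    have i: "integrable lborel (\<lambda>\<xi>::real^3. (B * C)\<^sup>2 * (1 + norm \<xi>) powr (- (2 * e - 2 * \<beta>)))"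
      using e3 by (intro integrable_mult_right integrable_one_plus_norm_powr) simp
    show "integrable lborel (\<lambda>\<xi>. (norm (V \<xi>))\<^sup>2 * (1 + (norm \<xi>)\<^sup>2) powr \<beta>)"
    proof (rule Bochner_Integration.integrable_bound[OF i])
      show "AE \<xi> in lborel. norm ((norm (V \<xi>))\<^sup>2 * (1 + (norm \<xi>)\<^sup>2) powr \<beta>) \<le> norm ((B * C)\<^sup>2 * (1 + norm \<xi>) powr (- (2 * e - 2 * \<beta>)))"
      proof (rule AE_I2)
        fix \<xi> :: "real^3"
        have "(1 + (norm \<xi>)\<^sup>2) powr \<beta> \<le> ((1 + norm \<xi>)\<^sup>2) powr \<beta>"
          using assms(8) by (intro powr_mono2) (auto simp: power2_sum)
        also have "\<dots> = (1 + norm \<xi>) powr (2 * \<beta>)"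
          using add_pos_nonneg[of 1 "norm \<xi>"] by (simp add: powr_powr flip: powr_numeral)
        finally have "(norm (V \<xi>))\<^sup>2 * (1 + (norm \<xi>)\<^sup>2) powr \<beta> \<le> (B * C * (1 + norm \<xi>) powr (- e))\<^sup>2 * (1 + norm \<xi>) powr (2 * \<beta>)"
          by (intro mult_mono power_mono V_bd) auto
        also have "\<dots> = (B * C)\<^sup>2 * (1 + norm \<xi>) powr (- (2 * e - 2 * \<beta>))"
        proof -
          have "- (2 * e - 2 * \<beta>) = (- e + - e) + 2 * \<beta>" by simp
          then have "(1 + norm \<xi>) powr (- (2 * e - 2 * \<beta>)) = ((1 + norm \<xi>) powr (- e))\<^sup>2 * (1 + norm \<xi>) powr (2 * \<beta>)"
            by (simp only: powr_add power2_eq_square)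
          then show ?thesis by (simp only: power_mult_distrib mult_ac)
        qed
        finally show "norm ((norm (V \<xi>))\<^sup>2 * (1 + (norm \<xi>)\<^sup>2) powr \<beta>) \<le> norm ((B * C)\<^sup>2 * (1 + norm \<xi>) powr (- (2 * e - 2 * \<beta>)))"
          by simp
      qed
    qed measurable
  qed measurable
  then show ?thesis unfolding Q_high_def V_def .
qed

end
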